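(* There exist constants $0 < A \leq B < \infty$ such that for every convex curve $\Gamma \subseteq \mathbb{R}^2$ we have, as measures on $\Gamma$, $$A\, \nu \leq \mu \leq B\, \nu,$$ that is, $A\,\nu(E) \leq \mu(E) \leq B\,\nu(E)$ for every Borel set $E \subseteq \Gamma$, where $\mu$ is the affine measure on $\mathbb{R}^2$ restricted to $\Gamma$ and $\nu$ is the affine arclength measure on $\Gamma$. The constants $A, B$ do not depend on $\Gamma$.
   Context: Convex curve: a convex curve $\Gamma \subseteq \mathbb{R}^2$ is the boundary $\partial K$ of a non-empty open convex set $K \subseteq \mathbb{R}^2$. No smoothness is assumed. Affine arclength measure $\nu$ (compact case): a compact convex curve $\Gamma$ (that is, $K$ bounded) is rectifiable; let $z \colon J = [0,\ell(\Gamma)) \to \Gamma$ be a counterclockwise arclength parametrization, where $\ell(\Gamma)$ is the length of $\Gamma$. The one-sided derivatives of $z$ exist everywhere as unit vectors (with $z$ extended periodically at the endpoints) and agree Lebesgue-almost everywhere, giving $z'$; they are themselves differentiable Lebesgue-almost everywhere with a common derivative $z''$, and $\det\begin{pmatrix} z'(t) & z''(t)\end{pmatrix} \geq 0$ for almost every $t$. The measure $\nu$ on $J$ is defined by $$d\nu(t) = \sqrt[3]{\det \begin{pmatrix} z'(t) & z''(t) \end{pmatrix}}\, dt,$$ and $\nu$ also denotes its push-forward to $\Gamma$ via $z$. Affine arclength measure $\nu$ (non-compact case): for $N \in \mathbb{N}$ large enough that $K \cap (-N,N)^2 \neq \varnothing$, let $\Gamma_N = \partial(K \cap [-N,N]^2)$,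 a compact convex curve, with affine arclength measure $\nu_{\Gamma_N}$. Then $\nu$ on $\Gamma$ is the Borel measure $\nu(E) = \lim_{N \to \infty} \nu_{\Gamma_N}(E \cap (-N,N)^2)$. Affine measure $\mu$ on $\mathbb{R}^2$: for $\delta > 0$ let $\mathcal{R}^\delta$ be the collection of all rectangles in $\mathbb{R}^2$ (of arbitrary orientation) with diameter at most $\delta$, and let $|R|$ be the Lebesgue measure (area) of a rectangle $R$. For $E \subseteq \mathbb{R}^2$ define $$\mu^\delta(E) = \inf\Big\{ \sum_{R \in \mathcal{R}'} |R|^{1/3} : \mathcal{R}' \subseteq \mathcal{R}^\delta \text{ at most countable},\ E \subseteq \bigcup_{R \in \mathcal{R}'} R \Big\}, \qquad \mu^\ast(E) = \lim_{\delta \to 0} \mu^\delta(E).$$ The affine measure $\mu$ is the restriction of the outer measure $\mu^\ast$ to its Carathéodory measurable sets; $\mu$ also denotes its restriction to $\Gamma$. *)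

theory Defs
  imports "HOL-Complex_Analysis.Complex_Analysis"
begin

section \<open>Arclength parametrizations\<close>

definition arc_length :: "(real \<Rightarrow> real^2) \<Rightarrow> real \<Rightarrow> real \<Rightarrow> ennreal" where
  "arc_length z s t =
     (SUP (n, p) \<in> {(n :: nat, p :: nat \<Rightarrow> real). mono p \<and> p 0 = s \<and> p n = t}.
        ennreal (\<Sum>i<n. dist (z (p i)) (z (p (Suc i)))))"

definition complex_of_plane :: "real^2 \<Rightarrow> complex" where
  "complex_of_plane v = Complex (v $ 1) (v $ 2)"

text \<open>
  A counterclockwise arclength parametrization on \<open>[0, L)\<close> of a closed curve \<open>\<Gamma>\<close>, extended
  \<open>L\<close>-periodically to the real line. The conditions force \<open>L\<close> to be the length of \<open>\<Gamma>\<close>.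
  Counterclockwise means winding number \<open>1\<close> around the points enclosed by \<open>\<Gamma>\<close>.
\<close>

definition ccw_arclength_parametrization :: "(real^2) set \<Rightarrow> real \<Rightarrow> (real \<Rightarrow> real^2) \<Rightarrow> bool" where
  "ccw_arclength_parametrization \<Gamma> L z \<longleftrightarrow>
     bij_betw z {0..<L} \<Gamma> \<and>
     (\<forall>t. z (t + L) = z t) \<and>
     (\<forall>s t. s \<le> t \<longrightarrow> arc_length z s t = ennreal (t - s)) \<and>
     (\<forall>p \<in> inside \<Gamma>. winding_number (\<lambda>s. complex_of_plane (z (L * s))) (complex_of_plane p) = 1)"

section \<open>Affine arclength measure\<close>

definition right_derivative :: "(real \<Rightarrow> real^2) \<Rightarrow> real \<Rightarrow> real^2" where
  "right_derivative z t = vector_derivative z (at_right t)"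

text \<open>
  The right derivative serves as \<open>z'\<close> because it is defined everywhere: \<open>vector_derivative z (at t)\<close>
  is arbitrary at the corners of the curve, which may be dense, and this would affect the
  derivative of \<open>z'\<close> even at the other points.
\<close>

definition affine_density :: "(real \<Rightarrow> real^2) \<Rightarrow> real \<Rightarrow> real" where
  "affine_density z t =
     root 3 (det (transpose (vector
       [right_derivative z t, vector_derivative (right_derivative z) (at t)] :: real^2^2)))"

text \<open>
  All measures on a curve are regarded as Borel measures on the plane that are concentrated on
  the curve.
\<close>

definition param_affine_arclength :: "real \<Rightarrow> (real \<Rightarrow> real^2) \<Rightarrow> (real^2) measure" where
  "param_affine_arclength L z =
     distr (density (lebesgue_on {0..<L}) (\<lambda>t. ennreal (affine_density z t))) borel z"

definition compact_affine_arclength :: "(real^2) set \<Rightarrow> (real^2) measure" where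
  "compact_affine_arclength \<Gamma> =
     (let (L, z) = (SOME (L, z). ccw_arclength_parametrization \<Gamma> L z)
      in param_affine_arclength L z)"

abbreviation open_square :: "nat \<Rightarrow> (real^2) set" where
  "open_square N \<equiv> box (\<chi> i. - real N) (\<chi> i. real N)"

abbreviation closed_square :: "nat \<Rightarrow> (real^2) set" where
  "closed_square N \<equiv> cbox (\<chi> i. - real N) (\<chi> i. real N)"

text \<open>
  The argument is the open convex set \<open>K\<close> that the curve \<open>frontier K\<close> bounds. In the
  unbounded case the finitely many \<open>N\<close> for which \<open>K\<close> misses the open square are irrelevant
  to the limit.
\<close>

definition affine_arclength :: "(real^2) set \<Rightarrow> (real^2) measure" where
  "affine_arclength K =
     (if bounded K then compact_affine_arclength (frontier K)
      else measure_of UNIV (sets borel)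
        (\<lambda>E. lim (\<lambda>N. emeasure (compact_affine_arclength (frontier (K \<inter> closed_square N)))
                         (E \<inter> open_square N))))"

section \<open>Affine measure on the plane\<close>

definition rectangles :: "real \<Rightarrow> (real^2) set set" where
  "rectangles \<delta> =
     {R. diameter R \<le> \<delta> \<and>
         (\<exists>(f :: real^2 \<Rightarrow> real^2) c a b. orthogonal_transformation f \<and> 0 < a \<and> 0 < b \<and>
            R = (\<lambda>x. c + f x) ` cbox 0 (vector [a, b]))}"

definition affine_premeasure :: "real \<Rightarrow> (real^2) set \<Rightarrow> ennreal" where
  "affine_premeasure \<delta> E =
     (INF C \<in> {C. C \<subseteq> rectangles \<delta> \<and> countable C \<and> E \<subseteq> \<Union> C}.
        \<Sum>\<^sub>\<infinity>R\<in>C. ennreal (root 3 (measure lebesgue R)))"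

definition affine_outer_measure :: "(real^2) set \<Rightarrow> ennreal" where
  "affine_outer_measure E = Lim (at_right 0) (\<lambda>\<delta>. affine_premeasure \<delta> E)"

text \<open>\<open>lambda_system\<close> is the family of Caratheodory measurable sets.\<close>

definition affine_measure :: "(real^2) measure" where
  "affine_measure =
     measure_of UNIV (lambda_system UNIV (Pow UNIV) affine_outer_measure) affine_outer_measure"

end

theory Submission
  imports Defs
begin

text \<open>
  Seen from a point of the bounded convex set, an arclength parametrization \<open>z\<close> of its frontier has
  an increasing polar angle because its winding number is \<open>1\<close>, and hence \<open>z\<close> has the right derivative
  \<open>(cos \<alpha>, sin \<alpha>)\<close> for an increasing right-continuous tangent angle \<open>\<alpha>\<close>. By Lebesgue's theorem
  \<open>\<alpha>\<close> is differentiable almost everywhere, so \<open>\<nu>\<close> has density \<open>root 3 \<alpha>'\<close>, whatever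
  the singular part of \<open>\<alpha>\<close>.

  For \<open>\<mu> \<le> B \<nu>\<close>, an arc of length \<open>h\<close> along which \<open>\<alpha>\<close> increases by \<open>\<Delta>\<close> lies in a rectangle of area
  about \<open>h\<^sup>2 \<Delta>\<close>, of cost \<open>h root 3 (\<Delta> / h)\<close>. Summing over equal cells gives the integral of the
  cube root of the difference quotient of \<open>\<alpha>\<close>, which is uniformly integrable and converges to \<open>\<nu>\<close> of
  the arc; outer regularity extends the bound from arcs to Borel sets.

  For \<open>A \<nu> \<le> \<mu>\<close> it suffices that \<open>\<nu>(R) \<le> A\<inverse> root 3 |R|\<close> for every rectangle \<open>R\<close>. On the part of the
  curve whose tangent stays within an octant relative to \<open>R\<close>, the points in \<open>R\<close> have parameters in an
  interval \<open>[s, t]\<close>, and the inequality of the means bounds \<open>root 3 \<alpha>'\<close> by a combination of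
  \<open>(t - r) \<alpha>'(r)\<close>, whose integral is at most the height of the arc, and \<open>1 / sqrt (t - r)\<close>.

  For unbounded sets the truncations are compatible: two arclength parametrizations of curves that
  agree in an open set differ there locally by a translation of the parameter.
\<close>

text \<open>The measure d\<alpha> may have atoms and a singular part, while \<nu> sees only
  \<alpha>'. Each bound copes in its own way. Above, the cube root is sublinear: cutting it off at
  height \<open>T\<close> costs at most the total turning divided by \<open>T^2\<close>, for every
  mesh, so concentrated turning disappears as \<open>T\<close> grows. Below, only the inequality
  between the integral of \<alpha>' and the increment of \<alpha> enters, and integration by parts
  becomes Abel summation on a grid of mesh \<open>h\<close>; adding \<open>h\<close> to the weight
  \<open>t - r\<close> also removes the singularity of the inverse square root.

  Octants are used because a frame axis bounds each of them. Within one, the arc length is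
  comparable with the chord component along that axis, and the turning is comparable with the sine
  of the angle to the axis. Hence the integral of \<open>\<alpha> r - \<alpha> s\<close> is at most
  twice the height of the chord, and length times height is at most twice the area of
  \<open>R\<close>.

  Constants: \<open>root 3 4\<close> comes from rectangles twice as long and twice as high as the
  displacements they must contain. An octant contributes at most \<open>3 * root 3 |R|\<close>, and
  13 octants cover the window of width \<open>3 * pi\<close> containing \<alpha>, which gives
  39.\<close>

section \<open>The affine measure on Borel sets\<close>

lemma infsum_ennreal_eq_nn_integral:
  fixes f :: "'a \<Rightarrow> ennreal"
  assumes "countable A"
  shows "infsum f A = (\<integral>\<^sup>+x. f x \<partial>count_space A)"
proof (cases "finite A")
  case True
  then show ?thesis by (simp add: nn_integral_count_space_finite)
next
  case False
  let ?g = "from_nat_into A"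
  have bij: "bij_betw ?g UNIV A"
    using assms False bij_betw_from_nat_into by blast
  have "infsum f A = infsum (\<lambda>n. f (?g n)) UNIV"
    using infsum_reindex_bij_betw[OF bij, of f] by simp
  also have "\<dots> = (\<Sum>n. f (?g n))"
  proof -
    have "((\<lambda>n. f (?g n)) has_sum infsum (\<lambda>n. f (?g n)) UNIV) UNIV"
      by (intro has_sum_infsum nonneg_summable_on_complete) simp
    then show ?thesis
      using has_sum_imp_sums sums_unique by blast
  qed
  also have "\<dots> = (\<integral>\<^sup>+n. f (?g n) \<partial>count_space UNIV)"
    by (simp add: nn_integral_count_space_nat)
  also have "\<dots> = (\<integral>\<^sup>+x. f x \<partial>count_space A)"
    by (rule nn_integral_bij_count_space[OF bij])
  finally show ?thesis .
qed

text \<open>Covers are sets of rectangles, so covers of different sets may share members. Reading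
  the total cost as a weighted counting measure lets subadditivity of a measure deal with such
  overlaps.\<close>

lemma infsum_ennreal_eq_emeasure:
  fixes f :: "'a \<Rightarrow> ennreal"
  assumes "countable A"
  shows "infsum f A = emeasure (density (count_space UNIV) f) A"
  by (simp add: infsum_ennreal_eq_nn_integral[OF assms] emeasure_density
      nn_integral_count_space_indicator)

section \<open>Covers by small rectangles\<close>

lemma rectangles_mono: "\<delta> \<le> \<delta>' \<Longrightarrow> rectangles \<delta> \<subseteq> rectangles \<delta>'"
  by (auto simp: rectangles_def)

lemma rectangles_compact:
  assumes "R \<in> rectangles \<delta>"
  shows "compact R"
proof -
  obtain f c a b where f: "orthogonal_transformation f"
    and R: "R = (\<lambda>x. c + f x) ` cbox 0 (vector [a, b] :: real^2)"
    using assms by (auto simp: rectangles_def)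
  have "continuous_on (cbox 0 (vector [a, b] :: real^2)) f"
    using f by (simp add: linear_continuous_on linear_linear orthogonal_transformation_linear)
  then show ?thesis
    unfolding R by (intro compact_continuous_image continuous_intros) auto
qed

lemma affine_premeasure_mono: "E \<subseteq> F \<Longrightarrow> affine_premeasure \<delta> E \<le> affine_premeasure \<delta> F"
  unfolding affine_premeasure_def by (rule INF_superset_mono) auto

lemma affine_premeasure_antimono:
  "\<delta> \<le> \<delta>' \<Longrightarrow> affine_premeasure \<delta>' E \<le> affine_premeasure \<delta> E"
  unfolding affine_premeasure_def
  by (rule INF_superset_mono) (use rectangles_mono in blast)+

lemma affine_premeasure_le:
  assumes "countable C" "C \<subseteq> rectangles \<delta>" "E \<subseteq> \<Union>C"
  shows "affine_premeasure \<delta> E \<le> (\<Sum>\<^sub>\<infinity>R\<in>C. ennreal (root 3 (measure lebesgue R)))"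
  unfolding affine_premeasure_def by (rule INF_lower) (use assms in auto)

lemma affine_premeasure_empty [simp]: "affine_premeasure \<delta> {} = 0"
  using affine_premeasure_le[of "{}" \<delta> "{}"] by simp

lemma affine_premeasure_countably_subadditive:
  fixes E :: "nat \<Rightarrow> (real^2) set"
  shows "affine_premeasure \<delta> (\<Union>i. E i) \<le> (\<Sum>i. affine_premeasure \<delta> (E i))"
proof (cases "\<forall>i. affine_premeasure \<delta> (E i) < \<infinity>")
  case True
  let ?w = "\<lambda>R :: (real^2) set. ennreal (root 3 (measure lebesgue R))"
  show ?thesis
  proof (rule ennreal_le_epsilon)
    fix e :: real assume "0 < e"
    have "\<exists>C. C \<subseteq> rectangles \<delta> \<and> countable C \<and> E i \<subseteq> \<Union>C \<and>
        infsum ?w C < affine_premeasure \<delta> (E i) + ennreal (e * (1/2) ^ Suc i)" for i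
    proof -
      have "affine_premeasure \<delta> (E i) < affine_premeasure \<delta> (E i) + ennreal (e * (1/2) ^ Suc i)"
        using True[rule_format, of i] \<open>0 < e\<close>
        by (cases "affine_premeasure \<delta> (E i)") (auto simp: ennreal_plus[symmetric] ennreal_less_iff simp del: ennreal_plus)
      then show ?thesis
        unfolding affine_premeasure_def INF_less_iff by blast
    qed
    then obtain C where C: "\<And>i. C i \<subseteq> rectangles \<delta>" "\<And>i. countable (C i)" "\<And>i. E i \<subseteq> \<Union>(C i)"
      "\<And>i. infsum ?w (C i) < affine_premeasure \<delta> (E i) + ennreal (e * (1/2) ^ Suc i)"
      by metis
    have "affine_premeasure \<delta> (\<Union>i. E i) \<le> infsum ?w (\<Union>i. C i)"
    proof (rule affine_premeasure_le)
      show "(\<Union>i. E i) \<subseteq> \<Union> (\<Union>i. C i)"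
        using C(3) by (simp add: subset_iff) metis
    qed (use C(1,2) in auto)
    also have "\<dots> = emeasure (density (count_space UNIV) ?w) (\<Union>i. C i)"
      by (rule infsum_ennreal_eq_emeasure) (use C in auto)
    also have "\<dots> \<le> (\<Sum>i. emeasure (density (count_space UNIV) ?w) (C i))"
      by (rule emeasure_subadditive_countably) auto
    also have "\<dots> = (\<Sum>i. infsum ?w (C i))"
      using C by (simp add: infsum_ennreal_eq_emeasure)
    also have "\<dots> \<le> (\<Sum>i. affine_premeasure \<delta> (E i) + ennreal (e * (1/2) ^ Suc i))"
      by (intro suminf_le) (use C(4) less_imp_le in auto)
    also have "\<dots> = (\<Sum>i. affine_premeasure \<delta> (E i)) + (\<Sum>i. ennreal (e * (1/2) ^ Suc i))"
      by (rule suminf_add[symmetric]) auto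
    also have "(\<Sum>i. ennreal (e * (1/2) ^ Suc i)) = ennreal e"
    proof (rule suminf_ennreal_eq)
      show "(\<lambda>i. e * (1/2) ^ Suc i) sums e"
        using sums_mult[OF power_half_series, of e] by simp
    qed (use \<open>0 < e\<close> in auto)
    finally show "affine_premeasure \<delta> (\<Union>i. E i) \<le> (\<Sum>i. affine_premeasure \<delta> (E i)) + ennreal e" .
  qed
next
  case False
  then obtain i where "affine_premeasure \<delta> (E i) = \<infinity>"
    by (metis infinity_ennreal_def less_top)
  then have "(\<Sum>i. affine_premeasure \<delta> (E i)) = \<infinity>"
    by (metis ennreal_suminf_lessD infinity_ennreal_def less_top order_less_irrefl)
  then show ?thesis by simp
qed

text \<open>A smaller \<delta> admits fewer covers, so the premeasures increase as \<delta>
  decreases to 0. Their limit therefore exists, and the operator \<open>Lim\<close> has its intended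
  meaning.\<close>

lemma affine_outer_measure_eq_SUP:
  "affine_outer_measure E = (SUP \<delta>\<in>{0<..}. affine_premeasure \<delta> E)"
  unfolding affine_outer_measure_def
proof (rule tendsto_Lim)
  show "((\<lambda>\<delta>. affine_premeasure \<delta> E) \<longlongrightarrow> (SUP \<delta>\<in>{0<..}. affine_premeasure \<delta> E)) (at_right 0)"
  proof (rule order_tendstoI)
    fix a assume "a < (SUP \<delta>\<in>{0<..}. affine_premeasure \<delta> E)"
    then obtain d where d: "d > 0" "a < affine_premeasure d E"
      by (auto simp: less_SUP_iff)
    then have "\<forall>\<^sub>F x in at_right 0. x \<le> d"
      unfolding eventually_at_right_field by (auto intro: exI[of _ d])
    then show "\<forall>\<^sub>F x in at_right 0. a < affine_premeasure x E"
      by (rule eventually_mono) (use d affine_premeasure_antimono order_less_le_trans in blast)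
  next
    fix a assume a: "(SUP \<delta>\<in>{0<..}. affine_premeasure \<delta> E) < a"
    have "\<forall>\<^sub>F x in at_right (0::real). x \<in> {0<..}"
      unfolding eventually_at_right_field by (auto intro: exI[of _ 1])
    then show "\<forall>\<^sub>F x in at_right 0. affine_premeasure x E < a"
    proof (rule eventually_mono)
      fix x :: real assume "x \<in> {0<..}"
      then have "affine_premeasure x E \<le> (SUP \<delta>\<in>{0<..}. affine_premeasure \<delta> E)"
        by (rule SUP_upper)
      with a show "affine_premeasure x E < a" by (rule order_le_less_trans[rotated])
    qed
  qed
qed simp

lemma affine_premeasure_le_outer: "\<delta> > 0 \<Longrightarrow> affine_premeasure \<delta> E \<le> affine_outer_measure E"
  unfolding affine_outer_measure_eq_SUP by (rule SUP_upper) auto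

lemma affine_outer_measure_leI:
  "(\<And>\<delta>. \<delta> > 0 \<Longrightarrow> affine_premeasure \<delta> E \<le> c) \<Longrightarrow> affine_outer_measure E \<le> c"
  unfolding affine_outer_measure_eq_SUP by (rule SUP_least) auto

lemma affine_outer_measure_mono: "E \<subseteq> F \<Longrightarrow> affine_outer_measure E \<le> affine_outer_measure F"
  by (meson affine_outer_measure_leI affine_premeasure_le_outer affine_premeasure_mono order_trans)

lemma affine_outer_measure_empty [simp]: "affine_outer_measure {} = 0"
  by (simp add: affine_outer_measure_eq_SUP)

lemma affine_outer_measure_countably_subadditive:
  fixes E :: "nat \<Rightarrow> (real^2) set"
  shows "affine_outer_measure (\<Union>i. E i) \<le> (\<Sum>i. affine_outer_measure (E i))"
proof (rule affine_outer_measure_leI)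
  fix \<delta> :: real assume "\<delta> > 0"
  have "affine_premeasure \<delta> (\<Union>i. E i) \<le> (\<Sum>i. affine_premeasure \<delta> (E i))"
    by (rule affine_premeasure_countably_subadditive)
  also have "\<dots> \<le> (\<Sum>i. affine_outer_measure (E i))"
    by (intro suminf_le affine_premeasure_le_outer) (use \<open>\<delta> > 0\<close> in auto)
  finally show "affine_premeasure \<delta> (\<Union>i. E i) \<le> (\<Sum>i. affine_outer_measure (E i))" .
qed

lemma affine_outer_measure_space: "outer_measure_space (Pow UNIV) affine_outer_measure"
  unfolding outer_measure_space_def positive_def increasing_def countably_subadditive_def
  by (simp add: affine_outer_measure_mono affine_outer_measure_countably_subadditive)

section \<open>The Caratheodory criterion for metric outer measures\<close>

lemma affine_outer_measure_Un:
  "affine_outer_measure (A \<union> B) \<le> affine_outer_measure A + affine_outer_measure B"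
proof -
  define F where "F = (\<lambda>i::nat. if i = 0 then A else if i = 1 then B else {})"
  have "affine_outer_measure (\<Union>i. F i) \<le> (\<Sum>i. affine_outer_measure (F i))"
    by (rule affine_outer_measure_countably_subadditive)
  also have "\<dots> = (\<Sum>i<2. affine_outer_measure (F i))"
    by (rule suminf_finite) (auto simp: F_def)
  also have "\<dots> = affine_outer_measure A + affine_outer_measure B"
    by (simp add: F_def numeral_2_eq_2)
  also have "(\<Union>i. F i) = A \<union> B"
    by (auto simp: F_def split: if_splits)
  finally show ?thesis .
qed

text \<open>A rectangle of diameter less than \<open>d\<close> cannot meet both sets, so a fine
  cover of the union splits into disjoint covers of the two parts.\<close>

lemma affine_outer_measure_Un_separated:
  assumes "d > 0" and d: "\<And>x y. x \<in> A \<Longrightarrow> y \<in> B \<Longrightarrow> d \<le> dist x y"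
  shows "affine_outer_measure A + affine_outer_measure B \<le> affine_outer_measure (A \<union> B)"
proof -
  let ?w = "\<lambda>R :: (real^2) set. ennreal (root 3 (measure lebesgue R))"
  have "affine_premeasure a A + affine_premeasure b B \<le> affine_outer_measure (A \<union> B)"
    if "a > 0" "b > 0" for a b
  proof -
    define \<delta> where "\<delta> = min (min a b) (d / 2)"
    have \<delta>: "\<delta> > 0" "\<delta> \<le> a" "\<delta> \<le> b" "\<delta> < d"
      using that \<open>d > 0\<close> by (auto simp: \<delta>_def)
    have "affine_premeasure \<delta> A + affine_premeasure \<delta> B \<le> affine_premeasure \<delta> (A \<union> B)"
      unfolding affine_premeasure_def[of \<delta> "A \<union> B"]
    proof (rule INF_greatest)
      fix C assume "C \<in> {C. C \<subseteq> rectangles \<delta> \<and> countable C \<and> A \<union> B \<subseteq> \<Union> C}"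
      then have C: "C \<subseteq> rectangles \<delta>" "countable C" "A \<union> B \<subseteq> \<Union> C" by auto
      define CA where "CA = {R\<in>C. R \<inter> A \<noteq> {}}"
      define CB where "CB = {R\<in>C. R \<inter> B \<noteq> {}}"
      have sub: "CA \<subseteq> C" "CB \<subseteq> C" by (auto simp: CA_def CB_def)
      have cnt: "countable CA" "countable CB"
        using sub C(2) countable_subset by blast+
      have disj: "CA \<inter> CB = {}"
      proof (rule ccontr)
        assume "CA \<inter> CB \<noteq> {}"
        then obtain R x y where R: "R \<in> C" "x \<in> R" "x \<in> A" "y \<in> R" "y \<in> B"
          by (auto simp: CA_def CB_def)
        then have "R \<in> rectangles \<delta>" using C by auto
        then have "bounded R"
          using rectangles_compact compact_imp_bounded by blast
        moreover have "diameter R \<le> \<delta>"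
          using \<open>R \<in> rectangles \<delta>\<close> by (simp add: rectangles_def)
        ultimately have "dist x y \<le> \<delta>"
          using diameter_bounded_bound[of R x y] R by simp
        with d[of x y] R \<delta> show False by simp
      qed
      have "affine_premeasure \<delta> A + affine_premeasure \<delta> B \<le> infsum ?w CA + infsum ?w CB"
      proof (intro add_mono affine_premeasure_le cnt)
        show "A \<subseteq> \<Union>CA" "B \<subseteq> \<Union>CB"
          using C(3) unfolding CA_def CB_def by blast+
      qed (use sub C in auto)
      also have "\<dots> = infsum ?w (CA \<union> CB)"
        by (rule infsum_Un_disjoint[symmetric]) (auto simp: disj intro!: nonneg_summable_on_complete)
      also have "\<dots> \<le> infsum ?w C"
        by (rule infsum_mono_neutral) (use sub in \<open>auto intro!: nonneg_summable_on_complete\<close>)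
      finally show "affine_premeasure \<delta> A + affine_premeasure \<delta> B \<le> infsum ?w C" .
    qed
    then show ?thesis
      using affine_premeasure_antimono[OF \<delta>(2), of A] affine_premeasure_antimono[OF \<delta>(3), of B]
        affine_premeasure_le_outer[OF \<delta>(1), of "A \<union> B"]
      by (meson add_mono order_trans)
  qed
  then have "affine_premeasure a A + affine_outer_measure B \<le> affine_outer_measure (A \<union> B)"
    if "a > 0" for a
    using that unfolding affine_outer_measure_eq_SUP[of B]
    by (subst ennreal_SUP_add_right) (auto intro!: SUP_least)
  then show ?thesis
    unfolding affine_outer_measure_eq_SUP[of A]
    by (subst ennreal_SUP_add_left[symmetric]) (auto intro!: SUP_least)
qed

text \<open>One distance \<open>d\<close> separates \<open>D i\<close> from all later sets at once,
  so the first set can be split off a finite union and induction handles the rest.\<close>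

lemma affine_outer_measure_separated_sum:
  fixes D :: "nat \<Rightarrow> (real^2) set"
  assumes sep: "\<And>i j. i < j \<Longrightarrow> \<exists>d>0. \<forall>k\<ge>j. \<forall>x\<in>D i. \<forall>y\<in>D k. d \<le> dist x y"
  shows "(\<Sum>i<n. affine_outer_measure (D i)) \<le> affine_outer_measure (\<Union>i<n. D i)"
proof -
  have "(\<Sum>i\<in>{m..<m+n}. affine_outer_measure (D i)) \<le> affine_outer_measure (\<Union>i\<in>{m..<m+n}. D i)" for m n
  proof (induction n arbitrary: m)
    case (Suc n)
    obtain d where d: "d > 0" "\<And>k x y. k \<ge> Suc m \<Longrightarrow> x \<in> D m \<Longrightarrow> y \<in> D k \<Longrightarrow> d \<le> dist x y"
      using sep[of m "Suc m"] by auto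
    have eq: "{m..<m + Suc n} = insert m {Suc m..<Suc m + n}" by auto
    have "(\<Sum>i\<in>{m..<m+Suc n}. affine_outer_measure (D i))
        \<le> affine_outer_measure (D m) + affine_outer_measure (\<Union>i\<in>{Suc m..<Suc m+n}. D i)"
      unfolding eq using Suc.IH[of "Suc m"] by (simp add: add_left_mono)
    also have "\<dots> \<le> affine_outer_measure (D m \<union> (\<Union>i\<in>{Suc m..<Suc m+n}. D i))"
      by (rule affine_outer_measure_Un_separated[OF d(1)]) (use d(2) in auto)
    also have "D m \<union> (\<Union>i\<in>{Suc m..<Suc m+n}. D i) = (\<Union>i\<in>{m..<m+Suc n}. D i)"
      unfolding eq by simp
    finally show ?case .
  qed simp
  from this[of 0 n] show ?thesis by (simp add: lessThan_atLeast0)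
qed

lemma ennreal_suminf_tail_small:
  fixes a :: "nat \<Rightarrow> ennreal"
  assumes "(\<Sum>i. a i) < \<infinity>" "e > 0"
  shows "\<exists>n. (\<Sum>i. a (i + n)) \<le> ennreal e"
proof -
  have "a i < \<infinity>" for i
    using assms(1) by (rule ennreal_suminf_lessD)
  then have a: "a i = ennreal (enn2real (a i))" for i
    by simp
  have "summable (\<lambda>i. enn2real (a i))"
    by (rule summable_suminf_not_top) (use assms a in \<open>auto simp: less_top[symmetric]\<close>)
  from suminf_exist_split[OF \<open>e > 0\<close> this]
  obtain n where n: "norm (\<Sum>i. enn2real (a (i + n))) < e" by blast
  have "(\<Sum>i. a (i + n)) = (\<Sum>i. ennreal (enn2real (a (i + n))))"
    using a by presburger
  also have "\<dots> = ennreal (\<Sum>i. enn2real (a (i + n)))"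
    using summable_ignore_initial_segment[OF \<open>summable _\<close>, of n]
    by (intro suminf_ennreal2) auto
  also have "\<dots> \<le> ennreal e"
    using n by (intro ennreal_leI) auto
  finally show ?thesis by blast
qed

text \<open>Outside \<open>F\<close>, the set \<open>X\<close> is exhausted by the parts
  \<open>Y n\<close> at distance at least \<open>1 / (n + 1)\<close> from \<open>F\<close>, on which
  additivity with \<open>F \<inter> X\<close> is the separated case. What remains lies in thin
  shells around \<open>F\<close> whose measures have a finite sum, so its measure tends to
  0.\<close>

lemma closed_in_lambda_system:
  assumes "closed F"
  shows "F \<in> lambda_system UNIV (Pow UNIV) affine_outer_measure"
proof (cases "F = {}")
  case True
  then show ?thesis by (simp add: lambda_system_def)
next
  case False
  let ?O = affine_outer_measure
  have "?O (F \<inter> X) + ?O ((UNIV - F) \<inter> X) \<le> ?O X" for X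
  proof (cases "?O X = \<infinity>")
    case False
    \<comment> \<open>Neighbouring shells touch, but shells \<open>k\<close> and
      \<open>l \<ge> k + 2\<close> are separated: the distance to \<open>F\<close> is at least
      \<open>1 / (k + 2)\<close> on the first and less than \<open>1 / (k + 3)\<close> on the
      second.\<close>
    define D where "D k = {x\<in>X. 1 / (k + 2) \<le> infdist x F \<and> infdist x F < 1 / (k + 1)}" for k :: nat
    define Y where "Y n = {x\<in>X. 1 / (n + 1) \<le> infdist x F}" for n :: nat
    have sep: "\<exists>d>0. \<forall>l\<ge>k+2. \<forall>x\<in>D k. \<forall>y\<in>D l. d \<le> dist x y" for k
    proof (intro exI[of _ "1 / (real k + 2) - 1 / (real k + 3)"] conjI allI impI ballI)
      show "0 < 1 / (real k + 2) - 1 / (real k + 3)"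
        by (simp add: frac_less2)
      fix l x y assume l: "k + 2 \<le> l" and x: "x \<in> D k" and y: "y \<in> D l"
      have "1 / (real l + 1) \<le> 1 / (real k + 3)"
        using l by (intro divide_left_mono) auto
      moreover have "1 / (real k + 2) \<le> infdist x F" "infdist y F < 1 / (real l + 1)"
        using x y by (simp_all add: D_def add.commute)
      moreover have "infdist x F \<le> infdist y F + dist x y" by (rule infdist_triangle)
      ultimately show "1 / (real k + 2) - 1 / (real k + 3) \<le> dist x y"
        by linarith
    qed
    \<comment> \<open>With \<open>r = 0\<close> and \<open>r = 1\<close> this treats the even and
      the odd shells, each family being pairwise separated; together they give the bound by twice
      the measure of \<open>X\<close>.\<close>
    have le: "(\<Sum>i. ?O (D (2 * i + r))) \<le> ?O X" for r
    proof (rule suminf_le_const)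
      fix n
      have "(\<Sum>i<n. ?O (D (2 * i + r))) \<le> ?O (\<Union>i<n. D (2 * i + r))"
      proof (rule affine_outer_measure_separated_sum)
        fix i j :: nat assume "i < j"
        obtain d where "d>0" "\<forall>l\<ge>2*i+r+2. \<forall>x\<in>D (2*i+r). \<forall>y\<in>D l. d \<le> dist x y"
          using sep by blast
        moreover have "2 * k + r \<ge> 2 * i + r + 2" if "k \<ge> j" for k
          using that \<open>i < j\<close> by linarith
        ultimately show "\<exists>d>0. \<forall>k\<ge>j. \<forall>x\<in>D (2*i+r). \<forall>y\<in>D (2*k+r). d \<le> dist x y"
          by blast
      qed
      also have "\<dots> \<le> ?O X"
        by (rule affine_outer_measure_mono) (auto simp: D_def)
      finally show "(\<Sum>i<n. ?O (D (2 * i + r))) \<le> ?O X" .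
    qed auto
    have fin: "(\<Sum>k. ?O (D k)) < \<infinity>"
    proof -
      have "(\<Sum>k<n. ?O (D k)) \<le> ?O X + ?O X" for n
      proof -
        have "(\<Sum>k<n. ?O (D k)) \<le> (\<Sum>k<2*n. ?O (D k))"
          by (rule sum_mono2) auto
        also have "\<dots> = (\<Sum>i<n. ?O (D (2 * i + 0))) + (\<Sum>i<n. ?O (D (2 * i + 1)))"
          by (induction n) (auto simp: algebra_simps)
        also have "\<dots> \<le> (\<Sum>i. ?O (D (2 * i + 0))) + (\<Sum>i. ?O (D (2 * i + 1)))"
          by (intro add_mono sum_le_suminf) auto
        also have "\<dots> \<le> ?O X + ?O X"
          by (intro add_mono le)
        finally show ?thesis .
      qed
      then have "(\<Sum>k. ?O (D k)) \<le> ?O X + ?O X"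
        by (intro suminf_le_const) auto
      then show ?thesis
        using False by (auto simp: less_top[symmetric] top_unique)
    qed
    show ?thesis
    proof (rule ennreal_le_epsilon)
      fix e :: real assume "e > 0"
      obtain n where n: "(\<Sum>i. ?O (D (i + n))) \<le> ennreal e"
        using ennreal_suminf_tail_small[OF fin \<open>e > 0\<close>] by blast
      have sub: "(UNIV - F) \<inter> X \<subseteq> Y n \<union> (\<Union>i. D (i + n))"
      proof
        fix x assume x: "x \<in> (UNIV - F) \<inter> X"
        then have "infdist x F > 0"
          using in_closed_iff_infdist_zero[OF assms \<open>F \<noteq> {}\<close>] infdist_nonneg[of x F]
          by (auto simp: less_le)
        then obtain m :: nat where m: "1 / (m + 1) \<le> infdist x F"
          using reals_Archimedean[of "infdist x F"] by (auto simp: inverse_eq_divide add.commute intro: less_imp_le)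
        \<comment> \<open>The first threshold that the distance of \<open>x\<close> reaches: either
          it is among the first \<open>n\<close>, and \<open>x\<close> lies in \<open>Y n\<close>,
          or the previous threshold fails and \<open>x\<close> lies in the shell
          \<open>k - 1\<close>.\<close>
        define k where "k = (LEAST m :: nat. 1 / (m + 1) \<le> infdist x F)"
        have k: "1 / (k + 1) \<le> infdist x F"
          using LeastI[of "\<lambda>m::nat. 1 / (real m + 1) \<le> infdist x F" m] m by (simp add: k_def add.commute)
        show "x \<in> Y n \<union> (\<Union>i. D (i + n))"
        proof (cases "k \<le> n")
          case True
          then have "1 / (real n + 1) \<le> 1 / (real k + 1)" by (intro divide_left_mono) auto
          then have "1 / (real n + 1) \<le> infdist x F" using k by (simp add: add.commute)
          with x show ?thesis by (auto simp: Y_def add.commute)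
        next
          case False
          define j where "j = k - 1"
          have j: "k = Suc j" "j \<ge> n" using False by (auto simp: j_def)
          have "\<not> 1 / (real j + 1) \<le> infdist x F"
            using not_less_Least[of j "\<lambda>m::nat. 1 / (m + 1) \<le> infdist x F"] j(1)
            unfolding k_def[symmetric] by auto
          then have "x \<in> D j"
            using k x j(1) by (auto simp: D_def add.commute)
          then have "x \<in> D ((j - n) + n)" using j by simp
          then show ?thesis by blast
        qed
      qed
      have "?O ((UNIV - F) \<inter> X) \<le> ?O (Y n) + ?O (\<Union>i. D (i + n))"
        using affine_outer_measure_mono[OF sub] affine_outer_measure_Un order_trans by blast
      also have "\<dots> \<le> ?O (Y n) + ennreal e"
        using affine_outer_measure_countably_subadditive[of "\<lambda>i. D (i + n)"] n
        by (intro add_left_mono) (rule order_trans)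
      finally have "?O (F \<inter> X) + ?O ((UNIV - F) \<inter> X) \<le> (?O (F \<inter> X) + ?O (Y n)) + ennreal e"
        by (simp add: add_left_mono add.assoc)
      also have "?O (F \<inter> X) + ?O (Y n) \<le> ?O ((F \<inter> X) \<union> Y n)"
      proof (rule affine_outer_measure_Un_separated[of "1 / (real n + 1)"])
        fix x y assume "x \<in> F \<inter> X" "y \<in> Y n"
        then have "infdist y F \<le> dist y x" "1 / (real n + 1) \<le> infdist y F"
          by (simp_all add: Y_def infdist_le add.commute)
        then show "1 / (real n + 1) \<le> dist x y" by (simp add: dist_commute)
      qed simp
      also have "?O ((F \<inter> X) \<union> Y n) \<le> ?O X"
        by (rule affine_outer_measure_mono) (auto simp: Y_def)
      finally show "?O (F \<inter> X) + ?O ((UNIV - F) \<inter> X) \<le> ?O X + ennreal e"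
        by (simp add: add_right_mono)
    qed
  qed simp
  moreover have "?O X \<le> ?O (F \<inter> X) + ?O ((UNIV - F) \<inter> X)" for X
    using affine_outer_measure_Un[of "F \<inter> X" "(UNIV - F) \<inter> X"]
    by (simp add: Int_Un_distrib2[symmetric])
  ultimately show ?thesis
    by (auto simp: lambda_system_def intro: antisym)
qed

lemma borel_subset_lambda_system:
  "sets borel \<subseteq> lambda_system UNIV (Pow UNIV) affine_outer_measure"
proof -
  have "measure_space UNIV (lambda_system UNIV (Pow UNIV) affine_outer_measure) affine_outer_measure"
    by (rule sigma_algebra.caratheodory_lemma[OF sigma_algebra_Pow affine_outer_measure_space])
  then interpret sigma_algebra UNIV "lambda_system UNIV (Pow UNIV) affine_outer_measure"
    by (simp add: measure_space_def)
  show ?thesis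
    unfolding borel_eq_closed
    by (subst sets_measure_of, simp, rule sigma_sets_subset) (use closed_in_lambda_system in blast)
qed

lemma emeasure_affine_measure:
  assumes "E \<in> sets borel"
  shows "emeasure affine_measure E = affine_outer_measure E"
proof -
  let ?L = "lambda_system UNIV (Pow UNIV) affine_outer_measure"
  have "measure_space UNIV ?L affine_outer_measure"
    by (rule sigma_algebra.caratheodory_lemma[OF sigma_algebra_Pow affine_outer_measure_space])
  then show ?thesis
    unfolding affine_measure_def
    using assms borel_subset_lambda_system
    by (intro emeasure_measure_of_sigma) (auto simp: measure_space_def)
qed

lemma sets_borel_subset_affine_measure: "sets borel \<subseteq> sets affine_measure"
proof -
  have "sets affine_measure = sigma_sets UNIV (lambda_system UNIV (Pow UNIV) affine_outer_measure)"
    unfolding affine_measure_def by (rule sets_measure_of) auto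
  then show ?thesis
    using borel_subset_lambda_system by (auto intro: sigma_sets.Basic)
qed

section \<open>Differentiability of distribution functions\<close>

text \<open>The form of Vitali's theorem fitted to \<open>interval_measure\<close>, which gives
  \<open>{u<..v}\<close> the mass \<open>f v - f u\<close>. Disjoint closed balls yield disjoint
  half-open intervals, and passing to open intervals loses only countably many endpoints; openness
  permits a second application of the lemma inside their union.\<close>

lemma vitali_intervals:
  fixes B G :: "real set"
  assumes "open G" "B \<subseteq> G"
    and small: "\<And>x d. x \<in> B \<Longrightarrow> d > 0 \<Longrightarrow> \<exists>u v. u < v \<and> u \<le> x \<and> x \<le> v \<and> v - u < d \<and> P u v"
  obtains C where "countable C" "\<And>u v. (u, v) \<in> C \<Longrightarrow> u < v \<and> {u..v} \<subseteq> G \<and> P u v"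
    "disjoint_family_on (\<lambda>(u, v). {u<..v}) C"
    "negligible (B - (\<Union>(u, v)\<in>C. {u<..<v}))"
proof -
  define K where "K = {(u, v). u < v \<and> {u..v} \<subseteq> G \<and> P u v}"
  define a where "a = (\<lambda>(u, v). (u + v) / 2 :: real)"
  define r where "r = (\<lambda>(u, v). (v - u) / 2 :: real)"
  have ball: "cball (a (u, v)) (r (u, v)) = {u..v}" for u v
    unfolding a_def r_def cball_eq_atLeastAtMost by (simp add: field_simps)
  have r: "0 < r i" if "i \<in> K" for i
    using that by (auto simp: K_def r_def)
  have S: "\<exists>i. i \<in> K \<and> x \<in> cball (a i) (r i) \<and> r i < d" if "x \<in> B" "0 < d" for x d
  proof -
    obtain e where e: "e > 0" "cball x e \<subseteq> G"
      using \<open>open G\<close> \<open>B \<subseteq> G\<close> \<open>x \<in> B\<close> open_contains_cball by blast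
    obtain u v where uv: "u < v" "u \<le> x" "x \<le> v" "v - u < min d e" "P u v"
      using small[OF \<open>x \<in> B\<close>, of "min d e"] \<open>0 < d\<close> e by auto
    have "{u..v} \<subseteq> cball x e" using uv by (auto simp: dist_real_def)
    then have "(u, v) \<in> K" using uv e by (auto simp: K_def)
    moreover have "r (u, v) < d" using uv by (auto simp: r_def)
    ultimately show ?thesis using uv by (intro exI[of _ "(u, v)"]) (auto simp: ball)
  qed
  obtain C where C: "countable C" "C \<subseteq> K"
     "pairwise (\<lambda>i j. disjnt (cball (a i) (r i)) (cball (a j) (r j))) C"
     "negligible (B - (\<Union>i \<in> C. cball (a i) (r i)))"
    using Vitali_covering_theorem_cballs[of K r B a, OF r S] by blast
  show ?thesis
  proof
    show "countable C" by fact
    show "u < v \<and> {u..v} \<subseteq> G \<and> P u v" if "(u, v) \<in> C" for u v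
      using that C(2) by (auto simp: K_def)
    show "disjoint_family_on (\<lambda>(u, v). {u<..v}) C"
      unfolding disjoint_family_on_def
    proof (intro ballI impI)
      fix i j assume "i \<in> C" "j \<in> C" "i \<noteq> j"
      then have "disjnt (cball (a i) (r i)) (cball (a j) (r j))"
        using C(3) by (auto simp: pairwise_def)
      then show "(case i of (u, v) \<Rightarrow> {u<..v}) \<inter> (case j of (u, v) \<Rightarrow> {u<..v}) = {}"
        by (cases i; cases j) (force simp: ball disjnt_def)
    qed
    have "countable (fst ` C \<union> snd ` C)" using C(1) by simp
    then have "negligible ((B - (\<Union>i \<in> C. cball (a i) (r i))) \<union> (fst ` C \<union> snd ` C))"
      using C(4) by (intro negligible_Un) (auto simp: negligible_iff_null_sets intro!: null_sets_completionI countable_imp_null_set_lborel)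
    then show "negligible (B - (\<Union>(u, v)\<in>C. {u<..<v}))"
    proof (rule negligible_subset, safe)
      fix x assume x: "x \<notin> (\<Union>(u, v)\<in>C. {u<..<v})" "x \<notin> snd ` C" "x \<notin> fst ` C"
      fix u v assume uv: "(u, v) \<in> C" "x \<in> cball (a (u, v)) (r (u, v))"
      then have "u \<le> x" "x \<le> v" "x \<noteq> u" "x \<noteq> v"
        using x by (auto simp: ball) force+
      then show False using x(1) uv(1) by force
    qed
  qed
qed

section \<open>Slopes of a right-continuous increasing function\<close>

locale distribution_fun =
  fixes f :: "real \<Rightarrow> real"
  assumes mono: "\<And>x y. x \<le> y \<Longrightarrow> f x \<le> f y"
    and right_cont: "\<And>x. continuous (at_right x) f"
begin

lemma borel_measurable_f [measurable]: "f \<in> borel_measurable borel"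
  by (rule borel_measurable_mono) (simp add: monoI mono)

lemma emeasure_Ioc: "u \<le> v \<Longrightarrow> emeasure (interval_measure f) {u<..v} = ennreal (f v - f u)"
  by (rule emeasure_interval_measure_Ioc) (use mono right_cont in auto)

lemma emeasure_UN_Ioc:
  fixes C :: "(real \<times> real) set"
  assumes "countable C" "disjoint_family_on (\<lambda>(u, v). {u<..v}) C" "sets M = sets borel"
  shows "emeasure M (\<Union>(u, v)\<in>C. {u<..v})
    = (\<integral>\<^sup>+i. emeasure M (case i of (u, v) \<Rightarrow> {u<..v}) \<partial>count_space C)"
proof (rule emeasure_UN_countable)
  show "(case i of (u, v) \<Rightarrow> {u<..v}) \<in> sets M" for i
    using assms(3) by (cases i) simp
qed (use assms in auto)

lemma slope_upper_cover:
  assumes C: "countable C" "disjoint_family_on (\<lambda>(u, v). {u<..v}) C"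
    and slope: "\<And>u v. (u, v) \<in> C \<Longrightarrow> u < v \<and> f v - f u \<le> q * (v - u)" and "q \<ge> 0"
  shows "emeasure (interval_measure f) (\<Union>(u, v)\<in>C. {u<..v})
    \<le> ennreal q * emeasure lborel (\<Union>(u, v)\<in>C. {u<..v})"
proof -
  have "emeasure (interval_measure f) (\<Union>(u, v)\<in>C. {u<..v})
      \<le> (\<integral>\<^sup>+i. ennreal q * emeasure lborel (case i of (u, v) \<Rightarrow> {u<..v}) \<partial>count_space C)"
    unfolding emeasure_UN_Ioc[OF C sets_interval_measure]
  proof (rule nn_integral_mono, clarsimp)
    fix u v assume "(u, v) \<in> C"
    with slope have uv: "u < v" "f v - f u \<le> q * (v - u)" by auto
    then show "emeasure (interval_measure f) {u<..v} \<le> ennreal q * emeasure lborel {u<..v}"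
      using \<open>q \<ge> 0\<close> by (simp add: emeasure_Ioc ennreal_mult[symmetric] ennreal_leI)
  qed
  also have "\<dots> = ennreal q * emeasure lborel (\<Union>(u, v)\<in>C. {u<..v})"
    unfolding emeasure_UN_Ioc[OF C sets_lborel] by (rule nn_integral_cmult) auto
  finally show ?thesis .
qed

lemma slope_lower_cover:
  assumes C: "countable C" "disjoint_family_on (\<lambda>(u, v). {u<..v}) C"
    and slope: "\<And>u v. (u, v) \<in> C \<Longrightarrow> u < v \<and> p * (v - u) \<le> f v - f u" and "p \<ge> 0"
  shows "ennreal p * emeasure lborel (\<Union>(u, v)\<in>C. {u<..v})
    \<le> emeasure (interval_measure f) (\<Union>(u, v)\<in>C. {u<..v})"
proof -
  have "ennreal p * emeasure lborel (\<Union>(u, v)\<in>C. {u<..v})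
     = (\<integral>\<^sup>+i. ennreal p * emeasure lborel (case i of (u, v) \<Rightarrow> {u<..v}) \<partial>count_space C)"
    unfolding emeasure_UN_Ioc[OF C sets_lborel] by (rule nn_integral_cmult[symmetric]) auto
  also have "\<dots> \<le> emeasure (interval_measure f) (\<Union>(u, v)\<in>C. {u<..v})"
    unfolding emeasure_UN_Ioc[OF C sets_interval_measure]
  proof (rule nn_integral_mono, clarsimp)
    fix u v assume "(u, v) \<in> C"
    with slope have uv: "u < v" "p * (v - u) \<le> f v - f u" by auto
    then show "ennreal p * emeasure lborel {u<..v} \<le> emeasure (interval_measure f) {u<..v}"
      using \<open>p \<ge> 0\<close> by (simp add: emeasure_Ioc ennreal_mult[symmetric] ennreal_leI)
  qed
  finally show ?thesis .
qed

lemma emeasure_le_of_negligible_diff: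
  assumes "B \<in> sets borel" "U \<in> sets borel" "negligible (B - U)"
  shows "emeasure lborel B \<le> emeasure lborel U"
proof -
  have "emeasure lborel (B - U) = 0"
    using assms by (auto simp: negligible_iff_null_sets null_sets_def)
  have "emeasure lborel B \<le> emeasure lborel (U \<union> (B - U))"
    by (rule emeasure_mono) (use assms in auto)
  also have "\<dots> \<le> emeasure lborel U + emeasure lborel (B - U)"
    by (rule emeasure_subadditive) (use assms in auto)
  finally show ?thesis using \<open>emeasure lborel (B - U) = 0\<close> by simp
qed

lemma sets_UN_intervals [measurable]:
  fixes C :: "(real \<times> real) set"
  assumes "countable C"
  shows "(\<Union>(u, v)\<in>C. {u<..v}) \<in> sets borel" "(\<Union>(u, v)\<in>C. {u<..<v}) \<in> sets borel"
  by (rule sets.countable_UN'; use assms in auto)+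

text \<open>Almost all of \<open>B\<close> is covered by disjoint intervals inside \<open>G\<close>,
  on each of which \<open>f\<close> gains at least \<open>p\<close> times the length.\<close>

lemma emeasure_large_slope:
  assumes B: "B \<in> sets borel" "open G" "B \<subseteq> G" and "p \<ge> 0"
    and small: "\<And>x d. x \<in> B \<Longrightarrow> d > 0 \<Longrightarrow>
      \<exists>u v. u < v \<and> u \<le> x \<and> x \<le> v \<and> v - u < d \<and> p * (v - u) \<le> f v - f u"
  shows "ennreal p * emeasure lborel B \<le> emeasure (interval_measure f) G"
proof -
  obtain C where C: "countable C" "\<And>u v. (u, v) \<in> C \<Longrightarrow> u < v \<and> {u..v} \<subseteq> G \<and> p * (v - u) \<le> f v - f u"
    "disjoint_family_on (\<lambda>(u, v). {u<..v}) C" "negligible (B - (\<Union>(u, v)\<in>C. {u<..<v}))"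
    using vitali_intervals[OF B(2,3), of "\<lambda>u v. p * (v - u) \<le> f v - f u", OF small] by metis
  have "emeasure lborel B \<le> emeasure lborel (\<Union>(u, v)\<in>C. {u<..v})"
  proof (rule emeasure_le_of_negligible_diff)
    show "negligible (B - (\<Union>(u, v)\<in>C. {u<..v}))"
      by (rule negligible_subset[OF C(4)]) force
  qed (use B C sets_UN_intervals in auto)
  then have "ennreal p * emeasure lborel B \<le> ennreal p * emeasure lborel (\<Union>(u, v)\<in>C. {u<..v})"
    by (rule mult_left_mono) simp
  also have "\<dots> \<le> emeasure (interval_measure f) (\<Union>(u, v)\<in>C. {u<..v})"
    by (rule slope_lower_cover) (use C \<open>p \<ge> 0\<close> in auto)
  also have "\<dots> \<le> emeasure (interval_measure f) G"
  proof (rule emeasure_mono)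
    show "(\<Union>(u, v)\<in>C. {u<..v}) \<subseteq> G"
      using C(2) by force
  qed (use B in simp)
  finally show ?thesis .
qed

text \<open>Choose an open \<open>G\<close> around \<open>B\<close> exceeding it by at most
  \<open>e\<close> in measure. Intervals of slope at most \<open>q\<close> cover almost all of
  \<open>B\<close> inside \<open>G\<close>; inside those, intervals of slope at least
  \<open>p\<close> cover almost all of \<open>B\<close> again. The two estimates give
  \<open>p * s \<le> q * (s + e)\<close> for the measure \<open>s\<close> of \<open>B\<close>, which
  forces \<open>s = 0\<close> because \<open>q < p\<close>.\<close>

lemma emeasure_oscillating_slope:
  assumes B: "B \<in> sets borel" "emeasure lborel B < \<infinity>" and "0 \<le> q" "q < p"
    and small: "\<And>x d. x \<in> B \<Longrightarrow> d > 0 \<Longrightarrow>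
      \<exists>u v. u < v \<and> u \<le> x \<and> x \<le> v \<and> v - u < d \<and> f v - f u \<le> q * (v - u)"
    and large: "\<And>x d. x \<in> B \<Longrightarrow> d > 0 \<Longrightarrow>
      \<exists>u v. u < v \<and> u \<le> x \<and> x \<le> v \<and> v - u < d \<and> p * (v - u) \<le> f v - f u"
  shows "emeasure lborel B = 0"
proof -
  obtain s where s: "emeasure lborel B = ennreal s" "s \<ge> 0"
    using B(2) by (cases "emeasure lborel B") auto
  have le: "p * s \<le> q * (s + e)" if "e > 0" for e
  proof -
    obtain G where G: "open G" "B \<subseteq> G" "emeasure lborel G \<le> ennreal (s + e)"
    proof -
      obtain T where T: "open T" "B \<subseteq> T" "emeasure lebesgue (T - B) < ennreal e"
        using sets_lebesgue_outer_open[of B e] B \<open>e > 0\<close> by auto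
      have "emeasure lborel T \<le> emeasure lborel B + emeasure lborel (T - B)"
        using emeasure_subadditive[of B lborel "T - B"] B T
        by (auto simp: Un_absorb1)
      also have "\<dots> \<le> ennreal s + ennreal e"
        using T B s by (intro add_mono) (auto simp: less_imp_le)
      finally show ?thesis
        using that[of T] T s \<open>e > 0\<close> by simp
    qed
    obtain C where C: "countable C" "\<And>u v. (u, v) \<in> C \<Longrightarrow> u < v \<and> {u..v} \<subseteq> G \<and> f v - f u \<le> q * (v - u)"
      "disjoint_family_on (\<lambda>(u, v). {u<..v}) C" "negligible (B - (\<Union>(u, v)\<in>C. {u<..<v}))"
      using vitali_intervals[OF G(1,2), of "\<lambda>u v. f v - f u \<le> q * (v - u)", OF small] by metis
    define U where "U = (\<Union>(u, v)\<in>C. {u<..<v})"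
    define V where "V = (\<Union>(u, v)\<in>C. {u<..v})"
    have [measurable]: "U \<in> sets borel" "V \<in> sets borel"
      unfolding U_def V_def using C(1) by (auto intro: sets_UN_intervals)
    have "open U" unfolding U_def by (intro open_UN) auto
    have "emeasure lborel B \<le> emeasure lborel (B \<inter> U)"
      by (rule emeasure_le_of_negligible_diff) (use B C(4) in \<open>auto simp: U_def[symmetric] Diff_Int\<close>)
    then have "ennreal p * ennreal s \<le> ennreal p * emeasure lborel (B \<inter> U)"
      unfolding s by (rule mult_left_mono) simp
    also have "\<dots> \<le> emeasure (interval_measure f) U"
      by (rule emeasure_large_slope) (use B \<open>open U\<close> large \<open>0 \<le> q\<close> \<open>q < p\<close> in auto)
    also have "\<dots> \<le> emeasure (interval_measure f) V"
    proof (rule emeasure_mono)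
      show "U \<subseteq> V" unfolding U_def V_def by (intro UN_mono) auto
    qed simp
    also have "\<dots> \<le> ennreal q * emeasure lborel V"
      unfolding V_def by (rule slope_upper_cover) (use C \<open>0 \<le> q\<close> in auto)
    also have "\<dots> \<le> ennreal q * emeasure lborel G"
    proof (intro mult_left_mono emeasure_mono)
      show "V \<subseteq> G" unfolding V_def using C(2) by force
    qed (use G in auto)
    also have "\<dots> \<le> ennreal q * ennreal (s + e)"
      by (intro mult_left_mono G) simp
    finally have "ennreal (p * s) \<le> ennreal (q * (s + e))"
      using s \<open>0 \<le> q\<close> \<open>q < p\<close> \<open>e > 0\<close> by (simp add: ennreal_mult)
    then show ?thesis
      using s \<open>0 \<le> q\<close> \<open>e > 0\<close> by (subst (asm) ennreal_le_iff) auto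
  qed
  have "p * s \<le> q * s"
  proof (rule field_le_epsilon)
    fix e :: real assume "e > 0"
    \<comment> \<open>Dividing by \<open>q + 1\<close> instead of \<open>q\<close> includes the case
      \<open>q = 0\<close>.\<close>
    have "p * s \<le> q * (s + e / (q + 1))"
      by (rule le) (use \<open>e > 0\<close> \<open>0 \<le> q\<close> in auto)
    also have "\<dots> \<le> q * s + e"
      using \<open>e > 0\<close> \<open>0 \<le> q\<close> by (simp add: field_simps)
    finally show "p * s \<le> q * s + e" .
  qed
  then have "s = 0"
    using s \<open>q < p\<close> by (smt (verit) mult_right_less_imp_less mult_right_mono mult_strict_right_mono)
  with s show ?thesis by simp
qed

definition slope :: "real \<Rightarrow> real \<Rightarrow> real" where
  "slope x h = (f (x + h) - f x) / h"

lemma slope_nonneg: "0 \<le> slope x h"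
  using mono[of x "x + h"] mono[of "x + h" x]
  by (cases "h > 0"; cases "h < 0") (auto simp: slope_def divide_nonpos_neg)

lemma slope_measurable [measurable]: "(\<lambda>x. slope x h) \<in> borel_measurable borel"
  unfolding slope_def by measurable

text \<open>As \<open>k\<close> decreases to \<open>h\<close>, \<open>slope x k\<close> tends to
  \<open>slope x h\<close>; so a rational increment slightly larger than \<open>h\<close> has its
  slope in the same open set.\<close>

lemma slope_rational:
  assumes "h \<noteq> 0" "\<bar>h\<bar> < d" "open S" "slope x h \<in> S"
  shows "\<exists>h'\<in>\<rat>. h' \<noteq> 0 \<and> \<bar>h'\<bar> < d \<and> slope x h' \<in> S"
proof -
  have "continuous (at_right (x + h)) f" by (rule right_cont)
  then have "(f \<longlongrightarrow> f (x + h)) (at_right (x + h))" by (simp add: continuous_within)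
  then have "((\<lambda>k. f (x + k)) \<longlongrightarrow> f (x + h)) (at_right h)"
    by (subst (asm) at_right_to_0) (subst at_right_to_0, simp add: filterlim_filtermap add_ac)
  then have "((\<lambda>k. slope x k) \<longlongrightarrow> slope x h) (at_right h)"
    unfolding slope_def by (intro tendsto_intros) (use \<open>h \<noteq> 0\<close> in auto)
  then have "\<forall>\<^sub>F k in at_right h. slope x k \<in> S"
    using assms by (auto simp: tendsto_def)
  moreover have "((\<lambda>k. k) \<longlongrightarrow> h) (at_right h)" by (rule tendsto_ident_at)
  then have "\<forall>\<^sub>F k in at_right h. k \<in> {-d<..<d} - {0}"
    by (rule topological_tendstoD) (use assms in \<open>auto intro: open_delete\<close>)
  ultimately have "\<forall>\<^sub>F k in at_right h. slope x k \<in> S \<and> k \<in> {-d<..<d} - {0}"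
    by (rule eventually_conj)
  then obtain b where b: "b > h" "\<And>k. h < k \<Longrightarrow> k < b \<Longrightarrow> slope x k \<in> S \<and> k \<in> {-d<..<d} - {0}"
    unfolding eventually_at_right_field by blast
  obtain k where "k \<in> \<rat>" "h < k" "k < b"
    using Rats_dense_in_real[OF b(1)] by blast
  with b(2)[of k] show ?thesis by (intro bexI[of _ k]) (auto simp: abs_less_iff)
qed

text \<open>Right continuity of \<open>f\<close> allows restricting to rational increments, which keeps these sets Borel.\<close>

definition freq_slope :: "real set \<Rightarrow> real set" where
  "freq_slope S = {x. \<forall>n::nat. \<exists>h\<in>\<rat>. h \<noteq> 0 \<and> \<bar>h\<bar> < 1 / Suc n \<and> slope x h \<in> S}"

lemma freq_slope_sets:
  assumes [measurable]: "S \<in> sets borel"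
  shows "freq_slope S \<in> sets borel"
proof -
  have [simp]: "countable (\<rat> :: real set)" by (rule countable_rat)
  have eq: "freq_slope S = (\<Inter>n::nat. \<Union>h\<in>{h\<in>\<rat>. h \<noteq> 0 \<and> \<bar>h\<bar> < 1 / Suc n}. (\<lambda>x. slope x h) -` S \<inter> space borel)"
    unfolding freq_slope_def by (simp add: set_eq_iff Bex_def conj_assoc)
  show ?thesis
    unfolding eq
  proof (rule sets.countable_INT, safe)
    fix n :: nat
    show "(\<Union>h\<in>{h\<in>\<rat>. h \<noteq> 0 \<and> \<bar>h\<bar> < 1 / Suc n}. (\<lambda>x. slope x h) -` S \<inter> space borel) \<in> sets borel"
      using measurable_sets[OF slope_measurable assms]
      by (intro sets.countable_UN') (auto intro: countable_subset[OF _ countable_rat])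
  qed
qed

lemma freq_slopeI:
  assumes "open S" "\<exists>\<^sub>F h in at 0. slope x h \<in> S"
  shows "x \<in> freq_slope S"
proof -
  have "\<exists>h\<in>\<rat>. h \<noteq> 0 \<and> \<bar>h\<bar> < 1 / Suc n \<and> slope x h \<in> S" for n :: nat
  proof -
    obtain h where "h \<noteq> 0" "\<bar>h\<bar> < 1 / Suc n" "slope x h \<in> S"
      using assms(2) unfolding frequently_at by (auto simp: dist_real_def) (metis divide_pos_pos of_nat_0_less_iff zero_less_Suc zero_less_one of_nat_Suc)
    then show ?thesis using slope_rational assms(1) by blast
  qed
  then show ?thesis by (simp add: freq_slope_def)
qed

lemma freq_slopeD:
  assumes "x \<in> freq_slope S" "d > 0"
  shows "\<exists>u v. u < v \<and> u \<le> x \<and> x \<le> v \<and> v - u < d \<and> (f v - f u) / (v - u) \<in> S"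
proof -
  obtain n :: nat where n: "1 / Suc n < d"
    using reals_Archimedean[OF \<open>d > 0\<close>] by (auto simp: field_simps)
  obtain h where h: "h \<noteq> 0" "\<bar>h\<bar> < 1 / Suc n" "slope x h \<in> S"
    using assms(1) by (force simp: freq_slope_def)
  show ?thesis
  proof (cases "h > 0")
    case True
    then show ?thesis using h n by (intro exI[of _ x] exI[of _ "x + h"]) (auto simp: slope_def)
  next
    case False
    then show ?thesis using h n
      using minus_divide_divide[of "f x - f (x + h)" "- h"]
      by (intro exI[of _ "x + h"] exI[of _ x]) (auto simp: slope_def)
  qed
qed

lemma null_oscillating:
  assumes "q < p" "0 \<le> q"
  shows "freq_slope {..<q} \<inter> freq_slope {p<..} \<in> null_sets lborel" (is "?E \<in> _")
proof -
  have [measurable]: "?E \<in> sets borel"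
    by (intro sets.Int freq_slope_sets) auto
  have "?E \<inter> {-real n..real n} \<in> null_sets lborel" for n
  proof -
    have "emeasure lborel (?E \<inter> {-real n..real n}) = 0"
    proof (rule emeasure_oscillating_slope[OF _ _ \<open>0 \<le> q\<close> \<open>q < p\<close>])
      have "emeasure lborel (?E \<inter> {-real n..real n}) \<le> emeasure lborel {-real n..real n}"
        by (rule emeasure_mono) auto
      then show "emeasure lborel (?E \<inter> {-real n..real n}) < \<infinity>"
        by (simp add: order_le_less_trans)
    next
      fix x d :: real assume x: "x \<in> ?E \<inter> {-real n..real n}" "d > 0"
      show "\<exists>u v. u < v \<and> u \<le> x \<and> x \<le> v \<and> v - u < d \<and> f v - f u \<le> q * (v - u)"
        using freq_slopeD[of x "{..<q}" d] x by (auto simp: pos_divide_less_eq) (metis less_imp_le)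
      show "\<exists>u v. u < v \<and> u \<le> x \<and> x \<le> v \<and> v - u < d \<and> p * (v - u) \<le> f v - f u"
        using freq_slopeD[of x "{p<..}" d] x by (auto simp: pos_less_divide_eq) (metis less_imp_le)
    qed simp
    then show ?thesis by (simp add: null_sets_def)
  qed
  then have "(\<Union>n. ?E \<inter> {-real n..real n}) \<in> null_sets lborel" by blast
  also have "(\<Union>n. ?E \<inter> {-real n..real n}) = ?E"
  proof -
    have "\<exists>n. x \<in> {-real n..real n}" for x
    proof -
      obtain n :: nat where "\<bar>x\<bar> \<le> real n" using real_arch_simple by blast
      then show ?thesis by (intro exI[of _ n]) (simp add: abs_le_iff)
    qed
    then show ?thesis by blast
  qed
  finally show ?thesis .
qed

text \<open>On a bounded piece, slopes above every \<open>p\<close> would give \<open>p\<close>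
  times its measure at most the fixed total variation \<open>m\<close>, for all
  \<open>p\<close>.\<close>

lemma null_infinite_slope: "(\<Inter>p::nat. freq_slope {real p<..}) \<in> null_sets lborel" (is "?E \<in> _")
proof -
  have [measurable]: "?E \<in> sets borel"
    by (intro sets.countable_INT) (auto intro!: freq_slope_sets)
  have "?E \<inter> {-real n..real n} \<in> null_sets lborel" for n
  proof -
    define m where "m = f (real n + 1) - f (- real n - 1)"
    have m: "m \<ge> 0" unfolding m_def using mono by simp
    have *: "ennreal (real p) * emeasure lborel (?E \<inter> {-real n..real n}) \<le> ennreal m" for p
    proof -
      have "ennreal (real p) * emeasure lborel (?E \<inter> {-real n..real n})
          \<le> emeasure (interval_measure f) {- real n - 1<..<real n + 1}"
      proof (rule emeasure_large_slope)
        fix x d :: real assume x: "x \<in> ?E \<inter> {-real n..real n}" "d > 0"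
        then have "x \<in> freq_slope {real p<..}" by blast
        from freq_slopeD[OF this \<open>d > 0\<close>]
        show "\<exists>u v. u < v \<and> u \<le> x \<and> x \<le> v \<and> v - u < d \<and> real p * (v - u) \<le> f v - f u"
          by (auto simp: pos_less_divide_eq) (metis less_imp_le)
      qed auto
      also have "\<dots> \<le> emeasure (interval_measure f) {- real n - 1<..real n + 1}"
        by (rule emeasure_mono) auto
      also have "\<dots> = ennreal m" by (simp add: emeasure_Ioc m_def)
      finally show ?thesis .
    qed
    have "emeasure lborel (?E \<inter> {-real n..real n}) \<le> emeasure lborel {-real n..real n}"
      by (rule emeasure_mono) auto
    then obtain s where s: "emeasure lborel (?E \<inter> {-real n..real n}) = ennreal s" "s \<ge> 0"
      by (cases "emeasure lborel (?E \<inter> {-real n..real n})") (auto simp: top_unique)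
    have "real p * s \<le> m" for p
      using *[of p] s m by (simp add: ennreal_mult[symmetric])
    then have "s \<le> 0"
      using reals_Archimedean3[of s] by (metis not_le)
    then show ?thesis using s by (simp add: null_sets_def)
  qed
  then have "(\<Union>n. ?E \<inter> {-real n..real n}) \<in> null_sets lborel" by blast
  also have "(\<Union>n. ?E \<inter> {-real n..real n}) = ?E"
  proof -
    have "\<exists>n. x \<in> {-real n..real n}" for x
    proof -
      obtain n :: nat where "\<bar>x\<bar> \<le> real n" using real_arch_simple by blast
      then show ?thesis by (intro exI[of _ n]) (simp add: abs_le_iff)
    qed
    then show ?thesis by blast
  qed
  finally show ?thesis .
qed

text \<open>The lower and upper limits of the slopes always exist as extended reals. If they
  differed, two rationals would fit strictly between them and \<open>x\<close> would oscillate
  across both; the second assumption excludes a common infinite value.\<close>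

lemma differentiable_of_not_freq:
  assumes osc: "\<And>q p. q \<in> \<rat> \<Longrightarrow> p \<in> \<rat> \<Longrightarrow> 0 \<le> q \<Longrightarrow> q < p \<Longrightarrow> x \<notin> freq_slope {..<q} \<inter> freq_slope {p<..}"
    and inf: "x \<notin> (\<Inter>p::nat. freq_slope {real p<..})"
  shows "\<exists>D. (f has_real_derivative D) (at x)"
proof -
  define X where "X h = ereal (slope x h)" for h
  define l where "l = Liminf (at 0) X"
  define u where "u = Limsup (at 0) X"
  have "l \<le> u" unfolding l_def u_def by (rule Liminf_le_Limsup) simp
  have "0 \<le> l" unfolding l_def by (rule Liminf_bounded) (simp add: X_def slope_nonneg)
  have "\<not> l < u"
  proof
    assume "l < u"
    obtain q :: rat where q: "l < ereal (of_rat q)" "ereal (of_rat q) < u"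
      using ereal_dense3[OF \<open>l < u\<close>] by blast
    obtain p :: rat where p: "ereal (of_rat q) < ereal (of_rat p)" "ereal (of_rat p) < u"
      using ereal_dense3[OF q(2)] by blast
    have q0: "0 \<le> (of_rat q :: real)"
      using order_le_less_trans[OF \<open>0 \<le> l\<close> q(1)] by simp
    have "\<exists>\<^sub>F h in at 0. slope x h < of_rat q"
    proof (rule ccontr)
      assume "\<not> (\<exists>\<^sub>F h in at 0. slope x h < of_rat q)"
      then have "\<forall>\<^sub>F h in at 0. ereal (of_rat q) \<le> X h"
        by (simp add: not_frequently not_less X_def)
      from Liminf_bounded[OF this] q(1) show False unfolding l_def by simp
    qed
    moreover have "\<exists>\<^sub>F h in at 0. of_rat p < slope x h"
    proof (rule ccontr)
      assume "\<not> (\<exists>\<^sub>F h in at 0. of_rat p < slope x h)"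
      then have "\<forall>\<^sub>F h in at 0. X h \<le> ereal (of_rat p)"
        by (simp add: not_frequently not_less X_def)
      from Limsup_bounded[OF this] p(2) show False unfolding u_def by simp
    qed
    ultimately have "x \<in> freq_slope {..<of_rat q} \<inter> freq_slope {of_rat p<..}"
      by (intro IntI freq_slopeI) auto
    then show False using osc[of "of_rat q" "of_rat p"] q0 p(1) by auto
  qed
  with \<open>l \<le> u\<close> have "u = l" by simp
  then have lim: "(X \<longlongrightarrow> l) (at 0)"
    unfolding l_def u_def by (intro Liminf_eq_Limsup) auto
  show ?thesis
  proof (cases l)
    case (real r)
    then have "((\<lambda>h. slope x h) \<longlongrightarrow> r) (at 0)"
      using lim by (simp add: X_def[abs_def])
    then show ?thesis unfolding DERIV_def slope_def by blast
  next
    case PInf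
    have "x \<in> freq_slope {real p<..}" for p
    proof (rule freq_slopeI)
      have "\<forall>\<^sub>F h in at 0. ereal (real p) < X h"
        using order_tendstoD(1)[OF lim, of "ereal (real p)"] PInf by simp
      then show "\<exists>\<^sub>F h in at 0. slope x h \<in> {real p<..}"
        unfolding X_def by (intro eventually_frequently) auto
    qed simp
    then show ?thesis using inf by blast
  next
    case MInf
    then show ?thesis using \<open>0 \<le> l\<close> by simp
  qed
qed

lemma AE_differentiable: "AE x in lborel. \<exists>D. (f has_real_derivative D) (at x)"
proof (rule AE_I')
  let ?J = "{(q :: real, p :: real). q \<in> \<rat> \<and> p \<in> \<rat> \<and> 0 \<le> q \<and> q < p}"
  have "countable (\<rat> \<times> \<rat> :: (real \<times> real) set)"
    by (intro countable_SIGMA countable_rat)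
  moreover have "?J \<subseteq> \<rat> \<times> \<rat>" by auto
  ultimately have "countable ?J" by (rule countable_subset[rotated])
  then show "(\<Union>(q, p)\<in>?J. freq_slope {..<q} \<inter> freq_slope {p<..}) \<union> (\<Inter>p::nat. freq_slope {real p<..})
      \<in> null_sets lborel"
    by (intro null_sets.Un null_infinite_slope null_sets_UN') (auto intro: null_oscillating)
  show "{x \<in> space lborel. \<not> (\<exists>D. (f has_real_derivative D) (at x))} \<subseteq>
     (\<Union>(q, p)\<in>?J. freq_slope {..<q} \<inter> freq_slope {p<..}) \<union> (\<Inter>p::nat. freq_slope {real p<..})"
  proof (rule subsetI, rule ccontr)
    fix x assume x: "x \<in> {x \<in> space lborel. \<not> (\<exists>D. (f has_real_derivative D) (at x))}"
      "x \<notin> (\<Union>(q, p)\<in>?J. freq_slope {..<q} \<inter> freq_slope {p<..}) \<union> (\<Inter>p::nat. freq_slope {real p<..})"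
    have "\<exists>D. (f has_real_derivative D) (at x)"
      by (rule differentiable_of_not_freq) (use x(2) in auto)
    with x(1) show False by simp
  qed
qed

text \<open>A Borel measurable version of the derivative defined at every point. A single sequence
  of increments makes measurability immediate; \<open>max 0\<close> is there because
  \<open>lim\<close> of a divergent sequence is an unspecified number.\<close>

definition density_part :: "real \<Rightarrow> real" where
  "density_part x = max 0 (lim (\<lambda>n. slope x (1 / Suc n)))"

lemma density_part_measurable [measurable]: "density_part \<in> borel_measurable borel"
  unfolding density_part_def by measurable

lemma density_part_nonneg [simp]: "0 \<le> density_part x"
  by (simp add: density_part_def)

lemma slope_tendsto_density_part:
  assumes "(f has_real_derivative D) (at x)"
  shows "density_part x = D" "(\<lambda>n. slope x (1 / Suc n)) \<longlonglongrightarrow> density_part x"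
proof -
  have "((\<lambda>h. slope x h) \<longlongrightarrow> D) (at 0)"
    using assms by (simp add: DERIV_def slope_def)
  moreover have "filterlim (\<lambda>n. 1 / real (Suc n)) (at 0) sequentially"
    unfolding filterlim_at using LIMSEQ_inverse_real_of_nat by (auto simp: inverse_eq_divide)
  ultimately have *: "(\<lambda>n. slope x (1 / Suc n)) \<longlonglongrightarrow> D"
    by (rule filterlim_compose)
  have "0 \<le> D"
    by (rule LIMSEQ_le_const[OF *]) (auto simp: slope_nonneg)
  with limI[OF *] show "density_part x = D" by (simp add: density_part_def)
  with * show "(\<lambda>n. slope x (1 / Suc n)) \<longlonglongrightarrow> density_part x" by simp
qed

lemma AE_density_part: "AE x in lborel. (f has_real_derivative density_part x) (at x)"
  using AE_differentiable by eventually_elim (use slope_tendsto_density_part(1) in blast)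

text \<open>Fatou's lemma applied to the difference quotients. The integral of a quotient is, after
  a translation, a difference of averages of \<open>f\<close> near the two ends, and right
  continuity at \<open>b\<close> gives the limit. Jumps and the singular part make the inequality
  strict in general.\<close>

lemma nn_integral_density_part_le:
  assumes "a \<le> b"
  shows "(\<integral>\<^sup>+x\<in>{a..b}. ennreal (density_part x) \<partial>lborel) \<le> ennreal (f b - f a)"
proof -
  let ?h = "\<lambda>n. 1 / real (Suc n)"
  have step: "(\<integral>\<^sup>+x\<in>{a..b}. ennreal (slope x h) \<partial>lborel) \<le> ennreal (f (b + h) - f a)" if "h > 0" for h
  proof -
    \<comment> \<open>Subtracting \<open>f a\<close> makes the integrand nonnegative on the interval
      and its integral finite, so that it can be cancelled in \<open>ennreal\<close> at the
      end.\<close>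
    define g where "g x = (f x - f a) / h" for x
    have [measurable]: "g \<in> borel_measurable borel" unfolding g_def by measurable
    have g0: "0 \<le> g x" if "a \<le> x" for x
      using mono[OF that] \<open>h > 0\<close> by (simp add: g_def)
    have gm: "g x \<le> g y" if "x \<le> y" for x y
      using mono[OF that] \<open>h > 0\<close> by (simp add: g_def divide_right_mono)
    let ?I = "\<integral>\<^sup>+x\<in>{a..b}. ennreal (g x) \<partial>lborel"
    have "?I \<le> (\<integral>\<^sup>+x\<in>{a..b}. ennreal (g b) \<partial>lborel)"
      by (intro nn_integral_mono) (auto simp: indicator_def intro: ennreal_leI gm)
    then have fin: "?I < \<infinity>"
      using \<open>a \<le> b\<close> by (simp add: nn_integral_cmult_indicator ennreal_mult_less_top order_le_less_trans)
    have "?I + (\<integral>\<^sup>+x\<in>{a..b}. ennreal (slope x h) \<partial>lborel) = (\<integral>\<^sup>+x\<in>{a..b}. ennreal (g (x + h)) \<partial>lborel)"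
    proof (subst nn_integral_add[symmetric])
      show "(\<integral>\<^sup>+x. ennreal (g x) * indicator {a..b} x + ennreal (slope x h) * indicator {a..b} x \<partial>lborel)
        = (\<integral>\<^sup>+x\<in>{a..b}. ennreal (g (x + h)) \<partial>lborel)"
      proof (rule nn_integral_cong)
        fix x
        have "slope x h = g (x + h) - g x"
          by (simp add: slope_def g_def diff_divide_distrib)
        then show "ennreal (g x) * indicator {a..b} x + ennreal (slope x h) * indicator {a..b} x
          = ennreal (g (x + h)) * indicator {a..b} x"
          using slope_nonneg[of x h] g0[of x]
          by (auto simp: indicator_def ennreal_plus[symmetric] simp del: ennreal_plus)
      qed
    qed measurable
    also have "\<dots> = (\<integral>\<^sup>+x. ennreal (g (h + 1 * x)) * indicator {a+h..b+h} (h + 1 * x) \<partial>lborel)"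
      by (intro nn_integral_cong) (auto simp: indicator_def add.commute)
    also have "\<dots> = (\<integral>\<^sup>+x\<in>{a+h..b+h}. ennreal (g x) \<partial>lborel)"
      by (subst nn_integral_real_affine[where c=1 and t=h]) auto
    also have "\<dots> \<le> (\<integral>\<^sup>+x. ennreal (g x) * indicator {a..b} x + ennreal (g (b + h)) * indicator {b..b+h} x \<partial>lborel)"
      by (intro nn_integral_mono) (use \<open>h > 0\<close> in \<open>auto simp: indicator_def intro!: ennreal_leI gm\<close>)
    also have "\<dots> = ?I + (\<integral>\<^sup>+x\<in>{b..b+h}. ennreal (g (b + h)) \<partial>lborel)"
      by (rule nn_integral_add) auto
    also have "(\<integral>\<^sup>+x\<in>{b..b+h}. ennreal (g (b + h)) \<partial>lborel) = ennreal (g (b + h)) * ennreal h"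
      using \<open>h > 0\<close> by (simp add: nn_integral_cmult_indicator)
    also have "\<dots> = ennreal (f (b + h) - f a)"
      using \<open>h > 0\<close> g0[of "b + h"] \<open>a \<le> b\<close> by (simp add: ennreal_mult[symmetric]) (simp add: g_def)
    finally show ?thesis
      using fin by (subst (asm) ennreal_add_left_cancel_le) auto
  qed
  have "(\<integral>\<^sup>+x\<in>{a..b}. ennreal (density_part x) \<partial>lborel)
      \<le> (\<integral>\<^sup>+x. liminf (\<lambda>n. ennreal (slope x (?h n)) * indicator {a..b} x) \<partial>lborel)"
  proof (rule nn_integral_mono_AE)
    show "AE x in lborel. ennreal (density_part x) * indicator {a..b} x
        \<le> liminf (\<lambda>n. ennreal (slope x (?h n)) * indicator {a..b} x)"
      using AE_differentiable
    proof eventually_elim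
      fix x assume "\<exists>D. (f has_real_derivative D) (at x)"
      then have "(\<lambda>n. slope x (?h n)) \<longlonglongrightarrow> density_part x"
        using slope_tendsto_density_part(2) by blast
      then have "(\<lambda>n. ennreal (slope x (?h n)) * indicator {a..b} x) \<longlonglongrightarrow> ennreal (density_part x) * indicator {a..b} x"
        by (auto simp: indicator_def intro!: tendsto_ennrealI)
      then show "ennreal (density_part x) * indicator {a..b} x
        \<le> liminf (\<lambda>n. ennreal (slope x (?h n)) * indicator {a..b} x)"
        by (simp add: lim_imp_Liminf)
    qed
  qed
  also have "\<dots> \<le> liminf (\<lambda>n. \<integral>\<^sup>+x\<in>{a..b}. ennreal (slope x (?h n)) \<partial>lborel)"
    by (rule nn_integral_liminf) measurable
  also have "\<dots> \<le> liminf (\<lambda>n. ennreal (f (b + ?h n) - f a))"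
    by (rule Liminf_mono) (intro always_eventually allI step, simp)
  also have "\<dots> = ennreal (f b - f a)"
  proof (rule lim_imp_Liminf)
    have "(f \<longlongrightarrow> f b) (at_right b)"
      using right_cont[of b] by (simp add: continuous_within)
    moreover have "filterlim (\<lambda>n. b + ?h n) (at_right b) sequentially"
      unfolding filterlim_at
      using tendsto_add[OF tendsto_const LIMSEQ_inverse_real_of_nat, of b] by (auto simp: inverse_eq_divide)
    ultimately have "(\<lambda>n. f (b + ?h n)) \<longlonglongrightarrow> f b" by (rule filterlim_compose)
    then show "(\<lambda>n. ennreal (f (b + ?h n) - f a)) \<longlonglongrightarrow> ennreal (f b - f a)"
      by (intro tendsto_intros)
  qed simp
  finally show ?thesis .
qed

end

section \<open>Polar angles and supporting directions\<close>

definition dir :: "real \<Rightarrow> real^2" where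
  "dir a = cos a *\<^sub>R axis 1 1 + sin a *\<^sub>R axis 2 1"

definition cross2 :: "real^2 \<Rightarrow> real^2 \<Rightarrow> real" where
  "cross2 v w = v $ 1 * w $ 2 - v $ 2 * w $ 1"

lemma dir_nth [simp]: "dir a $ 1 = cos a" "dir a $ 2 = sin a"
  by (simp_all add: dir_def axis_def)

lemma inner_2: "v \<bullet> w = v $ 1 * w $ 1 + v $ 2 * (w $ 2 :: real)" for v w :: "real^2"
  by (simp add: inner_vec_def sum_2)

lemma norm_dir [simp]: "norm (dir a) = 1"
  by (simp add: norm_eq_sqrt_inner inner_2 flip: power2_eq_square)

lemma dir_neq_0 [simp]: "dir a \<noteq> 0"
  using norm_dir[of a] by (metis norm_zero zero_neq_one)

lemma dir_inner_dir: "dir a \<bullet> dir b = cos (b - a)"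
  by (simp add: inner_2 cos_diff)

lemma cross2_dir_dir: "cross2 (dir a) (dir b) = sin (b - a)"
  by (simp add: cross2_def sin_diff)

lemma cross2_simps:
  "cross2 (r *\<^sub>R v) w = r * cross2 v w" "cross2 v (r *\<^sub>R w) = r * cross2 v w"
  "cross2 (- v) w = - cross2 v w" "cross2 v (- w) = - cross2 v w"
  "cross2 v (w + w') = cross2 v w + cross2 v w'" "cross2 v (w - w') = cross2 v w - cross2 v w'"
  by (simp_all add: cross2_def algebra_simps)

lemma dir_quarter: "dir (a + pi / 2) \<bullet> v = cross2 (dir a) v"
  by (simp add: inner_2 cross2_def cos_add sin_add)

lemma dir_pi: "dir (a + pi) = - dir a"
  by (simp add: vec_eq_iff forall_2)

lemma dir_decomp: "v = (dir a \<bullet> v) *\<^sub>R dir a + cross2 (dir a) v *\<^sub>R dir (a + pi / 2)"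
proof -
  define c s where "c = cos a" and "s = sin a"
  have "c * c + s * s = 1" by (simp add: c_def s_def sin_cos_squared_add3 add.commute)
  then have "v $ 1 = (c * v $ 1 + s * v $ 2) * c + (c * v $ 2 - s * v $ 1) * (- s)"
    "v $ 2 = (c * v $ 1 + s * v $ 2) * s + (c * v $ 2 - s * v $ 1) * c"
    by algebra+
  then show ?thesis
    by (simp add: vec_eq_iff forall_2 inner_2 cross2_def cos_add sin_add c_def s_def)
qed

lemma norm_dir_decomp: "(norm v)\<^sup>2 = (dir a \<bullet> v)\<^sup>2 + (cross2 (dir a) v)\<^sup>2"
proof -
  have "(dir a \<bullet> v)\<^sup>2 + (cross2 (dir a) v)\<^sup>2 = ((cos a)\<^sup>2 + (sin a)\<^sup>2) * ((v $ 1)\<^sup>2 + (v $ 2)\<^sup>2)"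
    unfolding inner_2 cross2_def dir_nth by algebra
  also have "\<dots> = (norm v)\<^sup>2"
    unfolding power2_norm_eq_inner inner_2[of v v] by (simp add: power2_eq_square)
  finally show ?thesis ..
qed

lemma dir_has_vector_derivative: "(dir has_vector_derivative dir (a + pi / 2)) (at a)"
proof -
  have "dir (a + pi / 2) = (- sin a) *\<^sub>R axis 1 1 + cos a *\<^sub>R axis 2 1"
    by (simp add: dir_def cos_add sin_add)
  then show ?thesis
    unfolding dir_def[abs_def] by (auto intro!: derivative_eq_intros simp: has_real_derivative_iff_has_vector_derivative[symmetric])
qed

text \<open>The arccosine of the component along \<open>dir a\<close> gives the angle up to sign;
  the positive cross product selects the sign and keeps the angle in an open half turn.\<close>

lemma dir_polar:
  assumes "cross2 (dir a) v > 0"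
  shows "\<exists>b. a < b \<and> b < a + pi \<and> v = norm v *\<^sub>R dir b"
proof -
  let ?x = "dir a \<bullet> v" and ?y = "cross2 (dir a) v"
  have "v \<noteq> 0" using assms by (auto simp: cross2_def)
  then have n: "norm v > 0" by simp
  have sq: "(norm v)\<^sup>2 = ?x\<^sup>2 + ?y\<^sup>2" by (rule norm_dir_decomp)
  then have "?x\<^sup>2 < (norm v)\<^sup>2" using assms by simp
  then have "\<bar>?x\<bar> < norm v" using n by (metis abs_of_pos abs_le_square_iff not_le)
  then have q: "-1 < ?x / norm v" "?x / norm v < 1"
    using n by (auto simp: field_simps abs_less_iff)
  define c where "c = arccos (?x / norm v)"
  have c: "0 < c" "c < pi" "cos c = ?x / norm v"
    using q arccos_lt_bounded[of "?x / norm v"] by (simp_all add: c_def)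
  have "sin c > 0" using c by (simp add: sin_gt_zero)
  moreover have "(sin c)\<^sup>2 = (?y / norm v)\<^sup>2"
    using n sq[symmetric] unfolding sin_squared_eq c(3) power_divide
    by (simp add: eq_divide_eq left_diff_distrib)
  ultimately have sc: "sin c = ?y / norm v"
    using n assms by (metis divide_pos_pos less_imp_le power2_eq_imp_eq)
  have "v = ?x *\<^sub>R dir a + ?y *\<^sub>R dir (a + pi / 2)" by (rule dir_decomp)
  also have "\<dots> = norm v *\<^sub>R (cos c *\<^sub>R dir a + sin c *\<^sub>R dir (a + pi / 2))"
    using n by (simp add: c(3) sc scaleR_add_right)
  also have "cos c *\<^sub>R dir a + sin c *\<^sub>R dir (a + pi / 2) = dir (a + c)"
    by (simp add: vec_eq_iff forall_2 cos_add sin_add)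
  finally show ?thesis using c by (intro exI[of _ "a + c"]) simp
qed

lemma dir_eq_iff: "dir a = dir b \<longleftrightarrow> (\<exists>n::int. a = b + 2 * pi * n)"
  using sin_cos_eq_iff[of a b] by (auto simp: vec_eq_iff forall_2)

lemma arc_length_ge_dist:
  assumes "s \<le> t"
  shows "ennreal (dist (z s) (z t)) \<le> arc_length z s t"
proof -
  define p where "p i = (if i = 0 then s else t)" for i :: nat
  have "mono p" using assms by (auto simp: p_def mono_def)
  then have "(1, p) \<in> {(n :: nat, p :: nat \<Rightarrow> real). mono p \<and> p 0 = s \<and> p n = t}"
    by (simp add: p_def)
  then have "ennreal (\<Sum>i<1. dist (z (p i)) (z (p (Suc i)))) \<le> arc_length z s t"
    unfolding arc_length_def by (rule SUP_upper2) simp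
  then show ?thesis by (simp add: p_def)
qed

section \<open>Bounded open convex sets seen from an interior point\<close>

locale convex_region =
  fixes K :: "(real^2) set" and p :: "real^2"
  assumes open_K: "open K" and convex_K: "convex K" and bounded_K: "bounded K" and p_in_K: "p \<in> K"
begin

lemma frontier_disjoint: "x \<in> frontier K \<Longrightarrow> x \<notin> K"
  using open_K by (simp add: frontier_def interior_open)

lemma frontier_subset_closure: "frontier K \<subseteq> closure K"
  by (auto simp: frontier_def)

text \<open>The open segment from a point of the interior to a point of the closure stays in the
  interior, so it contains no frontier point.\<close>

lemma frontier_ray_unique:
  assumes "p + r *\<^sub>R v \<in> frontier K" "p + r' *\<^sub>R v \<in> frontier K" "r > 0" "r' > 0"
  shows "r = r'"
proof -
  have False if "p + r *\<^sub>R v \<in> frontier K" "p + r' *\<^sub>R v \<in> frontier K" "0 < r" "r < r'" for r r'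
  proof -
    have "v \<noteq> 0" using that(1) p_in_K frontier_disjoint by auto
    have "p + r *\<^sub>R v = (1 - r / r') *\<^sub>R p + (r / r') *\<^sub>R (p + r' *\<^sub>R v)"
      using that by (simp add: algebra_simps)
    moreover have "0 < r / r'" "r / r' < 1" using that by auto
    ultimately have "p + r *\<^sub>R v \<in> open_segment p (p + r' *\<^sub>R v)"
      using \<open>v \<noteq> 0\<close> that unfolding in_segment by (intro conjI exI[of _ "r / r'"]) auto
    moreover have "open_segment p (p + r' *\<^sub>R v) \<subseteq> interior K"
      using that(2) frontier_subset_closure p_in_K open_K convex_K
      by (intro in_interior_closure_convex_segment) (auto simp: interior_open)
    ultimately show False using that(1) frontier_disjoint interior_subset by blast
  qed
  then show ?thesis using assms by (metis linorder_less_linear)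
qed

text \<open>A supporting line at \<open>x\<close> is directed so that the region lies on its left.
  Since \<open>p\<close> lies strictly on the left as well, the direction is in the open half turn
  counterclockwise from the ray towards \<open>x\<close>.\<close>

lemma support_direction:
  assumes "x \<in> frontier K" "x = p + r *\<^sub>R dir t" "r > 0"
  shows "\<exists>a. t < a \<and> a < t + pi \<and> (\<forall>y\<in>closure K. 0 \<le> cross2 (dir a) (y - x))"
proof -
  have ri: "rel_interior K = K" using open_K p_in_K by (intro rel_interior_open) auto
  obtain n where n: "\<And>y. y \<in> closure K \<Longrightarrow> n \<bullet> x \<le> n \<bullet> y" "\<And>y. y \<in> K \<Longrightarrow> n \<bullet> x < n \<bullet> y"
    using supporting_hyperplane_relative_frontier[of K x] convex_K assms(1)
      frontier_subset_closure frontier_disjoint unfolding ri by (metis subsetD)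
  \<comment> \<open>The inner normal \<open>n\<close> turned clockwise by a right angle, so that the
    half-plane condition becomes a sign of \<open>cross2\<close>.\<close>
  define d :: "real^2" where "d = (\<chi> i. if i = 1 then n $ 2 else - n $ 1)"
  have d: "cross2 d v = n \<bullet> v" for v
    by (simp add: d_def cross2_def inner_2)
  have "0 < cross2 d (p - x)"
    using n(2)[OF p_in_K] by (simp add: d inner_diff_right)
  also have "p - x = (- r) *\<^sub>R dir t" by (simp add: assms)
  also have "cross2 d \<dots> = r * cross2 (dir t) d"
    by (simp add: cross2_def algebra_simps)
  finally have "cross2 (dir t) d > 0" using assms(3) by (simp add: zero_less_mult_iff)
  then obtain a where a: "t < a" "a < t + pi" "d = norm d *\<^sub>R dir a"
    using dir_polar by blast
  have "norm d > 0" using a \<open>cross2 (dir t) d > 0\<close> by (auto simp: cross2_def)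
  have "0 \<le> cross2 (dir a) (y - x)" if "y \<in> closure K" for y
  proof -
    have "0 \<le> cross2 d (y - x)" using n(1)[OF that] by (simp add: d inner_diff_right)
    then have "0 \<le> norm d * cross2 (dir a) (y - x)" using a(3) by (metis cross2_simps(1))
    then show ?thesis using \<open>norm d > 0\<close> by (simp add: zero_le_mult_iff)
  qed
  with a show ?thesis by blast
qed

end

locale convex_param = convex_region +
  fixes L :: real and z :: "real \<Rightarrow> real^2"
  assumes ccw: "ccw_arclength_parametrization (frontier K) L z"
begin

lemma z_bij: "bij_betw z {0..<L} (frontier K)"
  and z_periodic: "z (t + L) = z t"
  and z_arc_length: "s \<le> t \<Longrightarrow> arc_length z s t = ennreal (t - s)"
  and z_winding: "q \<in> inside (frontier K) \<Longrightarrow>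
    winding_number (\<lambda>s. complex_of_plane (z (L * s))) (complex_of_plane q) = 1"
  using ccw by (auto simp: ccw_arclength_parametrization_def)

lemma L_pos: "L > 0"
proof -
  have "frontier K \<noteq> {}"
    using bounded_K p_in_K by (metis empty_iff frontier_eq_empty not_bounded_UNIV)
  then have "{0..<L} \<noteq> {}" using z_bij by (auto simp: bij_betw_def)
  then show ?thesis by auto
qed

lemma z_L: "z L = z 0"
  using z_periodic[of 0] by simp

lemma z_in_frontier: "t \<in> {0..L} \<Longrightarrow> z t \<in> frontier K"
  using z_bij z_L L_pos by (cases "t = L") (auto simp: bij_betw_def)

lemma z_dist: "dist (z s) (z t) \<le> \<bar>s - t\<bar>"
proof -
  have "dist (z s) (z t) \<le> t - s" if "s \<le> t" for s t
    using arc_length_ge_dist[OF that, of z] z_arc_length[OF that] that by simp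
  from this[of s t] this[of t s] show ?thesis by (cases "s \<le> t") (auto simp: dist_commute)
qed

lemma continuous_on_z: "continuous_on S z"
proof -
  have "1-lipschitz_on UNIV z"
    by (rule lipschitz_onI) (use z_dist in \<open>auto simp: dist_real_def\<close>)
  then show ?thesis
    using lipschitz_on_continuous_on continuous_on_subset by blast
qed

lemma inside_eq: "inside (frontier K) = K"
  using inside_frontier_eq_interior[OF bounded_K convex_K] open_K by (simp add: interior_open)

text \<open>The imaginary part of a continuous logarithm of the curve around \<open>p\<close> is a
  polar angle, and winding number 1 makes it grow by \<open>2 * pi\<close>. It is injective because
  a ray meets the frontier once; a continuous injective function is monotone, and the positive total
  increment decides the direction.\<close>

lemma polar_angle:
  obtains \<theta> where "continuous_on {0..L} \<theta>" "\<theta> L = \<theta> 0 + 2 * pi" "strict_mono_on {0..L} \<theta>"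
    "\<And>t. t \<in> {0..L} \<Longrightarrow> \<exists>r>0. z t = p + r *\<^sub>R dir (\<theta> t)"
proof -
  define g where "g s = complex_of_plane (z (L * s))" for s
  have g_cont: "continuous_on S g" for S
    unfolding g_def complex_of_plane_def Complex_eq
    by (intro continuous_intros continuous_on_compose2[OF continuous_on_z[of UNIV]]) auto
  then have "path g" by (simp add: path_def)
  have inj: "x = y" if "complex_of_plane x = complex_of_plane y" for x y
    using that by (simp add: complex_of_plane_def vec_eq_iff forall_2)
  have "complex_of_plane p \<notin> path_image g"
  proof
    assume "complex_of_plane p \<in> path_image g"
    then obtain s where s: "s \<in> {0..1}" "p = z (L * s)"
      unfolding path_image_def g_def using inj by auto
    then have "L * s \<in> {0..L}" using L_pos by (auto simp: mult_left_le)
    then show False using z_in_frontier frontier_disjoint p_in_K s by metis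
  qed
  then obtain q where q: "path q"
    "pathfinish q - pathstart q = 2 * of_real pi * \<i> * winding_number g (complex_of_plane p)"
    "\<And>t. t \<in> {0..1} \<Longrightarrow> g t = complex_of_plane p + exp (q t)"
    using winding_number_as_continuous_log[OF \<open>path g\<close>] by metis
  have "winding_number g (complex_of_plane p) = 1"
    unfolding g_def using z_winding p_in_K inside_eq by simp
  with q(2) have "q 1 - q 0 = 2 * of_real pi * \<i>"
    by (simp add: pathfinish_def pathstart_def)
  then have "Im (q 1 - q 0) = 2 * pi" by simp
  then have q1: "Im (q 1) - Im (q 0) = 2 * pi" by simp
  define \<theta> where "\<theta> t = Im (q (t / L))" for t
  have cont: "continuous_on {0..L} \<theta>"
  proof -
    have "continuous_on {0..L} (\<lambda>t. q (t / L))"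
    proof (rule continuous_on_compose2[of "{0..1}" q _ "\<lambda>t. t / L"])
      show "continuous_on {0..1} q" using q(1) by (simp add: path_def)
      show "continuous_on {0..L} (\<lambda>t. t / L)"
        using L_pos by (intro continuous_intros) auto
      show "(\<lambda>t. t / L) ` {0..L} \<subseteq> {0..1}" using L_pos by auto
    qed
    then show ?thesis unfolding \<theta>_def by (intro continuous_intros)
  qed
  have per: "\<theta> L = \<theta> 0 + 2 * pi" using q1 L_pos by (simp add: \<theta>_def)
  have polar: "\<exists>r>0. z t = p + r *\<^sub>R dir (\<theta> t)" if t: "t \<in> {0..L}" for t
  proof -
    have "t / L \<in> {0..1}" using t L_pos by auto
    from q(3)[OF this] have eq: "complex_of_plane (z t) = complex_of_plane p + exp (q (t / L))"
      using L_pos by (simp add: g_def)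
    have "z t = p + exp (Re (q (t / L))) *\<^sub>R dir (\<theta> t)"
      using arg_cong[OF eq, of Re] arg_cong[OF eq, of Im]
      by (simp add: vec_eq_iff forall_2 complex_of_plane_def Re_exp Im_exp \<theta>_def)
    then show ?thesis by (intro exI[of _ "exp (Re (q (t / L)))"]) simp
  qed
  have "inj_on \<theta> {0..L}"
  proof (rule inj_onI)
    fix s t assume st: "s \<in> {0..L}" "t \<in> {0..L}" "\<theta> s = \<theta> t"
    obtain r where r: "r > 0" "z s = p + r *\<^sub>R dir (\<theta> s)" using polar st by blast
    obtain r' where r': "r' > 0" "z t = p + r' *\<^sub>R dir (\<theta> t)" using polar st by blast
    have "r = r'"
      by (rule frontier_ray_unique[of _ "dir (\<theta> s)"])
        (use r r' st z_in_frontier[OF st(1)] z_in_frontier[OF st(2)] in auto)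
    then have eq: "z s = z t" using r r' st by simp
    show "s = t"
    proof (cases "s = L \<or> t = L")
      case False
      then show ?thesis using z_bij eq st by (auto simp: bij_betw_def inj_on_def)
    next
      \<comment> \<open>The parametrization is injective only on \<open>{0..<L}\<close>. Its closing
        point \<open>z L = z 0\<close> is told apart from the starting point by the increment of
        \<theta>.\<close>
      case True
      have *: "u = L" if "u \<in> {0..L}" "z u = z L" "\<theta> u = \<theta> L" for u
      proof (rule ccontr)
        assume "u \<noteq> L"
        then have "u = 0"
          using z_bij that z_L L_pos by (auto simp: bij_betw_def inj_on_def)
        then show False using that per by simp
      qed
      from True show ?thesis
        using *[of s] *[of t] eq st by auto
    qed
  qed
  then consider "strict_mono_on {0..L} \<theta>" | "strict_antimono_on {0..L} \<theta>"
    using injective_eq_monotone_map[of "{0..L}" \<theta>] cont by (auto simp: is_interval_cc)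
  then show ?thesis
  proof cases
    case 1
    then show ?thesis using that cont per polar by blast
  next
    case 2
    then have "\<theta> L < \<theta> 0" using L_pos by (auto simp: monotone_on_def)
    then show ?thesis using per pi_gt_zero by linarith
  qed
qed

end

section \<open>The tangent angle of a convex curve\<close>

text \<open>Chord directions are controlled only while the polar angle changes by less than
  \<open>pi\<close>, hence on short arcs. A linear lower bound on short intervals passes to long
  ones by telescoping.\<close>

lemma short_intervals_superadditive:
  fixes F :: "real \<Rightarrow> real"
  assumes "\<eta> > 0"
    and short: "\<And>s t. a \<le> s \<Longrightarrow> s \<le> t \<Longrightarrow> t \<le> b \<Longrightarrow> t - s < \<eta> \<Longrightarrow> c * (t - s) \<le> F t - F s"
    and "a \<le> b"
  shows "c * (b - a) \<le> F b - F a"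
proof -
  obtain n :: nat where n: "real n > 0" "(b - a) / n < \<eta>"
  proof -
    obtain m :: nat where "(b - a) / \<eta> < real m" using reals_Archimedean2 by blast
    then have "(b - a) / (real (Suc m)) < \<eta>"
      using \<open>\<eta> > 0\<close> by (simp add: field_simps)
    then show ?thesis using that[of "Suc m"] by simp
  qed
  define h where "h = (b - a) / n"
  have h: "0 \<le> h" "h < \<eta>" "a + real n * h = b"
    using n \<open>a \<le> b\<close> by (auto simp: h_def)
  have "k \<le> n \<Longrightarrow> c * (real k * h) \<le> F (a + real k * h) - F a" for k
  proof (induction k)
    case (Suc k)
    have "a + real (Suc k) * h \<le> a + real n * h"
      using Suc.prems h(1) by (intro add_left_mono mult_right_mono) auto
    then have "c * (a + real (Suc k) * h - (a + real k * h)) \<le> F (a + real (Suc k) * h) - F (a + real k * h)"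
      using h by (intro short) (auto simp: algebra_simps)
    then show ?case using Suc by (simp add: algebra_simps)
  qed simp
  from this[of n] show ?thesis using h(3) by (simp add: eq_diff_eq[symmetric] diff_eq_eq add.commute)
qed

text \<open>\<open>A\<close> is an arbitrary choice of a supporting angle at each point, lifted to
  the branch fixed by \<theta>. At a corner many values are admissible; the right limit taken later
  turns \<open>A\<close> into the angle of the right derivative.\<close>

locale tangent_curve = convex_param +
  fixes \<theta> A :: "real \<Rightarrow> real"
  assumes \<theta>_cont: "continuous_on {0..L} \<theta>"
    and \<theta>_period: "\<theta> L = \<theta> 0 + 2 * pi"
    and \<theta>_mono: "strict_mono_on {0..L} \<theta>"
    and \<theta>_polar: "t \<in> {0..L} \<Longrightarrow> \<exists>r>0. z t = p + r *\<^sub>R dir (\<theta> t)"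
    and A_range: "t \<in> {0..L} \<Longrightarrow> \<theta> t < A t \<and> A t < \<theta> t + pi"
    and A_support: "t \<in> {0..L} \<Longrightarrow> y \<in> closure K \<Longrightarrow> 0 \<le> cross2 (dir (A t)) (y - z t)"

lemma (in convex_param) tangent_curve_exists: "\<exists>\<theta> A. tangent_curve K p L z \<theta> A"
proof -
  obtain \<theta> where \<theta>: "continuous_on {0..L} \<theta>" "\<theta> L = \<theta> 0 + 2 * pi" "strict_mono_on {0..L} \<theta>"
    "\<And>t. t \<in> {0..L} \<Longrightarrow> \<exists>r>0. z t = p + r *\<^sub>R dir (\<theta> t)"
    using polar_angle by blast
  have "\<exists>a. t \<in> {0..L} \<longrightarrow> \<theta> t < a \<and> a < \<theta> t + pi \<and> (\<forall>y\<in>closure K. 0 \<le> cross2 (dir a) (y - z t))" for t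
    using \<theta>(4)[of t] support_direction[OF z_in_frontier[of t]] by blast
  then obtain A where "\<And>t. t \<in> {0..L} \<Longrightarrow> \<theta> t < A t \<and> A t < \<theta> t + pi \<and> (\<forall>y\<in>closure K. 0 \<le> cross2 (dir (A t)) (y - z t))"
    by metis
  then show ?thesis
    using \<theta> by (intro exI[of _ \<theta>] exI[of _ A] tangent_curve.intro tangent_curve_axioms.intro convex_param_axioms) auto
qed

context tangent_curve
begin

lemma z_closure: "t \<in> {0..L} \<Longrightarrow> z t \<in> closure K"
  using z_in_frontier frontier_subset_closure by blast

text \<open>The supporting line at each endpoint has the other endpoint on its left, so
  \<open>sin (\<phi> - A s) \<ge> 0\<close> and \<open>sin (\<phi> - A t) \<le> 0\<close>. The polar
  angles confine \<phi> well enough to read these signs as inequalities between angles.\<close>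

lemma chord_angle:
  assumes "0 \<le> s" "s < t" "t \<le> L" "\<theta> t < \<theta> s + pi"
  shows "\<exists>\<phi>. A s \<le> \<phi> \<and> \<phi> \<le> A t \<and> z t - z s = norm (z t - z s) *\<^sub>R dir \<phi>"
proof -
  have I: "s \<in> {0..L}" "t \<in> {0..L}" using assms by auto
  have "\<theta> s < \<theta> t" using \<theta>_mono I assms(2) by (auto simp: strict_mono_on_def)
  obtain r where r: "r > 0" "z s = p + r *\<^sub>R dir (\<theta> s)" using \<theta>_polar I by blast
  obtain r' where r': "r' > 0" "z t = p + r' *\<^sub>R dir (\<theta> t)" using \<theta>_polar I by blast
  let ?c = "z t - z s"
  have "cross2 (dir (\<theta> s)) ?c = r' * sin (\<theta> t - \<theta> s)"
    by (simp add: r r' cross2_simps cross2_dir_dir)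
  then have "cross2 (dir (\<theta> s)) ?c > 0"
    using r' assms \<open>\<theta> s < \<theta> t\<close> by (simp add: sin_gt_zero)
  then obtain \<phi> where \<phi>: "\<theta> s < \<phi>" "\<phi> < \<theta> s + pi" "?c = norm ?c *\<^sub>R dir \<phi>"
    using dir_polar by blast
  have n: "norm ?c > 0" using \<open>cross2 (dir (\<theta> s)) ?c > 0\<close> by (auto simp: cross2_def)
  have *: "cross2 (dir a) ?c = norm ?c * sin (\<phi> - a)" for a
    by (metis \<phi>(3) cross2_dir_dir cross2_simps(2))
  have "cross2 (dir (\<theta> t)) ?c = r * sin (\<theta> t - \<theta> s)"
    using sin_minus[of "\<theta> s - \<theta> t"] by (simp add: r r' cross2_simps cross2_dir_dir)
  then have "sin (\<phi> - \<theta> t) > 0"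
    using n r(1) assms \<open>\<theta> s < \<theta> t\<close> *[of "\<theta> t"]
    by (metis add_diff_cancel_left' diff_gt_0_iff_gt diff_strict_right_mono mult_pos_pos sin_gt_zero zero_less_mult_pos)
  have \<phi>t: "\<theta> t < \<phi>"
  proof (rule ccontr)
    assume "\<not> \<theta> t < \<phi>"
    then have "0 \<le> \<theta> t - \<phi>" "\<theta> t - \<phi> \<le> pi" using \<phi> assms by auto
    then have "0 \<le> sin (\<theta> t - \<phi>)" by (rule sin_ge_zero)
    then show False using \<open>sin (\<phi> - \<theta> t) > 0\<close> sin_minus[of "\<theta> t - \<phi>"] by simp
  qed
  have "0 \<le> sin (\<phi> - A s)"
    using A_support[OF I(1) z_closure[OF I(2)]] n by (simp add: * zero_le_mult_iff)
  have As: "A s \<le> \<phi>"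
  proof (rule ccontr)
    assume "\<not> A s \<le> \<phi>"
    then have "sin (A s - \<phi>) > 0" using \<phi> A_range[OF I(1)] by (intro sin_gt_zero) auto
    then show False using \<open>0 \<le> sin (\<phi> - A s)\<close> sin_minus[of "A s - \<phi>"] by simp
  qed
  have "0 \<le> cross2 (dir (A t)) (- ?c)"
    using A_support[OF I(2) z_closure[OF I(1)]] by (simp only: minus_diff_eq)
  then have "sin (\<phi> - A t) \<le> 0"
    using n by (simp only: cross2_simps(4) *) (simp add: mult_le_0_iff)
  have At: "\<phi> \<le> A t"
  proof (rule ccontr)
    assume "\<not> \<phi> \<le> A t"
    then have "sin (\<phi> - A t) > 0" using \<phi> \<open>\<theta> s < \<theta> t\<close> A_range[OF I(2)] by (intro sin_gt_zero) auto
    then show False using \<open>sin (\<phi> - A t) \<le> 0\<close> by simp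
  qed
  show ?thesis using As At \<phi>(3) by blast
qed

text \<open>The direction of the chord separates the two values if the polar angles are less than
  \<open>pi\<close> apart; otherwise
  \<open>A s < \<theta> s + pi \<le> \<theta> t < A t\<close>.\<close>

lemma A_mono:
  assumes "0 \<le> s" "s \<le> t" "t \<le> L"
  shows "A s \<le> A t"
proof (cases "s < t \<and> \<theta> t < \<theta> s + pi")
  case True
  then show ?thesis using chord_angle[of s t] assms by force
next
  case False
  then show ?thesis using assms A_range[of s] A_range[of t] by (cases "s = t") force+
qed

text \<open>Constant continuation beyond \<open>[0, L]\<close> makes the angle an increasing
  function on the whole line, as \<open>distribution_fun\<close> requires.\<close>

definition clamped_A :: "real \<Rightarrow> real" where
  "clamped_A t = A (max 0 (min L t))"

text \<open>For an increasing function the infimum over later arguments is the right limit.\<close>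

definition \<alpha> :: "real \<Rightarrow> real" where
  "\<alpha> t = Inf (clamped_A ` {t<..})"

lemma clamped_A_mono: "s \<le> t \<Longrightarrow> clamped_A s \<le> clamped_A t"
  unfolding clamped_A_def using L_pos by (intro A_mono) auto

lemma clamped_A_bounds: "A 0 \<le> clamped_A t" "clamped_A t \<le> A L"
  unfolding clamped_A_def using L_pos by (intro A_mono; auto)+

lemma clamped_A_eq: "t \<in> {0..L} \<Longrightarrow> clamped_A t = A t"
  by (auto simp: clamped_A_def)

lemma bdd_below_clamped_A: "bdd_below (clamped_A ` X)"
  using clamped_A_bounds(1) by (intro bdd_belowI2)

lemma \<alpha>_le: "t < u \<Longrightarrow> \<alpha> t \<le> clamped_A u"
  unfolding \<alpha>_def by (intro cINF_lower bdd_below_clamped_A) auto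

lemma \<alpha>_ge: "clamped_A t \<le> \<alpha> t"
  unfolding \<alpha>_def by (rule cINF_greatest) (auto intro: clamped_A_mono)

lemma \<alpha>_mono: "s \<le> t \<Longrightarrow> \<alpha> s \<le> \<alpha> t"
  unfolding \<alpha>_def by (rule cINF_superset_mono) (auto intro: bdd_below_clamped_A)

lemma \<alpha>_bounds: "A 0 \<le> \<alpha> t" "\<alpha> t \<le> A L"
  using \<alpha>_ge clamped_A_bounds(1) \<alpha>_le[of t "t + 1"] clamped_A_bounds(2) order_trans
  by (blast, force)

text \<open>Both ends come from the half turn allowed to \<open>A\<close> at \<open>0\<close> and at
  \<open>L\<close>. The width \<open>3 * pi\<close> of this window determines how many octants have
  to be considered.\<close>

lemma \<alpha>_range: "\<theta> 0 < \<alpha> t" "\<alpha> t < \<theta> 0 + 3 * pi"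
  using \<alpha>_bounds[of t] A_range[of 0] A_range[of L] \<theta>_period L_pos by auto

lemma \<alpha>_right_cont: "continuous (at_right x) \<alpha>"
  unfolding continuous_within
proof (rule order_tendstoI)
  fix c assume "c < \<alpha> x"
  then show "\<forall>\<^sub>F t in at_right x. c < \<alpha> t"
    unfolding eventually_at_right_field
  proof (intro exI[of _ "x + 1"] conjI allI impI)
    fix y assume "x < y"
    then show "c < \<alpha> y" using \<open>c < \<alpha> x\<close> \<alpha>_mono[of x y] by simp
  qed simp
next
  fix c assume "\<alpha> x < c"
  then obtain u where u: "u > x" "clamped_A u < c"
    unfolding \<alpha>_def using bdd_below_clamped_A by (subst (asm) cINF_less_iff) auto
  show "\<forall>\<^sub>F t in at_right x. \<alpha> t < c"
    unfolding eventually_at_right_field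
    using u \<alpha>_le by (intro exI[of _ u]) (auto intro: le_less_trans)
qed

sublocale \<alpha>: distribution_fun \<alpha>
  by unfold_locales (auto intro: \<alpha>_mono \<alpha>_right_cont)

lemma exists_short: "\<exists>\<eta>>0. \<forall>s t. 0 \<le> s \<longrightarrow> s \<le> t \<longrightarrow> t \<le> L \<longrightarrow> t - s < \<eta> \<longrightarrow> \<theta> t < \<theta> s + pi"
proof -
  have "uniformly_continuous_on {0..L} \<theta>"
    by (rule compact_uniformly_continuous[OF \<theta>_cont]) simp
  then obtain d where "d > 0" and d: "\<And>s t. s \<in> {0..L} \<Longrightarrow> t \<in> {0..L} \<Longrightarrow> dist t s < d \<Longrightarrow> dist (\<theta> t) (\<theta> s) < pi"
    unfolding uniformly_continuous_on_def using pi_gt_zero by metis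
  then show ?thesis
  proof (intro exI[of _ d] conjI allI impI)
    fix s t assume "0 \<le> s" "s \<le> t" "t \<le> L" "t - s < d"
    then have "dist (\<theta> t) (\<theta> s) < pi" by (intro d) (auto simp: dist_real_def)
    then show "\<theta> t < \<theta> s + pi" by (simp add: dist_real_def)
  qed
qed

text \<open>Every short subchord points in a direction between \<open>A s\<close> and
  \<open>A t\<close>, so its component along \<open>dir \<beta>\<close> is at least \<open>c\<close>
  times its length. Adding subchords replaces chord lengths by the arc length
  \<open>t - s\<close>.\<close>

lemma dir_inner_chord_ge_A:
  assumes "0 \<le> s" "s \<le> t" "t \<le> L"
    and c: "\<And>\<phi>. A s \<le> \<phi> \<Longrightarrow> \<phi> \<le> A t \<Longrightarrow> c \<le> cos (\<phi> - \<beta>)"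
  shows "c * (t - s) \<le> dir \<beta> \<bullet> (z t - z s)"
proof -
  obtain \<eta> where \<eta>: "\<eta> > 0" "\<And>s t. 0 \<le> s \<Longrightarrow> s \<le> t \<Longrightarrow> t \<le> L \<Longrightarrow> t - s < \<eta> \<Longrightarrow> \<theta> t < \<theta> s + pi"
    using exists_short by blast
  have chord: "c * norm (z v - z u) \<le> dir \<beta> \<bullet> z v - dir \<beta> \<bullet> z u"
    if "s \<le> u" "u \<le> v" "v \<le> t" "v - u < \<eta>" for u v
  proof (cases "u = v")
    case False
    then have "\<exists>\<phi>. A u \<le> \<phi> \<and> \<phi> \<le> A v \<and> z v - z u = norm (z v - z u) *\<^sub>R dir \<phi>"
      using that assms by (intro chord_angle \<eta>(2)) auto
    then obtain \<phi> where \<phi>: "A u \<le> \<phi>" "\<phi> \<le> A v" "z v - z u = norm (z v - z u) *\<^sub>R dir \<phi>"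
      by blast
    have "c \<le> cos (\<phi> - \<beta>)"
      using c \<phi> A_mono[of s u] A_mono[of v t] that assms by force
    then have "c * norm (z v - z u) \<le> cos (\<phi> - \<beta>) * norm (z v - z u)"
      by (rule mult_right_mono) simp
    also have "\<dots> = dir \<beta> \<bullet> (z v - z u)"
      by (subst (2) \<phi>(3)) (simp add: dir_inner_dir)
    finally show ?thesis by (simp add: inner_diff_right)
  qed simp
  have "c * (t - s) \<le> dir \<beta> \<bullet> z t - dir \<beta> \<bullet> z s"
  proof (rule short_intervals_superadditive[OF \<eta>(1)])
    fix u v assume uv: "s \<le> u" "u \<le> v" "v \<le> t" "v - u < \<eta>"
    show "c * (v - u) \<le> dir \<beta> \<bullet> z v - dir \<beta> \<bullet> z u"
    \<comment> \<open>For negative \<open>c\<close> it is enough that a chord is no longer than its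
      arc. For \<open>c \<ge> 0\<close> chord lengths must be bounded from below, which is only
      possible through the supremum over inscribed polygons.\<close>
    proof (cases "c \<ge> 0")
      case False
      have "norm (z v - z u) \<le> v - u"
        using z_dist[of v u] uv by (simp add: dist_norm)
      then have "c * (v - u) \<le> c * norm (z v - z u)"
        using False by (simp add: mult_left_mono_neg)
      then show ?thesis using chord[OF uv] by linarith
    next
      case True
      let ?F = "dir \<beta> \<bullet> z v - dir \<beta> \<bullet> z u"
      have F0: "?F \<ge> 0" using chord[OF uv] True by (meson mult_nonneg_nonneg norm_ge_zero order_trans)
      have "ennreal (v - u) = arc_length z u v" using z_arc_length uv by simp
      have "ennreal c * arc_length z u v \<le> ennreal ?F"
        unfolding arc_length_def SUP_mult_left_ennreal
      proof (rule SUP_least, clarsimp)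
        fix n and q :: "nat \<Rightarrow> real" assume q: "mono q" "u = q 0" "v = q n"
        have "c * (\<Sum>i<n. dist (z (q i)) (z (q (Suc i)))) = (\<Sum>i<n. c * norm (z (q (Suc i)) - z (q i)))"
          by (simp add: sum_distrib_left dist_norm norm_minus_commute)
        also have "\<dots> \<le> (\<Sum>i<n. dir \<beta> \<bullet> z (q (Suc i)) - dir \<beta> \<bullet> z (q i))"
        proof (rule sum_mono)
          fix i assume "i \<in> {..<n}"
          then have "q 0 \<le> q i" "q i \<le> q (Suc i)" "q (Suc i) \<le> q n"
            using q(1) by (auto simp: mono_def)
          then show "c * norm (z (q (Suc i)) - z (q i)) \<le> dir \<beta> \<bullet> z (q (Suc i)) - dir \<beta> \<bullet> z (q i)"
            using uv q by (intro chord) auto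
        qed
        also have "\<dots> = dir \<beta> \<bullet> z (q n) - dir \<beta> \<bullet> z (q 0)"
          by (rule sum_lessThan_telescope)
        finally show "ennreal c * ennreal (\<Sum>i<n. dist (z (q i)) (z (q (Suc i))))
            \<le> ennreal (dir \<beta> \<bullet> z (q n) - dir \<beta> \<bullet> z (q 0))"
          using True by (simp add: ennreal_mult[symmetric] sum_nonneg ennreal_leI)
      qed
      then show ?thesis
        using uv True F0 by (simp add: z_arc_length ennreal_mult[symmetric])
    qed
  qed fact
  then show ?thesis by (simp add: inner_diff_right)
qed

text \<open>The integral of \<open>dir (\<alpha> t)\<close> is \<open>z\<close>; this is the inequality form of that statement which
  suffices below.\<close>

lemma dir_inner_chord_ge:
  assumes "0 \<le> s" "s \<le> t" "t \<le> L"
    and c: "\<And>\<phi>. \<alpha> s \<le> \<phi> \<Longrightarrow> \<phi> \<le> \<alpha> t \<Longrightarrow> c \<le> cos (\<phi> - \<beta>)"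
  shows "c * (t - s) \<le> dir \<beta> \<bullet> (z t - z s)"
proof (cases "s = t")
  case False
  then have "s < t" using assms by simp
  \<comment> \<open>The bound for \<open>A\<close> is used on \<open>[u, t]\<close> with
    \<open>u > s\<close>, where \<open>\<alpha> s \<le> A u\<close>. At \<open>s\<close> itself
    \<open>A s\<close> may be smaller than \<open>\<alpha> s\<close>, so the claim is reached by
    letting \<open>u\<close> decrease to \<open>s\<close>.\<close>
  have ev: "\<forall>\<^sub>F u in at_right s. c * (t - u) \<le> dir \<beta> \<bullet> (z t - z u)"
    unfolding eventually_at_right_field
  proof (intro exI[of _ t] conjI allI impI)
    fix u assume "s < u" "u < t"
    then show "c * (t - u) \<le> dir \<beta> \<bullet> (z t - z u)"
    proof (intro dir_inner_chord_ge_A c)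
      fix \<phi> assume "A u \<le> \<phi>" "\<phi> \<le> A t"
      then show "\<alpha> s \<le> \<phi>" "\<phi> \<le> \<alpha> t"
        using \<alpha>_le[of s u] \<alpha>_ge[of t] clamped_A_eq[of u] clamped_A_eq[of t] \<open>s < u\<close> \<open>u < t\<close> assms
        by auto
    qed (use assms in auto)
  qed fact
  have "(z \<longlongrightarrow> z s) (at s within {s<..})"
    using continuous_on_z[of UNIV] by (metis UNIV_I continuous_on_eq_continuous_at continuous_within_subset continuous_within isCont_def open_UNIV tendsto_within_subset top_greatest)
  then have "((\<lambda>u. dir \<beta> \<bullet> (z t - z u)) \<longlongrightarrow> dir \<beta> \<bullet> (z t - z s)) (at_right s)"
    by (intro tendsto_intros)
  moreover have "((\<lambda>u. c * (t - u)) \<longlongrightarrow> c * (t - s)) (at_right s)"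
    by (intro tendsto_intros)
  ultimately show ?thesis
    by (rule tendsto_le[rotated, OF _ _ ev]) simp
qed simp

text \<open>A chord over a parameter step \<open>h\<close> has length at most \<open>h\<close> and
  component at least \<open>h * cos (\<alpha> y - \<alpha> s)\<close> along
  \<open>dir (\<alpha> s)\<close>. Expanding the square bounds its distance from
  \<open>h *\<^sub>R dir (\<alpha> s)\<close> by
  \<open>h * sqrt (2 * (1 - cos (\<alpha> y - \<alpha> s)))\<close>, and right continuity of
  \<alpha> finishes.\<close>

lemma z_right_derivative:
  assumes "0 \<le> s" "s < L"
  shows "(z has_vector_derivative dir (\<alpha> s)) (at_right s)"
  unfolding has_vector_derivative_def has_derivative_iff_norm
proof (intro conjI bounded_linear_scaleR_left)
  let ?B = "\<lambda>y. sqrt (2 * (1 - cos (\<alpha> y - \<alpha> s)))"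
  have lim: "(\<alpha> \<longlongrightarrow> \<alpha> s) (at_right s)"
    using \<alpha>_right_cont[of s] by (simp add: continuous_within)
  have "(?B \<longlongrightarrow> sqrt (2 * (1 - cos (\<alpha> s - \<alpha> s)))) (at_right s)"
    by (intro tendsto_intros lim)
  then have B0: "(?B \<longlongrightarrow> 0) (at_right s)" by simp
  have "\<forall>\<^sub>F y in at_right s. \<alpha> y < \<alpha> s + pi"
    using order_tendstoD(2)[OF lim] by simp
  moreover have "\<forall>\<^sub>F y in at_right s. y \<in> {s<..<L}"
    using assms(2) by (rule eventually_at_right_real)
  ultimately have ev: "\<forall>\<^sub>F y in at_right s.
      norm (z y - z s - (y - s) *\<^sub>R dir (\<alpha> s)) / norm (y - s) \<le> ?B y"
  proof eventually_elim
    case (elim y)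
    let ?v = "z y - z s" and ?h = "y - s" and ?c = "cos (\<alpha> y - \<alpha> s)"
    have h: "?h > 0" using elim by simp
    have "?c * ?h \<le> dir (\<alpha> s) \<bullet> ?v"
      by (rule dir_inner_chord_ge) (use elim assms in \<open>auto intro!: cos_monotone_0_pi_le\<close>)
    moreover have "norm ?v \<le> ?h"
      using z_dist[of y s] h by (simp add: dist_norm)
    then have "(norm ?v)\<^sup>2 \<le> ?h\<^sup>2" by (intro power_mono) auto
    moreover have "(norm (?v - ?h *\<^sub>R dir (\<alpha> s)))\<^sup>2 = (norm ?v)\<^sup>2 - 2 * ?h * (dir (\<alpha> s) \<bullet> ?v) + ?h\<^sup>2"
    proof -
      have "dir (\<alpha> s) \<bullet> dir (\<alpha> s) = 1" by (simp add: dir_inner_dir)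
      then show ?thesis
        unfolding power2_norm_eq_inner
        by (simp add: inner_diff_left inner_diff_right inner_commute power2_eq_square algebra_simps)
    qed
    moreover have "2 * ?h * (?c * ?h) \<le> 2 * ?h * (dir (\<alpha> s) \<bullet> ?v)"
      using calculation(1) h by (intro mult_left_mono) auto
    ultimately have "(norm (?v - ?h *\<^sub>R dir (\<alpha> s)))\<^sup>2 \<le> ?h\<^sup>2 * (2 * (1 - ?c))"
      by (simp add: algebra_simps power2_eq_square)
    then have "norm (?v - ?h *\<^sub>R dir (\<alpha> s)) \<le> sqrt (?h\<^sup>2 * (2 * (1 - ?c)))"
      by (rule real_le_rsqrt)
    also have "\<dots> = ?B y * ?h" using h by (simp add: real_sqrt_mult)
    finally show ?case using h by (simp add: pos_divide_le_eq)
  qed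
  show "((\<lambda>y. norm (z y - z s - (y - s) *\<^sub>R dir (\<alpha> s)) / norm (y - s)) \<longlongrightarrow> 0) (at_right s)"
    by (rule tendsto_sandwich[OF _ ev tendsto_const B0]) (rule always_eventually, simp)
qed

lemma right_derivative_z:
  assumes "0 \<le> s" "s < L"
  shows "right_derivative z s = dir (\<alpha> s)"
  unfolding right_derivative_def
  by (rule vector_derivative_within[OF _ z_right_derivative[OF assms]]) simp

text \<open>Near \<open>t\<close> the right derivative is \<open>dir \<circ> \<alpha>\<close>, whose
  derivative is \<open>D\<close> times the unit normal; the determinant of a unit vector and
  \<open>D\<close> times its normal is \<open>D\<close>.\<close>

lemma affine_density_z:
  assumes "0 < t" "t < L" "(\<alpha> has_real_derivative D) (at t)"
  shows "affine_density z t = root 3 D"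
proof -
  have "(\<alpha> has_vector_derivative D) (at t)"
    using assms(3) by (simp add: has_real_derivative_iff_has_vector_derivative)
  then have "(dir \<circ> \<alpha> has_vector_derivative D *\<^sub>R dir (\<alpha> t + pi / 2)) (at t)"
    by (rule vector_diff_chain_at) (rule dir_has_vector_derivative)
  then have "(right_derivative z has_vector_derivative D *\<^sub>R dir (\<alpha> t + pi / 2)) (at t)"
    by (rule has_vector_derivative_transform_within_open[where S="{0<..<L}"])
      (use assms right_derivative_z in auto)
  then have "vector_derivative (right_derivative z) (at t) = D *\<^sub>R dir (\<alpha> t + pi / 2)"
    by (rule vector_derivative_at)
  then have "det (transpose (vector [right_derivative z t, vector_derivative (right_derivative z) (at t)] :: real^2^2))
      = cross2 (dir (\<alpha> t)) (D *\<^sub>R dir (\<alpha> t + pi / 2))"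
    using right_derivative_z[of t] assms
    by (simp add: det_2 transpose_def vector_2 cross2_def mult.commute)
  also have "\<dots> = D" by (simp add: cross2_simps cross2_dir_dir)
  finally show ?thesis by (simp add: affine_density_def)
qed

abbreviation \<kappa> :: "real \<Rightarrow> ennreal" where
  "\<kappa> t \<equiv> ennreal (root 3 (\<alpha>.density_part t))"

lemma AE_affine_density: "AE t in lborel. t \<in> {0..<L} \<longrightarrow> ennreal (affine_density z t) = \<kappa> t"
  using \<alpha>.AE_density_part AE_lborel_singleton[of 0]
  by eventually_elim (use affine_density_z in auto)

lemma emeasure_param_affine_arclength:
  assumes [measurable]: "E \<in> sets borel"
  shows "emeasure (param_affine_arclength L z) E = (\<integral>\<^sup>+t\<in>{0..L}. \<kappa> t * indicator E (z t) \<partial>lborel)"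
proof -
  let ?M = "lebesgue_on {0..<L}"
  have [measurable]: "z \<in> borel_measurable borel"
    by (intro borel_measurable_continuous_onI continuous_on_z)
  have zM [measurable]: "z \<in> borel_measurable ?M"
    by (intro measurable_restrict_space1 measurable_completion) simp
  have \<kappa>M [measurable]: "\<kappa> \<in> borel_measurable ?M"
    by (intro measurable_restrict_space1 measurable_completion) simp
  have "AE t in ?M. ennreal (affine_density z t) = \<kappa> t"
    using AE_affine_density
    by (subst AE_restrict_space_iff) (auto intro!: AE_completion)
  \<comment> \<open>\<open>affine_density\<close> agrees with the Borel function \<kappa> almost
    everywhere, and its own measurability has not been established; so the two densities are
    identified through the integrals that define them.\<close>
  then have dens: "density ?M (\<lambda>t. ennreal (affine_density z t)) = density ?M \<kappa>"
    unfolding density_def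
    by (intro arg_cong[where f="measure_of (space ?M) (sets ?M)"] ext nn_integral_cong_AE)
      (elim eventually_mono, simp)
  have "emeasure (param_affine_arclength L z) E = emeasure (density ?M \<kappa>) (z -` E \<inter> {0..<L})"
    unfolding param_affine_arclength_def dens
    by (subst emeasure_distr) auto
  also have "\<dots> = (\<integral>\<^sup>+t. \<kappa> t * indicator (z -` E \<inter> {0..<L}) t \<partial>?M)"
    by (rule emeasure_density[OF \<kappa>M]) (use measurable_sets[OF zM assms] in simp)
  also have "\<dots> = (\<integral>\<^sup>+t\<in>{0..<L}. \<kappa> t * indicator E (z t) \<partial>lebesgue)"
    by (subst nn_integral_restrict_space) (auto intro!: nn_integral_cong simp: indicator_def)
  also have "\<dots> = (\<integral>\<^sup>+t\<in>{0..<L}. \<kappa> t * indicator E (z t) \<partial>lborel)"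
    by (rule nn_integral_completion)
  also have "\<dots> = (\<integral>\<^sup>+t\<in>{0..L}. \<kappa> t * indicator E (z t) \<partial>lborel)"
    using AE_lborel_singleton[of L]
    by (intro nn_integral_cong_AE) (auto elim!: eventually_mono simp: indicator_def)
  finally show ?thesis .
qed

end

section \<open>Covering arcs by rectangles\<close>

lemma mem_rectangle_iff:
  fixes f :: "real^2 \<Rightarrow> real^2"
  assumes f: "orthogonal_transformation f"
  shows "x \<in> (\<lambda>x. c + f x) ` cbox 0 (vector [a, b]) \<longleftrightarrow>
    f (axis 1 1) \<bullet> (x - c) \<in> {0..a} \<and> f (axis 2 1) \<bullet> (x - c) \<in> {0..b}"
proof -
  obtain y where y: "f y = x - c" using orthogonal_transformation_surj[OF f] by (metis surjD)
  have inj: "f u = f v \<longleftrightarrow> u = v" for u v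
    using orthogonal_transformation_inj[OF f] by (auto dest: injD)
  have "x \<in> (\<lambda>x. c + f x) ` cbox 0 (vector [a, b]) \<longleftrightarrow> y \<in> cbox 0 (vector [a, b])"
  proof
    assume "x \<in> (\<lambda>x. c + f x) ` cbox 0 (vector [a, b])"
    then obtain y' where "y' \<in> cbox 0 (vector [a, b])" "x = c + f y'" by blast
    then show "y \<in> cbox 0 (vector [a, b])" using y inj[of y y'] by simp
  next
    assume "y \<in> cbox 0 (vector [a, b])"
    then show "x \<in> (\<lambda>x. c + f x) ` cbox 0 (vector [a, b])"
      using y by (intro image_eqI[of _ _ y]) auto
  qed
  also have "\<dots> \<longleftrightarrow> y $ 1 \<in> {0..a} \<and> y $ 2 \<in> {0..b}"
    by (auto simp: mem_box_cart forall_2 vector_2)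
  also have "\<dots> \<longleftrightarrow> f (axis 1 1) \<bullet> (x - c) \<in> {0..a} \<and> f (axis 2 1) \<bullet> (x - c) \<in> {0..b}"
  proof -
    have "y $ 1 = f (axis 1 1) \<bullet> (x - c)" "y $ 2 = f (axis 2 1) \<bullet> (x - c)"
      using f unfolding y[symmetric] orthogonal_transformation_def by (simp_all add: inner_axis')
    then show ?thesis by simp
  qed
  finally show ?thesis .
qed

lemma measure_rectangle:
  fixes f :: "real^2 \<Rightarrow> real^2"
  assumes f: "orthogonal_transformation f" and "0 \<le> a" "0 \<le> b"
  shows "measure lebesgue ((\<lambda>x. c + f x) ` cbox 0 (vector [a, b])) = a * b"
proof -
  have "cbox (0 :: real^2) (vector [a, b]) \<noteq> {}"
    using assms by (simp add: interval_ne_empty_cart forall_2 vector_2)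
  then have "measure lebesgue (cbox (0 :: real^2) (vector [a, b])) = a * b"
    by (simp add: content_cbox_cart UNIV_2 vector_2)
  moreover have "(\<lambda>x. c + f x) ` cbox 0 (vector [a, b]) = (+) c ` f ` cbox 0 (vector [a, b])"
    by (simp add: image_image)
  ultimately show ?thesis
    by (simp add: measure_translation measure_orthogonal_image[OF f])
qed

text \<open>Centre, direction and half side lengths: this form is symmetric under reversing either
  axis and states membership through the two frame components.\<close>

definition frame_rectangle :: "real \<Rightarrow> real^2 \<Rightarrow> real \<Rightarrow> real \<Rightarrow> (real^2) set" where
  "frame_rectangle a q w k = {x. \<bar>dir a \<bullet> (x - q)\<bar> \<le> w \<and> \<bar>cross2 (dir a) (x - q)\<bar> \<le> k}"

lemma frame_rectangle_in_rectangles: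
  assumes "0 < w" "0 < k" "2 * w + 2 * k \<le> \<delta>"
  shows "frame_rectangle a q w k \<in> rectangles \<delta>"
    and "measure lebesgue (frame_rectangle a q w k) = 4 * (w * k)"
proof -
  define f where "f x = (x $ 1) *\<^sub>R dir a + (x $ 2) *\<^sub>R dir (a + pi / 2)" for x :: "real^2"
  have lin: "linear f"
    by (rule linearI) (simp_all add: f_def algebra_simps)
  have orth: "orthogonal_transformation f"
    unfolding orthogonal_transformation_def
  proof (intro conjI allI lin)
    fix v u :: "real^2"
    show "f v \<bullet> f u = v \<bullet> u"
      by (simp add: f_def inner_add_left inner_add_right dir_inner_dir) (simp add: inner_2)
  qed
  have fx: "f (axis 1 1) = dir a" "f (axis 2 1) = dir (a + pi / 2)"
    by (simp_all add: f_def axis_def)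
  define c where "c = q - w *\<^sub>R dir a - k *\<^sub>R dir (a + pi / 2)"
  have in1: "dir a \<bullet> (x - c) = dir a \<bullet> (x - q) + w" for x
    by (simp add: c_def algebra_simps inner_diff_right dir_inner_dir inner_add_right)
  have in2: "dir (a + pi / 2) \<bullet> (x - c) = cross2 (dir a) (x - q) + k" for x
    by (simp add: c_def algebra_simps inner_diff_right inner_add_right dir_inner_dir flip: dir_quarter)
  have eq: "frame_rectangle a q w k = (\<lambda>x. c + f x) ` cbox 0 (vector [2 * w, 2 * k])"
    unfolding set_eq_iff mem_rectangle_iff[OF orth] fx in1 in2
    by (auto simp: frame_rectangle_def abs_le_iff)
  show "measure lebesgue (frame_rectangle a q w k) = 4 * (w * k)"
    unfolding eq using assms by (simp add: measure_rectangle[OF orth])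
  have "diameter (frame_rectangle a q w k) \<le> 2 * w + 2 * k"
  proof (rule diameter_le)
    fix x y assume "x \<in> frame_rectangle a q w k" "y \<in> frame_rectangle a q w k"
    then have "\<bar>dir a \<bullet> (x - q)\<bar> \<le> w" "\<bar>dir a \<bullet> (y - q)\<bar> \<le> w"
      "\<bar>cross2 (dir a) (x - q)\<bar> \<le> k" "\<bar>cross2 (dir a) (y - q)\<bar> \<le> k"
      by (auto simp: frame_rectangle_def)
    moreover have "dir a \<bullet> (x - y) = dir a \<bullet> (x - q) - dir a \<bullet> (y - q)"
      "cross2 (dir a) (x - y) = cross2 (dir a) (x - q) - cross2 (dir a) (y - q)"
      by (simp_all add: inner_diff_right cross2_simps)
    ultimately have *: "\<bar>dir a \<bullet> (x - y)\<bar> \<le> 2 * w" "\<bar>cross2 (dir a) (x - y)\<bar> \<le> 2 * k"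
      by linarith+
    have "norm (x - y) = norm ((dir a \<bullet> (x - y)) *\<^sub>R dir a + cross2 (dir a) (x - y) *\<^sub>R dir (a + pi / 2))"
      by (subst dir_decomp[of "x - y" a]) simp
    also have "\<dots> \<le> \<bar>dir a \<bullet> (x - y)\<bar> + \<bar>cross2 (dir a) (x - y)\<bar>"
      by (rule norm_triangle_le) simp
    also have "\<dots> \<le> 2 * w + 2 * k" using * by linarith
    finally show "norm (x - y) \<le> 2 * w + 2 * k" .
  qed (use assms in auto)
  then show "frame_rectangle a q w k \<in> rectangles \<delta>"
    unfolding rectangles_def using assms orth
    by (intro CollectI conjI exI[of _ f] exI[of _ c] exI[of _ "2 * w"] exI[of _ "2 * k"] eq) auto
qed

lemma unit_vector_dir:
  assumes "norm v = 1"
  shows "\<exists>a. v = dir a"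
proof -
  have "(v $ 1)\<^sup>2 + (v $ 2)\<^sup>2 = 1"
    using assms power2_norm_eq_inner[of v] by (simp add: inner_2 power2_eq_square)
  then obtain a where "v $ 1 = cos a" "v $ 2 = sin a"
    using sincos_total_2pi by metis
  then show ?thesis by (intro exI[of _ a]) (simp add: vec_eq_iff forall_2)
qed

text \<open>The orthogonal map may reverse orientation, so the second axis is a quarter turn of the
  first only up to sign. Moving the origin to the centre makes that sign irrelevant.\<close>

lemma rectangle_eq_frame_rectangle:
  assumes "R \<in> rectangles \<delta>"
  shows "\<exists>a q w k. 0 < w \<and> 0 < k \<and> R = frame_rectangle a q w k \<and> measure lebesgue R = 4 * (w * k)"
proof -
  obtain f c A B where f: "orthogonal_transformation f" and AB: "0 < A" "0 < B"
    and R: "R = (\<lambda>x. c + f x) ` cbox 0 (vector [A, B] :: real^2)"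
    using assms by (auto simp: rectangles_def)
  define u v where "u = f (axis 1 1)" and "v = f (axis 2 1)"
  have n: "norm u = 1" "norm v = 1" "u \<bullet> v = 0"
    using orthogonal_transformation_norm[OF f] f
    by (auto simp: u_def v_def orthogonal_transformation_def inner_axis_axis)
  obtain a where a: "u = dir a" using unit_vector_dir n by blast
  have v: "v = cross2 (dir a) v *\<^sub>R dir (a + pi / 2)"
    using dir_decomp[of v a] n(3) a by simp
  have "\<bar>cross2 (dir a) v\<bar> = 1"
    using arg_cong[OF v, of norm] n(2) by simp
  then have sgn: "v = dir (a + pi / 2) \<or> v = - dir (a + pi / 2)"
    using v by (auto simp: abs_if split: if_splits)
  define q where "q = c + (A / 2) *\<^sub>R u + (B / 2) *\<^sub>R v"
  have uu: "u \<bullet> u = 1" "v \<bullet> v = 1" "v \<bullet> u = 0"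
    using n by (simp_all add: dot_square_norm inner_commute)
  have "u \<bullet> (x - c) = u \<bullet> (x - q) + A / 2" "v \<bullet> (x - c) = v \<bullet> (x - q) + B / 2" for x
    using n(3) by (simp_all add: q_def inner_diff_right inner_add_right uu)
  then have "x \<in> R \<longleftrightarrow> \<bar>u \<bullet> (x - q)\<bar> \<le> A / 2 \<and> \<bar>v \<bullet> (x - q)\<bar> \<le> B / 2" for x
    unfolding R mem_rectangle_iff[OF f] u_def[symmetric] v_def[symmetric] by (auto simp: abs_le_iff)
  moreover have "\<bar>v \<bullet> x\<bar> = \<bar>cross2 (dir a) x\<bar>" for x
    using sgn by (auto simp: dir_quarter)
  ultimately have "R = frame_rectangle a q (A / 2) (B / 2)"
    by (auto simp: frame_rectangle_def a)
  then show ?thesis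
    using AB measure_rectangle[OF f, of A B c] R
    by (intro exI[of _ a] exI[of _ q] exI[of _ "A / 2"] exI[of _ "B / 2"]) auto
qed

text \<open>Writing the sum over cells as the integral of a step function makes convergence theorems
  available when the mesh tends to 0.\<close>

lemma nn_integral_step:
  fixes g :: "int \<Rightarrow> ennreal"
  assumes "h > 0"
  shows "(\<integral>\<^sup>+x\<in>{s..<s + real n * h}. g \<lfloor>(x - s) / h\<rfloor> \<partial>lborel) = (\<Sum>i<n. ennreal h * g (int i))"
proof (induction n)
  case (Suc n)
  have "indicator {s..<s + real (Suc n) * h} x
      = (indicator {s..<s + real n * h} x + indicator {s + real n * h..<s + real (Suc n) * h} x :: ennreal)" for x
  proof -
    have "0 \<le> real n * h" "real (Suc n) * h = real n * h + h" using assms by (auto simp: algebra_simps)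
    then have "s \<le> s + real n * h" "s + real n * h \<le> s + real (Suc n) * h" using assms by linarith+
    then show ?thesis unfolding indicator_def by (auto simp del: of_nat_Suc)
  qed
  then have "(\<integral>\<^sup>+x\<in>{s..<s + real (Suc n) * h}. g \<lfloor>(x - s) / h\<rfloor> \<partial>lborel)
     = (\<integral>\<^sup>+x. g \<lfloor>(x - s) / h\<rfloor> * indicator {s..<s + real n * h} x
        + g \<lfloor>(x - s) / h\<rfloor> * indicator {s + real n * h..<s + real (Suc n) * h} x \<partial>lborel)"
    by (simp add: distrib_left)
  also have "\<dots> = (\<integral>\<^sup>+x\<in>{s..<s + real n * h}. g \<lfloor>(x - s) / h\<rfloor> \<partial>lborel)
      + (\<integral>\<^sup>+x\<in>{s + real n * h..<s + real (Suc n) * h}. g \<lfloor>(x - s) / h\<rfloor> \<partial>lborel)"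
    by (rule nn_integral_add) measurable
  also have "(\<integral>\<^sup>+x\<in>{s + real n * h..<s + real (Suc n) * h}. g \<lfloor>(x - s) / h\<rfloor> \<partial>lborel)
      = (\<integral>\<^sup>+x\<in>{s + real n * h..<s + real (Suc n) * h}. g (int n) \<partial>lborel)"
  proof (rule nn_integral_cong)
    fix x
    have "\<lfloor>(x - s) / h\<rfloor> = int n" if "s + real n * h \<le> x" "x < s + real (Suc n) * h"
      using that assms by (intro floor_unique) (simp_all add: field_simps)
    then show "g \<lfloor>(x - s) / h\<rfloor> * indicator {s + real n * h..<s + real (Suc n) * h} x
        = g (int n) * indicator {s + real n * h..<s + real (Suc n) * h} x"
      by (auto simp: indicator_def)
  qed
  also have "\<dots> = ennreal h * g (int n)"
    using assms by (simp add: nn_integral_cmult_indicator mult.commute algebra_simps)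
  finally show ?case using Suc by (simp add: add.commute)
qed simp

text \<open>A grid cell contains \<open>x\<close> at an uncontrolled place. The errors of the linear
  approximation at its two ends are proportional to their distances from \<open>x\<close>, which add
  up to the length of the cell.\<close>

lemma straddle_quotient_tendsto:
  fixes f :: "real \<Rightarrow> real"
  assumes "(f has_real_derivative D) (at x)"
    and ab: "\<And>n. a n \<le> x" "\<And>n. x \<le> b n" "\<And>n. a n < b n"
    and lim: "(\<lambda>n. b n - a n) \<longlonglongrightarrow> 0"
  shows "(\<lambda>n. (f (b n) - f (a n)) / (b n - a n)) \<longlonglongrightarrow> D"
proof (rule LIMSEQ_I)
  fix e :: real assume "e > 0"
  then have "e / 2 > 0" by simp
  have "\<forall>e>0. \<exists>d>0. \<forall>y. \<bar>y - x\<bar> < d \<longrightarrow> \<bar>f y - f x - D * (y - x)\<bar> \<le> e * \<bar>y - x\<bar>"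
    using assms(1) unfolding has_field_derivative_def has_derivative_at_alt by simp
  then obtain d where d: "d > 0" "\<And>y. \<bar>y - x\<bar> < d \<Longrightarrow> \<bar>f y - f x - D * (y - x)\<bar> \<le> e / 2 * \<bar>y - x\<bar>"
    using \<open>e / 2 > 0\<close> by blast
  obtain N where N: "\<And>n. n \<ge> N \<Longrightarrow> b n - a n < d"
    using LIMSEQ_D[OF lim \<open>d > 0\<close>] ab(3) by (fastforce simp: abs_less_iff)
  show "\<exists>N. \<forall>n\<ge>N. norm ((f (b n) - f (a n)) / (b n - a n) - D) < e"
  proof (intro exI[of _ N] allI impI)
    fix n assume "n \<ge> N"
    let ?h = "b n - a n"
    have h: "?h > 0" "?h < d" using ab(3) N \<open>n \<ge> N\<close> by auto
    have "\<bar>f (b n) - f x - D * (b n - x)\<bar> \<le> e / 2 * (b n - x)"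
      using d(2)[of "b n"] h ab[of n] by simp
    moreover have "\<bar>f (a n) - f x - D * (a n - x)\<bar> \<le> e / 2 * (x - a n)"
      using d(2)[of "a n"] h ab[of n] by simp
    moreover have "f (b n) - f (a n) - D * ?h = (f (b n) - f x - D * (b n - x)) - (f (a n) - f x - D * (a n - x))"
      by (simp add: algebra_simps)
    moreover have "e / 2 * (b n - x) + e / 2 * (x - a n) = e / 2 * ?h" by (simp flip: distrib_left)
    ultimately have "\<bar>f (b n) - f (a n) - D * ?h\<bar> \<le> e / 2 * ?h" by linarith
    moreover have "(f (b n) - f (a n)) / ?h - D = (f (b n) - f (a n) - D * ?h) / ?h"
      using h by (simp add: diff_divide_distrib)
    ultimately have "\<bar>(f (b n) - f (a n)) / ?h - D\<bar> \<le> e / 2"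
      using h by (simp add: pos_divide_le_eq)
    then show "norm ((f (b n) - f (a n)) / ?h - D) < e" using \<open>e > 0\<close> by simp
  qed
qed

lemma root3_le_add: "0 \<le> x \<Longrightarrow> root 3 x \<le> 1 + x"
proof (cases "x \<le> 1")
  case True
  assume "0 \<le> x"
  have "root 3 x \<le> root 3 1" using True by (subst real_root_le_iff) auto
  then show ?thesis using \<open>0 \<le> x\<close> by (simp only: real_root_one)
next
  case False
  assume "0 \<le> x"
  then have "x \<le> x ^ 3" using False by (simp add: self_le_power)
  then have "root 3 x \<le> root 3 (x ^ 3)" by simp
  then show ?thesis using \<open>0 \<le> x\<close> by (simp add: real_root_power_cancel)
qed

text \<open>If \<open>y = root 3 x\<close> exceeds \<open>T\<close>, then
  \<open>y * T^2 \<le> y^3 = x\<close>. This is the source of uniform integrability: the excess over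
  \<open>T\<close> is controlled by the integral of \<open>x\<close>.\<close>

lemma root3_truncate:
  assumes "0 \<le> x" "T > 0"
  shows "root 3 x \<le> min (root 3 x) T + x / T\<^sup>2"
proof (cases "root 3 x \<le> T")
  case False
  let ?y = "root 3 x"
  have y: "?y \<ge> 0" "x = ?y ^ 3" using assms by simp_all
  have "?y * T\<^sup>2 \<le> ?y * ?y\<^sup>2"
    using False y assms by (intro mult_left_mono power_mono) auto
  also have "\<dots> = x" using y(2) by (simp add: power3_eq_cube power2_eq_square)
  finally have "?y \<le> x / T\<^sup>2" using assms by (simp add: pos_le_divide_eq)
  then show ?thesis using False assms by linarith
qed (use assms in simp)

lemma root3_add_le:
  assumes "0 \<le> x" "0 \<le> y"
  shows "root 3 (x + y) \<le> root 3 x + root 3 y"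
proof -
  let ?a = "root 3 x" and ?b = "root 3 y"
  have ab: "?a \<ge> 0" "?b \<ge> 0" "x = ?a ^ 3" "y = ?b ^ 3" using assms by simp_all
  have "?a ^ 3 + ?b ^ 3 \<le> (?a + ?b) ^ 3"
    using ab by (simp add: power3_eq_cube algebra_simps)
  then have "root 3 (x + y) \<le> root 3 ((?a + ?b) ^ 3)" using ab(3,4) by simp
  then show ?thesis using ab by (simp add: real_root_power_cancel)
qed

section \<open>The cost of covering one arc\<close>

context tangent_curve
begin

text \<open>Along the arc the sine of the angle to the initial tangent is at most
  \<open>\<alpha> t - \<alpha> s\<close> in absolute value; applying
  \<open>dir_inner_chord_ge\<close> to both normals bounds the normal displacement on both sides.
  The slack \<eta> allows a nondegenerate rectangle over a straight arc.\<close>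

lemma arc_subset_frame_rectangle:
  assumes "0 \<le> s" "s \<le> t" "t \<le> L" "\<eta> \<ge> 0"
  shows "z ` {s..t} \<subseteq> frame_rectangle (\<alpha> s) (z s) (t - s) ((t - s) * (\<alpha> t - \<alpha> s) + \<eta>)"
proof
  fix x assume "x \<in> z ` {s..t}"
  then obtain u where u: "s \<le> u" "u \<le> t" "x = z u" by auto
  let ?v = "z u - z s" and ?D = "\<alpha> t - \<alpha> s"
  have D: "0 \<le> ?D" using \<alpha>_mono assms by simp
  have "\<bar>dir (\<alpha> s) \<bullet> ?v\<bar> \<le> norm (dir (\<alpha> s)) * norm ?v" by (rule Cauchy_Schwarz_ineq2)
  also have "\<dots> \<le> u - s" using z_dist[of u s] u by (simp add: dist_norm)
  finally have 1: "\<bar>dir (\<alpha> s) \<bullet> ?v\<bar> \<le> t - s" using u by simp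
  have sin_bound: "\<bar>sin (\<phi> - \<alpha> s)\<bar> \<le> ?D" if "\<alpha> s \<le> \<phi>" "\<phi> \<le> \<alpha> u" for \<phi>
    using abs_sin_x_le_abs_x[of "\<phi> - \<alpha> s"] that \<alpha>_mono[of u t] u by linarith
  have "- ?D * (u - s) \<le> dir (\<alpha> s + pi / 2) \<bullet> ?v"
  proof (rule dir_inner_chord_ge)
    fix \<phi> assume \<phi>: "\<alpha> s \<le> \<phi>" "\<phi> \<le> \<alpha> u"
    have "cos (\<phi> - (\<alpha> s + pi / 2)) = sin (\<phi> - \<alpha> s)"
      by (simp add: sin_cos_eq cos_minus[of "\<phi> - (\<alpha> s + pi / 2)", symmetric] algebra_simps)
    then show "- ?D \<le> cos (\<phi> - (\<alpha> s + pi / 2))" using sin_bound[OF \<phi>] by linarith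
  qed (use assms u in auto)
  moreover have "- ?D * (u - s) \<le> dir (\<alpha> s + pi / 2 + pi) \<bullet> ?v"
  proof (rule dir_inner_chord_ge)
    fix \<phi> assume \<phi>: "\<alpha> s \<le> \<phi>" "\<phi> \<le> \<alpha> u"
    have "cos (\<phi> - (\<alpha> s + pi / 2)) = sin (\<phi> - \<alpha> s)"
      by (simp add: sin_cos_eq cos_minus[of "\<phi> - (\<alpha> s + pi / 2)", symmetric] algebra_simps)
    moreover have "cos (\<phi> - (\<alpha> s + pi / 2 + pi)) = - cos (\<phi> - (\<alpha> s + pi / 2))"
      using cos_periodic_pi2[of "\<phi> - (\<alpha> s + pi / 2 + pi)"] cos_minus_pi[of "\<phi> - (\<alpha> s + pi / 2)"] by (simp add: algebra_simps)
    ultimately show "- ?D \<le> cos (\<phi> - (\<alpha> s + pi / 2 + pi))" using sin_bound[OF \<phi>] by linarith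
  qed (use assms u in auto)
  moreover have "dir (\<alpha> s + pi / 2 + pi) = - dir (\<alpha> s + pi / 2)" by (rule dir_pi)
  ultimately have "\<bar>cross2 (dir (\<alpha> s)) ?v\<bar> \<le> ?D * (u - s)"
    unfolding dir_quarter[symmetric] by (simp add: abs_le_iff algebra_simps)
  also have "\<dots> \<le> ?D * (t - s)" using D u by (intro mult_left_mono) auto
  finally show "x \<in> frame_rectangle (\<alpha> s) (z s) (t - s) (( t - s) * ?D + \<eta>)"
    using 1 u assms(4) by (simp add: frame_rectangle_def mult.commute)
qed

definition cell_slope :: "real \<Rightarrow> real \<Rightarrow> int \<Rightarrow> real" where
  "cell_slope s h i = (\<alpha> (s + (real_of_int i + 1) * h) - \<alpha> (s + real_of_int i * h)) / h"

lemma cell_slope_nonneg: "h > 0 \<Longrightarrow> 0 \<le> cell_slope s h i"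
  unfolding cell_slope_def by (intro divide_nonneg_pos) (auto intro!: \<alpha>_mono simp: algebra_simps)

text \<open>Taking the slack as \<open>h\<^sup>2 * \<epsilon>\<close> makes the area over a cell
  equal to \<open>h ^ 3 * (4 * (cell_slope + \<epsilon>))\<close>, so its cost is \<open>h\<close>
  times a cube root and the total is an integral.\<close>

lemma affine_premeasure_arc_le:
  assumes "0 \<le> s" "s < t" "t \<le> L" "\<epsilon> > 0" "n > 0" and h: "h = (t - s) / real n"
    and small: "2 * h + 2 * (h * (\<alpha> t - \<alpha> s) + h\<^sup>2 * \<epsilon>) \<le> \<delta>"
  shows "affine_premeasure \<delta> (z ` {s..t})
    \<le> ennreal (root 3 4) * (\<integral>\<^sup>+x\<in>{s..<t}. ennreal (root 3 (cell_slope s h \<lfloor>(x - s) / h\<rfloor> + \<epsilon>)) \<partial>lborel)"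
proof -
  let ?w = "\<lambda>R :: (real^2) set. ennreal (root 3 (measure lebesgue R))"
  have hpos: "h > 0" and hn: "s + real n * h = t" using assms by auto
  define c where "c i = s + real i * h" for i
  have c_mono: "c i \<le> c j" if "i \<le> j" for i j
    using that hpos by (simp add: c_def)
  have c_bounds: "s \<le> c i" "c i \<le> t" if "i \<le> n" for i
    using c_mono[of 0 i] c_mono[of i n] that hn by (auto simp: c_def)
  have c_Suc: "c (Suc i) - c i = h" for i by (simp add: c_def algebra_simps)
  define D where "D i = \<alpha> (c (Suc i)) - \<alpha> (c i)" for i
  have D0: "0 \<le> D i" for i using \<alpha>_mono[OF c_mono[of i "Suc i"]] by (simp add: D_def)
  have D_le: "D i \<le> \<alpha> t - \<alpha> s" if "i < n" for i
    using \<alpha>_mono[of s "c i"] \<alpha>_mono[of "c (Suc i)" t] c_bounds[of i] c_bounds[of "Suc i"] that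
    by (simp add: D_def)
  define R where "R i = frame_rectangle (\<alpha> (c i)) (z (c i)) h (h * D i + h\<^sup>2 * \<epsilon>)" for i
  have pos: "0 < h * D i + h\<^sup>2 * \<epsilon>" for i
    using hpos D0[of i] \<open>\<epsilon> > 0\<close> by (simp add: add_nonneg_pos)
  have R: "R i \<in> rectangles \<delta>" "measure lebesgue (R i) = 4 * (h * (h * D i + h\<^sup>2 * \<epsilon>))" if "i < n" for i
  proof -
    have "h * D i \<le> h * (\<alpha> t - \<alpha> s)" using D_le[OF that] hpos by (intro mult_left_mono) auto
    then have "2 * h + 2 * (h * D i + h\<^sup>2 * \<epsilon>) \<le> 2 * h + 2 * (h * (\<alpha> t - \<alpha> s) + h\<^sup>2 * \<epsilon>)"
      by (simp add: algebra_simps)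
    with small have "2 * h + 2 * (h * D i + h\<^sup>2 * \<epsilon>) \<le> \<delta>" by (rule order_trans[rotated])
    then show "R i \<in> rectangles \<delta>" "measure lebesgue (R i) = 4 * (h * (h * D i + h\<^sup>2 * \<epsilon>))"
      unfolding R_def using hpos pos by (intro frame_rectangle_in_rectangles; simp)+
  qed
  have cover: "z ` {s..t} \<subseteq> \<Union>(R ` {..<n})"
  proof
    fix x assume "x \<in> z ` {s..t}"
    then obtain u where u: "s \<le> u" "u \<le> t" "x = z u" by auto
    have "\<exists>i<n. c i \<le> u \<and> u \<le> c (Suc i)"
    proof (cases "u = t")
      case True
      then show ?thesis using \<open>n > 0\<close> c_bounds[of "n - 1"] hn by (intro exI[of _ "n - 1"]) (auto simp: c_def)
    next
      case False
      define i where "i = nat \<lfloor>(u - s) / h\<rfloor>"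
      have q: "0 \<le> (u - s) / h" using u hpos by simp
      have i: "real i \<le> (u - s) / h" "(u - s) / h < real i + 1"
        using q by (auto simp: i_def of_nat_nat)
      have "(u - s) / h < n" using u False hn hpos by (simp add: pos_divide_less_eq)
      then have "i < n" using i by linarith
      then show ?thesis
        using i hpos by (intro exI[of _ i]) (auto simp: c_def pos_le_divide_eq pos_divide_less_eq algebra_simps)
    qed
    then obtain i where i: "i < n" "c i \<le> u" "u \<le> c (Suc i)" by blast
    have "z ` {c i..c (Suc i)} \<subseteq> R i"
      unfolding R_def D_def using arc_subset_frame_rectangle[of "c i" "c (Suc i)" "h\<^sup>2 * \<epsilon>"]
        c_mono[of i "Suc i"] c_bounds[of i] c_bounds[of "Suc i"] i(1) assms
      by (simp add: c_Suc)
    then have "x \<in> R i" using u i by auto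
    then show "x \<in> \<Union>(R ` {..<n})" using i(1) by blast
  qed
  have "affine_premeasure \<delta> (z ` {s..t}) \<le> infsum ?w (R ` {..<n})"
    by (rule affine_premeasure_le[OF _ _ cover]) (use R in auto)
  also have "\<dots> = sum ?w (R ` {..<n})" by simp
  \<comment> \<open>Different cells may produce the same rectangle, which a cover counts only
    once.\<close>
  also have "\<dots> \<le> (\<Sum>i<n. ?w (R i))"
    using sum_image_le[of "{..<n}" ?w R] by (simp add: o_def)
  also have "\<dots> = (\<Sum>i<n. ennreal h * (ennreal (root 3 4) * ennreal (root 3 (cell_slope s h (int i) + \<epsilon>))))"
  proof (rule sum.cong[OF refl])
    fix i assume "i \<in> {..<n}"
    have cs: "cell_slope s h (int i) = D i / h"
      by (simp add: cell_slope_def D_def c_def add.commute)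
    have "4 * (h * (h * D i + h\<^sup>2 * \<epsilon>)) = h ^ 3 * (4 * (cell_slope s h (int i) + \<epsilon>))"
      using hpos by (simp add: cs power3_eq_cube power2_eq_square algebra_simps)
    then have "root 3 (measure lebesgue (R i)) = h * (root 3 4 * root 3 (cell_slope s h (int i) + \<epsilon>))"
      using R(2)[of i] \<open>i \<in> _\<close> hpos
      by (simp add: real_root_mult real_root_power_cancel del: distrib_left_numeral)
    then show "?w (R i) = ennreal h * (ennreal (root 3 4) * ennreal (root 3 (cell_slope s h (int i) + \<epsilon>)))"
      using hpos cell_slope_nonneg[OF hpos, of s "int i"] \<open>\<epsilon> > 0\<close> by (simp add: ennreal_mult)
  qed
  also have "\<dots> = ennreal (root 3 4) * (\<Sum>i<n. ennreal h * ennreal (root 3 (cell_slope s h (int i) + \<epsilon>)))"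
    by (simp add: sum_distrib_left mult.left_commute)
  also have "(\<Sum>i<n. ennreal h * ennreal (root 3 (cell_slope s h (int i) + \<epsilon>)))
      = (\<integral>\<^sup>+x\<in>{s..<t}. ennreal (root 3 (cell_slope s h \<lfloor>(x - s) / h\<rfloor> + \<epsilon>)) \<partial>lborel)"
    using nn_integral_step[OF hpos, where s=s and n=n and g="\<lambda>i. ennreal (root 3 (cell_slope s h i + \<epsilon>))"] hn by simp
  finally show ?thesis .
qed

lemma cell_slope_tendsto:
  assumes "(\<alpha> has_real_derivative D) (at x)" "s < t"
  shows "(\<lambda>n. cell_slope s ((t - s) / Suc n) \<lfloor>(x - s) / ((t - s) / Suc n)\<rfloor>) \<longlonglongrightarrow> D"
proof -
  define h where "h n = (t - s) / Suc n" for n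
  have h: "h n > 0" for n using assms(2) by (simp add: h_def)
  define i where "i n = \<lfloor>(x - s) / h n\<rfloor>" for n
  have i: "real_of_int (i n) * h n \<le> x - s" "x - s < (real_of_int (i n) + 1) * h n" for n
    unfolding i_def pos_le_divide_eq[OF h, symmetric] pos_divide_less_eq[OF h, symmetric]
    by linarith+
  have hlim: "h \<longlonglongrightarrow> 0"
    unfolding h_def using tendsto_mult[OF tendsto_const[of "t - s"] LIMSEQ_inverse_real_of_nat]
    by (simp add: divide_inverse)
  have eq: "(s + (real_of_int (i n) + 1) * h n) - (s + real_of_int (i n) * h n) = h n" for n
    by (simp add: algebra_simps)
  have "(\<lambda>n. (\<alpha> (s + (real_of_int (i n) + 1) * h n) - \<alpha> (s + real_of_int (i n) * h n)) /
      ((s + (real_of_int (i n) + 1) * h n) - (s + real_of_int (i n) * h n))) \<longlonglongrightarrow> D"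
  proof (rule straddle_quotient_tendsto[OF assms(1)])
    show "s + real_of_int (i n) * h n \<le> x" "x \<le> s + (real_of_int (i n) + 1) * h n"
      "s + real_of_int (i n) * h n < s + (real_of_int (i n) + 1) * h n" for n
      using i[of n] h[of n] by (auto simp: algebra_simps)
  qed (simp only: eq hlim)
  then show ?thesis unfolding eq by (simp add: cell_slope_def h_def i_def)
qed

text \<open>The total turning is the same for every mesh, with jumps and singular part included;
  this bounds the truncation error uniformly in the number of cells.\<close>

lemma nn_integral_cell_slope:
  assumes "s < t" "n > 0" and h: "h = (t - s) / real n"
  shows "(\<integral>\<^sup>+x\<in>{s..<t}. ennreal (cell_slope s h \<lfloor>(x - s) / h\<rfloor>) \<partial>lborel) = ennreal (\<alpha> t - \<alpha> s)"
proof -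
  have hpos: "h > 0" and hn: "s + real n * h = t" using assms by auto
  have "(\<integral>\<^sup>+x\<in>{s..<t}. ennreal (cell_slope s h \<lfloor>(x - s) / h\<rfloor>) \<partial>lborel)
      = (\<Sum>i<n. ennreal h * ennreal (cell_slope s h (int i)))"
    using nn_integral_step[OF hpos, where s=s and n=n and g="\<lambda>i. ennreal (cell_slope s h i)"] hn by simp
  also have "\<dots> = (\<Sum>i<n. ennreal (\<alpha> (s + real (Suc i) * h) - \<alpha> (s + real i * h)))"
    using hpos cell_slope_nonneg[OF hpos]
    by (intro sum.cong) (simp_all add: ennreal_mult[symmetric], simp add: cell_slope_def add.commute)
  also have "\<dots> = ennreal (\<Sum>i<n. \<alpha> (s + real (Suc i) * h) - \<alpha> (s + real i * h))"
    using hpos by (intro sum_ennreal) (auto intro!: \<alpha>_mono)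
  also have "(\<Sum>i<n. \<alpha> (s + real (Suc i) * h) - \<alpha> (s + real i * h)) = \<alpha> t - \<alpha> s"
    using sum_lessThan_telescope[of "\<lambda>i. \<alpha> (s + real i * h)" n] hn by simp
  finally show ?thesis .
qed

text \<open>The truncated integrands are bounded by \<open>T\<close>, so they converge by dominated
  convergence. The excess integrates to at most
  \<open>(\<alpha> t - \<alpha> s + \<epsilon> * (t - s)) / T\<^sup>2\<close> whatever the mesh
  is.\<close>

lemma affine_premeasure_arc_le_truncated:
  assumes "0 \<le> s" "s < t" "t \<le> L" "\<epsilon> > 0" "T > 0" "\<delta> > 0"
  shows "affine_premeasure \<delta> (z ` {s..t})
    \<le> ennreal (root 3 4) * ((\<integral>\<^sup>+x\<in>{s..<t}. ennreal (min (root 3 (\<alpha>.density_part x + \<epsilon>)) T) \<partial>lborel)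
        + ennreal ((\<alpha> t - \<alpha> s + \<epsilon> * (t - s)) / T\<^sup>2))"
proof -
  let ?C = "ennreal (root 3 4)"
  define h where "h n = (t - s) / Suc n" for n
  have h: "h n > 0" for n using assms(2) by (simp add: h_def)
  have hlim: "h \<longlonglongrightarrow> 0"
    unfolding h_def using tendsto_mult[OF tendsto_const[of "t - s"] LIMSEQ_inverse_real_of_nat]
    by (simp add: divide_inverse)
  define D where "D n x = cell_slope s (h n) \<lfloor>(x - s) / h n\<rfloor>" for n x
  have D0: "0 \<le> D n x" for n x unfolding D_def by (rule cell_slope_nonneg[OF h])
  have [measurable]: "D n \<in> borel_measurable borel" for n
    unfolding D_def by measurable
  let ?I = "\<lambda>n. \<integral>\<^sup>+x\<in>{s..<t}. ennreal (min (root 3 (D n x + \<epsilon>)) T) \<partial>lborel"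
  let ?c = "ennreal ((\<alpha> t - \<alpha> s + \<epsilon> * (t - s)) / T\<^sup>2)"
  have "(\<lambda>n. 2 * h n + 2 * (h n * (\<alpha> t - \<alpha> s) + (h n)\<^sup>2 * \<epsilon>)) \<longlonglongrightarrow> 2 * 0 + 2 * (0 * (\<alpha> t - \<alpha> s) + 0\<^sup>2 * \<epsilon>)"
    by (intro tendsto_intros hlim)
  then have "\<forall>\<^sub>F n in sequentially. 2 * h n + 2 * (h n * (\<alpha> t - \<alpha> s) + (h n)\<^sup>2 * \<epsilon>) < \<delta>"
    using \<open>\<delta> > 0\<close> by (intro order_tendstoD(2)) auto
  then have ev: "\<forall>\<^sub>F n in sequentially. affine_premeasure \<delta> (z ` {s..t}) \<le> ?C * (?I n + ?c)"
  proof eventually_elim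
    case (elim n)
    have "affine_premeasure \<delta> (z ` {s..t}) \<le> ?C * (\<integral>\<^sup>+x\<in>{s..<t}. ennreal (root 3 (D n x + \<epsilon>)) \<partial>lborel)"
      unfolding D_def
      by (rule affine_premeasure_arc_le[where n="Suc n"]) (use assms elim in \<open>auto simp: h_def\<close>)
    also have "(\<integral>\<^sup>+x\<in>{s..<t}. ennreal (root 3 (D n x + \<epsilon>)) \<partial>lborel)
        \<le> (\<integral>\<^sup>+x. ennreal (min (root 3 (D n x + \<epsilon>)) T) * indicator {s..<t} x
            + ennreal (1 / T\<^sup>2) * (ennreal (D n x) * indicator {s..<t} x + ennreal \<epsilon> * indicator {s..<t} x) \<partial>lborel)"
    proof (rule nn_integral_mono)
      fix x
      have "root 3 (D n x + \<epsilon>) \<le> min (root 3 (D n x + \<epsilon>)) T + (D n x + \<epsilon>) / T\<^sup>2"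
        using D0[of n x] assms by (intro root3_truncate) auto
      then have "ennreal (root 3 (D n x + \<epsilon>))
          \<le> ennreal (min (root 3 (D n x + \<epsilon>)) T + 1 / T\<^sup>2 * (D n x + \<epsilon>))"
        by (intro ennreal_leI) simp
      also have "\<dots> = ennreal (min (root 3 (D n x + \<epsilon>)) T) + ennreal (1 / T\<^sup>2) * (ennreal (D n x) + ennreal \<epsilon>)"
        using D0[of n x] assms by (simp add: ennreal_plus ennreal_mult del: times_divide_eq_left)
      finally show "ennreal (root 3 (D n x + \<epsilon>)) * indicator {s..<t} x
        \<le> ennreal (min (root 3 (D n x + \<epsilon>)) T) * indicator {s..<t} x
          + ennreal (1 / T\<^sup>2) * (ennreal (D n x) * indicator {s..<t} x + ennreal \<epsilon> * indicator {s..<t} x)"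
        by (simp add: indicator_def)
    qed
    also have "\<dots> = ?I n + ennreal (1 / T\<^sup>2) * ((\<integral>\<^sup>+x\<in>{s..<t}. ennreal (D n x) \<partial>lborel) + ennreal \<epsilon> * ennreal (t - s))"
      using assms(2) by (simp add: nn_integral_add nn_integral_cmult nn_integral_cmult_indicator)
    also have "(\<integral>\<^sup>+x\<in>{s..<t}. ennreal (D n x) \<partial>lborel) = ennreal (\<alpha> t - \<alpha> s)"
      unfolding D_def by (rule nn_integral_cell_slope[where n="Suc n"]) (use assms in \<open>auto simp: h_def\<close>)
    also have "ennreal (1 / T\<^sup>2) * (ennreal (\<alpha> t - \<alpha> s) + ennreal \<epsilon> * ennreal (t - s)) = ?c"
      using assms \<alpha>_mono[of s t]
      by (simp add: ennreal_mult[symmetric] ennreal_plus[symmetric] del: ennreal_plus)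
    finally show ?case by (simp add: mult_left_mono)
  qed
  have "?I \<longlonglongrightarrow> (\<integral>\<^sup>+x\<in>{s..<t}. ennreal (min (root 3 (\<alpha>.density_part x + \<epsilon>)) T) \<partial>lborel)"
  proof (rule nn_integral_dominated_convergence[where w="\<lambda>x. ennreal T * indicator {s..<t} x"])
    show "AE x in lborel. (\<lambda>n. ennreal (min (root 3 (D n x + \<epsilon>)) T) * indicator {s..<t} x)
        \<longlonglongrightarrow> ennreal (min (root 3 (\<alpha>.density_part x + \<epsilon>)) T) * indicator {s..<t} x"
      using \<alpha>.AE_density_part
    proof eventually_elim
      case (elim x)
      have "(\<lambda>n. D n x) \<longlonglongrightarrow> \<alpha>.density_part x"
        unfolding D_def h_def by (rule cell_slope_tendsto[OF elim assms(2)])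
      then have "(\<lambda>n. ennreal (min (root 3 (D n x + \<epsilon>)) T))
          \<longlonglongrightarrow> ennreal (min (root 3 (\<alpha>.density_part x + \<epsilon>)) T)"
        by (intro tendsto_intros)
      then show ?case by (cases "x \<in> {s..<t}") auto
    qed
    show "(\<integral>\<^sup>+x. ennreal T * indicator {s..<t} x \<partial>lborel) < \<infinity>"
      using assms(2) by (simp add: nn_integral_cmult_indicator ennreal_mult_less_top)
    show "AE x in lborel. ennreal (min (root 3 (D n x + \<epsilon>)) T) * indicator {s..<t} x \<le> ennreal T * indicator {s..<t} x" for n
      by (rule AE_I2) (auto simp: indicator_def intro!: ennreal_leI)
  qed measurable
  then have "(\<lambda>n. ?C * (?I n + ?c)) \<longlonglongrightarrow> ?C * ((\<integral>\<^sup>+x\<in>{s..<t}. ennreal (min (root 3 (\<alpha>.density_part x + \<epsilon>)) T) \<partial>lborel) + ?c)"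
    by (intro ennreal_tendsto_cmult tendsto_add tendsto_const) auto
  then show ?thesis
    using ev by (rule tendsto_lowerbound) simp
qed

lemma affine_outer_measure_arc_le:
  assumes "0 \<le> s" "s < t" "t \<le> L"
  shows "affine_outer_measure (z ` {s..t}) \<le> ennreal (root 3 4) * (\<integral>\<^sup>+x\<in>{s..t}. \<kappa> x \<partial>lborel)"
proof (rule affine_outer_measure_leI)
  fix \<delta> :: real assume "\<delta> > 0"
  let ?C = "ennreal (root 3 4)"
  show "affine_premeasure \<delta> (z ` {s..t}) \<le> ?C * (\<integral>\<^sup>+x\<in>{s..t}. \<kappa> x \<partial>lborel)"
  proof (rule ennreal_le_epsilon)
    fix e0 :: real assume "e0 > 0"
    \<comment> \<open>After division by the outer factor the error is halved: \<epsilon> is chosen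
      to spend one half on the widening of the rectangles, and \<open>T\<close> to spend the other
      half on truncation.\<close>
    define e where "e = e0 / root 3 4"
    have e: "e > 0" using \<open>e0 > 0\<close> by (simp add: e_def)
    define \<epsilon> where "\<epsilon> = (e / (2 * (t - s))) ^ 3"
    have \<epsilon>: "\<epsilon> > 0" "root 3 \<epsilon> * (t - s) = e / 2"
      using e assms(2) by (simp_all add: \<epsilon>_def real_root_power_cancel) (simp add: divide_simps)
    define M where "M = \<alpha> t - \<alpha> s + \<epsilon> * (t - s)"
    have M: "M > 0" using \<epsilon> \<alpha>_mono[of s t] assms(2) by (simp add: M_def add_nonneg_pos)
    define T where "T = sqrt (2 * M / e)"
    have T: "T > 0" "M / T\<^sup>2 = e / 2" using M e by (simp_all add: T_def)
    have "affine_premeasure \<delta> (z ` {s..t})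
      \<le> ?C * ((\<integral>\<^sup>+x\<in>{s..<t}. ennreal (min (root 3 (\<alpha>.density_part x + \<epsilon>)) T) \<partial>lborel) + ennreal (M / T\<^sup>2))"
      unfolding M_def by (rule affine_premeasure_arc_le_truncated) (use assms \<epsilon> T \<open>\<delta> > 0\<close> in auto)
    also have "(\<integral>\<^sup>+x\<in>{s..<t}. ennreal (min (root 3 (\<alpha>.density_part x + \<epsilon>)) T) \<partial>lborel)
        \<le> (\<integral>\<^sup>+x. \<kappa> x * indicator {s..t} x + ennreal (root 3 \<epsilon>) * indicator {s..t} x \<partial>lborel)"
    proof (rule nn_integral_mono)
      fix x
      have "min (root 3 (\<alpha>.density_part x + \<epsilon>)) T \<le> root 3 (\<alpha>.density_part x) + root 3 \<epsilon>"
        using root3_add_le[of "\<alpha>.density_part x" \<epsilon>] \<epsilon>(1) by simp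
      then have "ennreal (min (root 3 (\<alpha>.density_part x + \<epsilon>)) T) \<le> ennreal (root 3 (\<alpha>.density_part x) + root 3 \<epsilon>)"
        by (rule ennreal_leI)
      also have "\<dots> = \<kappa> x + ennreal (root 3 \<epsilon>)"
        using \<epsilon>(1) by (intro ennreal_plus) auto
      finally show "ennreal (min (root 3 (\<alpha>.density_part x + \<epsilon>)) T) * indicator {s..<t} x
          \<le> \<kappa> x * indicator {s..t} x + ennreal (root 3 \<epsilon>) * indicator {s..t} x"
        by (simp add: indicator_def)
    qed
    also have "\<dots> = (\<integral>\<^sup>+x\<in>{s..t}. \<kappa> x \<partial>lborel) + ennreal (root 3 \<epsilon>) * ennreal (t - s)"
      using assms(2) by (simp add: nn_integral_add nn_integral_cmult_indicator)
    also have "ennreal (root 3 \<epsilon>) * ennreal (t - s) = ennreal (e / 2)"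
      using \<epsilon>(1) assms(2) by (subst ennreal_mult[symmetric]) (simp_all add: \<epsilon>(2))
    finally have "affine_premeasure \<delta> (z ` {s..t}) \<le> ?C * ((\<integral>\<^sup>+x\<in>{s..t}. \<kappa> x \<partial>lborel) + ennreal (e / 2) + ennreal (e / 2))"
      by (simp add: T(2) mult_left_mono add_right_mono)
    also have "\<dots> = ?C * ((\<integral>\<^sup>+x\<in>{s..t}. \<kappa> x \<partial>lborel) + ennreal e)"
      using e by (simp add: add.assoc ennreal_plus[symmetric] del: ennreal_plus)
    also have "\<dots> = ?C * (\<integral>\<^sup>+x\<in>{s..t}. \<kappa> x \<partial>lborel) + ennreal e0"
      using e by (simp add: distrib_left ennreal_mult[symmetric] e_def)
    finally show "affine_premeasure \<delta> (z ` {s..t}) \<le> ?C * (\<integral>\<^sup>+x\<in>{s..t}. \<kappa> x \<partial>lborel) + ennreal e0" .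
  qed
qed

end

section \<open>Auxiliary inequalities and integrals\<close>

lemma disjoint_enumeration:
  assumes "countable \<A>" "pairwise disjnt \<A>"
  obtains f :: "nat \<Rightarrow> 'a set" where "disjoint_family f" "(\<Union>n. f n) = \<Union>\<A>" "\<And>n. f n = {} \<or> f n \<in> \<A>"
proof
  let ?g = "to_nat_on \<A>"
  define f where "f n = \<Union>{A\<in>\<A>. ?g A = n}" for n
  have inj: "inj_on ?g \<A>" using assms(1) by (rule inj_on_to_nat_on)
  have f_eq: "f (?g A) = A" if "A \<in> \<A>" for A
  proof -
    have "{B\<in>\<A>. ?g B = ?g A} = {A}" using inj that by (auto dest: inj_onD)
    then show ?thesis by (simp add: f_def)
  qed
  show cases: "f n = {} \<or> f n \<in> \<A>" for n
  proof (cases "\<exists>A\<in>\<A>. ?g A = n")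
    case True
    then show ?thesis using f_eq by auto
  next
    case False
    then show ?thesis by (auto simp: f_def)
  qed
  show "(\<Union>n. f n) = \<Union>\<A>" by (auto simp: f_def)
  show "disjoint_family f"
    unfolding disjoint_family_on_def
  proof (intro ballI impI, rule ccontr)
    fix m n assume "m \<noteq> n" "f m \<inter> f n \<noteq> {}"
    then obtain x A B where "A \<in> \<A>" "B \<in> \<A>" "?g A = m" "?g B = n" "x \<in> A" "x \<in> B"
      by (auto simp: f_def)
    moreover have "A \<noteq> B" using calculation \<open>m \<noteq> n\<close> by auto
    ultimately have "disjnt A B" using assms(2) by (auto simp: pairwise_def)
    then show False using \<open>x \<in> A\<close> \<open>x \<in> B\<close> by (auto simp: disjnt_def)
  qed
qed

text \<open>The inequality of the means for \<open>x, y, y\<close>. The factorization shows that the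
  difference of the cubes is nonnegative.\<close>

lemma am_gm_cube:
  fixes x y :: real
  assumes "0 \<le> x" "0 \<le> y"
  shows "root 3 (x * y\<^sup>2) \<le> (x + 2 * y) / 3"
proof -
  have "(x + 2 * y) ^ 3 - 27 * (x * y\<^sup>2) = (x - y)\<^sup>2 * (x + 8 * y)"
    by (simp add: power2_eq_square power3_eq_cube algebra_simps)
  also have "\<dots> \<ge> 0" using assms by simp
  finally have "x * y\<^sup>2 \<le> ((x + 2 * y) / 3) ^ 3" by (simp add: power_divide)
  then have "root 3 (x * y\<^sup>2) \<le> root 3 (((x + 2 * y) / 3) ^ 3)" by simp
  also have "\<dots> = (x + 2 * y) / 3" using assms by (intro real_root_power_cancel) auto
  finally show ?thesis .
qed

text \<open>The derivative of the sine stays above \<open>cos (pi / 3) = 1 / 2\<close> on this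
  range. Within an octant this bounds a turning angle by twice the rate at which the curve departs
  from the axis.\<close>

lemma half_le_sin:
  assumes "0 \<le> x" "x \<le> pi / 4"
  shows "x / 2 \<le> sin x"
proof (cases "x = 0")
  case False
  then have "x > 0" using assms by simp
  obtain y where y: "0 < y" "y < x" "sin x - sin 0 = (x - 0) * cos y"
    using MVT2[OF \<open>x > 0\<close>, of sin cos] by (auto intro: derivative_intros)
  have "1 / 2 \<le> cos y"
    using cos_monotone_0_pi_le[of y "pi / 3"] y assms by (simp add: cos_60)
  then have "x * (1 / 2) \<le> x * cos y" using \<open>x > 0\<close> by (intro mult_left_mono) auto
  then show ?thesis using y by simp
qed simp

text \<open>A quarter turn exchanges the two frame components up to sign, so any of the four axis
  directions of a rectangle may serve as reference.\<close>

lemma axis_product_invariant: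
  "\<bar>dir (a + real_of_int i * (pi / 2)) \<bullet> v\<bar> * \<bar>cross2 (dir (a + real_of_int i * (pi / 2))) v\<bar>
    = \<bar>dir a \<bullet> v\<bar> * \<bar>cross2 (dir a) v\<bar>"
proof -
  define P where "P b = \<bar>dir b \<bullet> v\<bar> * \<bar>cross2 (dir b) v\<bar>" for b
  have step: "P (b + pi / 2) = P b" for b
  proof -
    have "cross2 (dir (b + pi / 2)) v = dir (b + pi / 2 + pi / 2) \<bullet> v"
      by (simp only: dir_quarter)
    also have "b + pi / 2 + pi / 2 = b + pi" by simp
    finally have "cross2 (dir (b + pi / 2)) v = - (dir b \<bullet> v)" by (simp add: dir_pi)
    then show ?thesis by (simp add: P_def dir_quarter mult.commute)
  qed
  have "P (a + real_of_int i * (pi / 2)) = P a"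
  proof (induction i rule: int_induct[where k=0])
    case (step1 i)
    have "a + real_of_int (i + 1) * (pi / 2) = (a + real_of_int i * (pi / 2)) + pi / 2" by (simp add: algebra_simps)
    then show ?case using step1 step by metis
  next
    case (step2 i)
    have "a + real_of_int i * (pi / 2) = (a + real_of_int (i - 1) * (pi / 2)) + pi / 2" by (simp add: left_diff_distrib diff_divide_distrib)
    then show ?case using step2 step by metis
  qed simp
  then show ?thesis by (simp add: P_def)
qed

lemma nn_integral_cells_le:
  fixes f :: "real \<Rightarrow> ennreal"
  assumes [measurable]: "f \<in> borel_measurable borel" and "h > 0"
  shows "(\<integral>\<^sup>+x\<in>{s..s + real n * h}. f x \<partial>lborel) \<le> (\<Sum>i<n. \<integral>\<^sup>+x\<in>{s + real i * h..s + real (Suc i) * h}. f x \<partial>lborel)"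
proof (induction n)
  case 0
  have "(\<integral>\<^sup>+x\<in>{s..s + real 0 * h}. f x \<partial>lborel) = (\<integral>\<^sup>+x. 0 \<partial>(lborel :: real measure))"
    using AE_lborel_singleton[of s] by (intro nn_integral_cong_AE) (auto elim!: eventually_mono simp: indicator_def)
  then show ?case by simp
next
  case (Suc n)
  have "(\<integral>\<^sup>+x\<in>{s..s + real (Suc n) * h}. f x \<partial>lborel)
      \<le> (\<integral>\<^sup>+x. f x * indicator {s..s + real n * h} x + f x * indicator {s + real n * h..s + real (Suc n) * h} x \<partial>lborel)"
    by (intro nn_integral_mono) (auto simp: indicator_def simp del: of_nat_Suc)
  also have "\<dots> = (\<integral>\<^sup>+x\<in>{s..s + real n * h}. f x \<partial>lborel) + (\<integral>\<^sup>+x\<in>{s + real n * h..s + real (Suc n) * h}. f x \<partial>lborel)"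
    by (rule nn_integral_add) auto
  also have "\<dots> \<le> (\<Sum>i<Suc n. \<integral>\<^sup>+x\<in>{s + real i * h..s + real (Suc i) * h}. f x \<partial>lborel)"
    using Suc by (simp add: add_right_mono)
  finally show ?case .
qed

text \<open>Abel summation, the discrete form of integrating \<open>(t - r) d\<alpha>\<close> and
  \<open>(r - s) d\<alpha>\<close> by parts.\<close>

lemma sum_weighted_differences:
  fixes a :: "nat \<Rightarrow> real"
  shows "(\<Sum>i<n. real (n - i) * (a (Suc i) - a i)) = (\<Sum>i<n. a i - a 0) + (a n - a 0)"
    and "(\<Sum>i<n. real (Suc i) * (a (Suc i) - a i)) = (\<Sum>i<n. a n - a (Suc i)) + (a n - a 0)"
proof -
  show "(\<Sum>i<n. real (n - i) * (a (Suc i) - a i)) = (\<Sum>i<n. a i - a 0) + (a n - a 0)"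
  proof (induction n)
    case (Suc n)
    have "(\<Sum>i<Suc n. real (Suc n - i) * (a (Suc i) - a i))
        = (\<Sum>i<n. real (n - i) * (a (Suc i) - a i) + (a (Suc i) - a i)) + (a (Suc n) - a n)"
      by (simp add: Suc_diff_le algebra_simps)
    also have "\<dots> = (\<Sum>i<n. a i - a 0) + (a n - a 0) + (a n - a 0) + (a (Suc n) - a n)"
      by (simp only: sum.distrib Suc.IH sum_lessThan_telescope)
    finally show ?case by simp
  qed simp
  show "(\<Sum>i<n. real (Suc i) * (a (Suc i) - a i)) = (\<Sum>i<n. a n - a (Suc i)) + (a n - a 0)"
  proof (induction n)
    case (Suc n)
    have "(\<Sum>i<Suc n. a (Suc n) - a (Suc i)) = (\<Sum>i<n. (a n - a (Suc i)) + (a (Suc n) - a n))"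
      by simp
    also have "\<dots> = (\<Sum>i<n. a n - a (Suc i)) + real n * (a (Suc n) - a n)"
      by (simp only: sum.distrib sum_constant card_lessThan)
    finally show ?case using Suc by (simp add: algebra_simps)
  qed simp
qed

text \<open>The shift \<open>h\<close> keeps the antiderivative differentiable up to the endpoint
  where the unshifted integrand would be singular.\<close>

lemma nn_integral_inverse_sqrt:
  assumes "s \<le> t" "h > 0"
  shows "(\<integral>\<^sup>+r\<in>{s..t}. ennreal (1 / sqrt (t - r + h)) \<partial>lborel) \<le> ennreal (2 * sqrt (t - s + h))"
    and "(\<integral>\<^sup>+r\<in>{s..t}. ennreal (1 / sqrt (r - s + h)) \<partial>lborel) \<le> ennreal (2 * sqrt (t - s + h))"
proof -
  have "(\<integral>\<^sup>+r\<in>{s..t}. ennreal (1 / sqrt (t - r + h)) \<partial>lborel) = ennreal (- 2 * sqrt (t - t + h) - (- 2 * sqrt (t - s + h)))"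
  proof (rule nn_integral_FTC_Icc)
    fix r assume "r \<in> {s..t}"
    then show "((\<lambda>r. - 2 * sqrt (t - r + h)) has_real_derivative 1 / sqrt (t - r + h)) (at r)"
      using assms by (auto intro!: derivative_eq_intros simp: field_simps)
  qed (use assms in auto)
  also have "\<dots> \<le> ennreal (2 * sqrt (t - s + h))" using assms by (intro ennreal_leI) auto
  finally show "(\<integral>\<^sup>+r\<in>{s..t}. ennreal (1 / sqrt (t - r + h)) \<partial>lborel) \<le> ennreal (2 * sqrt (t - s + h))" .
  have "(\<integral>\<^sup>+r\<in>{s..t}. ennreal (1 / sqrt (r - s + h)) \<partial>lborel) = ennreal (2 * sqrt (t - s + h) - 2 * sqrt (s - s + h))"
  proof (rule nn_integral_FTC_Icc)
    fix r assume "r \<in> {s..t}"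
    then show "((\<lambda>r. 2 * sqrt (r - s + h)) has_real_derivative 1 / sqrt (r - s + h)) (at r)"
      using assms by (auto intro!: derivative_eq_intros simp: field_simps)
  qed (use assms in auto)
  also have "\<dots> \<le> ennreal (2 * sqrt (t - s + h))" using assms by (intro ennreal_leI) auto
  finally show "(\<integral>\<^sup>+r\<in>{s..t}. ennreal (1 / sqrt (r - s + h)) \<partial>lborel) \<le> ennreal (2 * sqrt (t - s + h))" .
qed

text \<open>The estimate needs endpoints in \<open>X\<close>, but the infimum and supremum of
  \<open>X\<close> need not belong to it. The intervals \<open>J n\<close> exhaust the open interval
  between them, and each nonempty \<open>J n\<close> lies between two points of \<open>X\<close>;
  monotone convergence gives the limit.\<close>

lemma nn_integral_le_of_subintervals:
  fixes f :: "real \<Rightarrow> ennreal"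
  assumes [measurable]: "f \<in> borel_measurable borel" and X: "X \<in> sets borel" "X \<subseteq> {a..b}"
    and le: "\<And>s t. s \<in> X \<Longrightarrow> t \<in> X \<Longrightarrow> s < t \<Longrightarrow> (\<integral>\<^sup>+x\<in>{s..t}. f x \<partial>lborel) \<le> B"
  shows "(\<integral>\<^sup>+x\<in>X. f x \<partial>lborel) \<le> B"
proof (cases "X = {}")
  case False
  define l u where "l = Inf X" and "u = Sup X"
  have bdd: "bdd_below X" "bdd_above X" using X by (auto intro: bdd_below_mono bdd_above_mono)
  have lu: "l \<le> x" "x \<le> u" if "x \<in> X" for x
    using that bdd by (auto simp: l_def u_def intro: cInf_lower cSup_upper)
  define J where "J n = {l + 1 / Suc n..u - 1 / Suc n}" for n :: nat
  define N where "N = density lborel f"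
  have [simp]: "sets N = sets borel" by (simp add: N_def)
  have N: "emeasure N A = (\<integral>\<^sup>+x\<in>A. f x \<partial>lborel)" if "A \<in> sets borel" for A
    using that by (simp add: N_def emeasure_density)
  have "(\<integral>\<^sup>+x\<in>X. f x \<partial>lborel) \<le> (\<integral>\<^sup>+x\<in>{l<..<u}. f x \<partial>lborel)"
    using AE_lborel_singleton[of l] AE_lborel_singleton[of u]
    by (intro nn_integral_mono_AE, eventually_elim) (use lu in \<open>force simp: indicator_def\<close>)
  also have "\<dots> = emeasure N (\<Union>n. J n)"
  proof -
    have "(\<Union>n. J n) = {l<..<u}"
    proof (intro equalityI subsetI)
      fix x assume x: "x \<in> {l<..<u}"
      obtain n where n: "inverse (real (Suc n)) < min (x - l) (u - x)"
        using reals_Archimedean[of "min (x - l) (u - x)"] x by auto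
      then have "x \<in> J n" by (auto simp: J_def inverse_eq_divide)
      then show "x \<in> (\<Union>n. J n)" by blast
    next
      fix x assume "x \<in> (\<Union>n. J n)"
      then obtain n where "x \<in> J n" by blast
      moreover have "1 / real (Suc n) > 0" by simp
      ultimately show "x \<in> {l<..<u}"
        unfolding J_def atLeastAtMost_iff greaterThanLessThan_iff by linarith
    qed
    then show ?thesis by (simp add: N)
  qed
  also have "\<dots> = (SUP n. emeasure N (J n))"
  proof (rule SUP_emeasure_incseq[symmetric])
    show "incseq J"
    proof (rule incseq_SucI)
      fix n :: nat
      have "1 / real (Suc (Suc n)) \<le> 1 / real (Suc n)" by (intro divide_left_mono) auto
      then show "J n \<subseteq> J (Suc n)" unfolding J_def by (auto simp del: of_nat_Suc)
    qed
  qed (auto simp: J_def)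
  also have "\<dots> \<le> B"
  proof (rule SUP_least)
    fix n
    show "emeasure N (J n) \<le> B"
    proof (cases "J n = {}")
      case False
      have "1 / real (Suc n) > 0" by simp
      then have lt: "l < l + 1 / Suc n" "u - 1 / Suc n < u" "l + 1 / Suc n \<le> u - 1 / Suc n"
        using False by (auto simp: J_def simp del: of_nat_Suc)
      obtain s where s: "s \<in> X" "s < l + 1 / Suc n"
        using lt(1) \<open>X \<noteq> {}\<close> bdd(1) unfolding l_def by (meson cInf_lessD)
      obtain t where t: "t \<in> X" "u - 1 / Suc n < t"
        using lt(2) \<open>X \<noteq> {}\<close> bdd(2) unfolding u_def by (meson less_cSupD)
      have "emeasure N (J n) \<le> emeasure N {s..t}"
        using s t by (intro emeasure_mono) (auto simp: J_def simp del: of_nat_Suc)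
      also have "\<dots> \<le> B" using le[of s t] s t lt(3) by (simp add: N del: of_nat_Suc)
      finally show ?thesis .
    qed simp
  qed
  finally show ?thesis .
qed simp

section \<open>The upper bound, from arcs to Borel sets\<close>

context tangent_curve
begin

lemma z_measurable [measurable]: "z \<in> borel_measurable borel"
  by (intro borel_measurable_continuous_onI continuous_on_z)

definition arc_measure :: "real measure" where
  "arc_measure = density lborel (\<lambda>t. \<kappa> t * indicator {0..L} t)"

lemma sets_arc_measure [simp, measurable_cong]: "sets arc_measure = sets borel"
  by (simp add: arc_measure_def)

lemma emeasure_arc_measure:
  "X \<in> sets borel \<Longrightarrow> emeasure arc_measure X = (\<integral>\<^sup>+t. \<kappa> t * indicator {0..L} t * indicator X t \<partial>lborel)"
  by (simp add: arc_measure_def emeasure_density)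

lemma emeasure_param_eq_arc_measure:
  assumes [measurable]: "E \<in> sets borel"
  shows "emeasure (param_affine_arclength L z) E = emeasure arc_measure (z -` E)"
  using measurable_sets[OF z_measurable assms]
  by (subst emeasure_param_affine_arclength[OF assms], subst emeasure_arc_measure)
    (auto intro!: nn_integral_cong simp: indicator_def)

lemma finite_arc_measure: "emeasure arc_measure UNIV < \<infinity>"
proof -
  have "emeasure arc_measure UNIV = (\<integral>\<^sup>+t. \<kappa> t * indicator {0..L} t \<partial>lborel)"
    by (simp add: emeasure_arc_measure)
  also have "\<dots> \<le> (\<integral>\<^sup>+t. ennreal 1 * indicator {0..L} t + ennreal (\<alpha>.density_part t) * indicator {0..L} t \<partial>lborel)"
  proof (rule nn_integral_mono)
    fix t
    have "\<kappa> t \<le> ennreal 1 + ennreal (\<alpha>.density_part t)"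
      unfolding ennreal_plus[symmetric, OF zero_le_one \<alpha>.density_part_nonneg]
      by (intro ennreal_leI root3_le_add) simp
    then show "\<kappa> t * indicator {0..L} t \<le> ennreal 1 * indicator {0..L} t + ennreal (\<alpha>.density_part t) * indicator {0..L} t"
      by (auto simp: indicator_def)
  qed
  also have "\<dots> = ennreal L + (\<integral>\<^sup>+t\<in>{0..L}. ennreal (\<alpha>.density_part t) \<partial>lborel)"
    using L_pos by (simp add: nn_integral_add)
  also have "\<dots> \<le> ennreal L + ennreal (\<alpha> L - \<alpha> 0)"
    using L_pos by (intro add_left_mono \<alpha>.nn_integral_density_part_le) simp
  also have "\<dots> < \<infinity>" by simp
  finally show ?thesis .
qed

text \<open>A connected open set meets \<open>[0, L]\<close> in an interval. Closing it adds at most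
  two points, which change the covered arc but not the integral.\<close>

lemma affine_outer_measure_component_le:
  assumes c: "open c" "connected c"
  shows "affine_outer_measure (z ` (c \<inter> {0..L})) \<le> ennreal (root 3 4) * emeasure arc_measure c"
proof (cases "c \<inter> {0..L} = {}")
  case False
  define I where "I = c \<inter> {0..L}"
  define s t where "s = Inf I" and "t = Sup I"
  have ne: "I \<noteq> {}" using False by (simp add: I_def)
  have bdd: "bdd_below I" "bdd_above I" unfolding I_def by auto
  have st: "s \<le> x" "x \<le> t" if "x \<in> I" for x
    using that bdd by (auto simp: s_def t_def intro: cInf_lower cSup_upper)
  have "0 \<le> s" unfolding s_def by (rule cInf_greatest[OF ne]) (simp add: I_def)
  have "t \<le> L" unfolding t_def by (rule cSup_least[OF ne]) (simp add: I_def)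
  have "s < t"
  proof -
    obtain x where x: "x \<in> I" using ne by blast
    then obtain e where e: "e > 0" "ball x e \<subseteq> c"
      using c(1) unfolding I_def open_contains_ball by blast
    \<comment> \<open>A second point of \<open>I\<close>, taken on a side of \<open>x\<close> where
      \<open>[0, L]\<close> leaves room; it shows that the interval has positive length.\<close>
    define y where "y = (if x < L then min L (x + e / 2) else max 0 (x - e / 2))"
    have "y \<in> ball x e" "y \<in> {0..L}" "y \<noteq> x"
      using e x L_pos by (auto simp: y_def I_def dist_real_def)
    then have "y \<in> I" using e by (auto simp: I_def)
    then show ?thesis using st[OF x] st[OF \<open>y \<in> I\<close>] \<open>y \<noteq> x\<close> by linarith
  qed
  have sub: "{s<..<t} \<subseteq> I"
  proof
    fix x assume x: "x \<in> {s<..<t}"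
    obtain y where y: "y \<in> I" "y < x" using x cInf_lessD[OF ne, of x] by (auto simp: s_def)
    obtain y' where y': "y' \<in> I" "x < y'" using x less_cSupD[OF ne, of x] by (auto simp: t_def)
    have "x \<in> c" using connectedD_interval[OF c(2), of y y' x] y y' by (auto simp: I_def)
    then show "x \<in> I" using y y' by (auto simp: I_def)
  qed
  have "affine_outer_measure (z ` I) \<le> affine_outer_measure (z ` {s..t})"
    using st by (intro affine_outer_measure_mono image_mono) auto
  also have "\<dots> \<le> ennreal (root 3 4) * (\<integral>\<^sup>+x\<in>{s..t}. \<kappa> x \<partial>lborel)"
    by (rule affine_outer_measure_arc_le) fact+
  also have "(\<integral>\<^sup>+x\<in>{s..t}. \<kappa> x \<partial>lborel) \<le> (\<integral>\<^sup>+x. \<kappa> x * indicator {0..L} x * indicator c x \<partial>lborel)"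
    using AE_lborel_singleton[of s] AE_lborel_singleton[of t]
  proof (intro nn_integral_mono_AE, eventually_elim)
    case (elim x)
    then show ?case using sub by (force simp: indicator_def I_def)
  qed
  also have "\<dots> = emeasure arc_measure c" using c(1) by (simp add: emeasure_arc_measure)
  finally show ?thesis by (simp add: I_def mult_left_mono)
qed simp

lemma affine_outer_measure_open_le:
  assumes "open U"
  shows "affine_outer_measure (z ` (U \<inter> {0..L})) \<le> ennreal (root 3 4) * emeasure arc_measure U"
proof -
  have "pairwise disjnt (components U)"
    using pairwise_disjoint_components[of U] by (simp add: disjnt_def pairwise_def)
  moreover have "countable (components U)"
    using calculation open_components[OF assms] by (intro countable_disjoint_open_subsets) auto
  ultimately obtain f where f: "disjoint_family f" "(\<Union>n. f n) = U" "\<And>n::nat. f n = {} \<or> f n \<in> components U"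
    using disjoint_enumeration[of "components U"] Union_components by metis
  have f_props: "open (f n)" "connected (f n)" for n
    using f(3)[of n] assms by (auto intro: open_components in_components_connected)
  have "affine_outer_measure (z ` (U \<inter> {0..L})) = affine_outer_measure (\<Union>n. z ` (f n \<inter> {0..L}))"
    unfolding f(2)[symmetric] by (intro arg_cong[where f=affine_outer_measure]) auto
  also have "\<dots> \<le> (\<Sum>n. affine_outer_measure (z ` (f n \<inter> {0..L})))"
    by (rule affine_outer_measure_countably_subadditive)
  also have "\<dots> \<le> (\<Sum>n. ennreal (root 3 4) * emeasure arc_measure (f n))"
    by (intro suminf_le affine_outer_measure_component_le f_props) auto
  also have "\<dots> = ennreal (root 3 4) * (\<Sum>n. emeasure arc_measure (f n))"
    by (rule ennreal_suminf_cmult)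
  also have "(\<Sum>n. emeasure arc_measure (f n)) = emeasure arc_measure (\<Union>n. f n)"
    by (rule suminf_emeasure) (use f f_props in auto)
  finally show ?thesis using f(2) by simp
qed

lemma affine_outer_measure_le:
  assumes E: "E \<in> sets borel" "E \<subseteq> frontier K"
  shows "affine_outer_measure E \<le> ennreal (root 3 4) * emeasure (param_affine_arclength L z) E"
proof (rule ennreal_le_epsilon)
  fix e :: real assume "e > 0"
  let ?C = "ennreal (root 3 4)"
  let ?N = arc_measure
  have zE: "z -` E \<in> sets borel" using measurable_sets[OF z_measurable E(1)] by simp
  have fin: "emeasure ?N (z -` E) < \<infinity>"
    using emeasure_mono[of "z -` E" UNIV ?N] finite_arc_measure by (auto intro: le_less_trans)
  have "emeasure ?N (z -` E) = (INF U \<in> {U. z -` E \<subseteq> U \<and> open U}. emeasure ?N U)"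
    using finite_arc_measure zE by (intro outer_regular) (auto simp: arc_measure_def)
  moreover have "emeasure ?N (z -` E) < emeasure ?N (z -` E) + ennreal (e / root 3 4)"
    using fin \<open>e > 0\<close>
    by (cases "emeasure ?N (z -` E)") (auto simp: ennreal_plus[symmetric] ennreal_less_iff simp del: ennreal_plus)
  ultimately obtain U where U: "z -` E \<subseteq> U" "open U" "emeasure ?N U < emeasure ?N (z -` E) + ennreal (e / root 3 4)"
    by (metis (no_types, lifting) INF_less_iff mem_Collect_eq)
  have "E \<subseteq> z ` (U \<inter> {0..L})"
  proof
    fix x assume "x \<in> E"
    then have "x \<in> z ` {0..<L}" using E z_bij by (auto simp: bij_betw_def)
    then obtain t where "t \<in> {0..<L}" "x = z t" by blast
    then show "x \<in> z ` (U \<inter> {0..L})" using U \<open>x \<in> E\<close> by auto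
  qed
  then have "affine_outer_measure E \<le> affine_outer_measure (z ` (U \<inter> {0..L}))"
    by (rule affine_outer_measure_mono)
  also have "\<dots> \<le> ?C * emeasure ?N U" by (rule affine_outer_measure_open_le) fact
  also have "\<dots> \<le> ?C * (emeasure ?N (z -` E) + ennreal (e / root 3 4))"
    using U(3) by (intro mult_left_mono) auto
  also have "\<dots> = ?C * emeasure (param_affine_arclength L z) E + ennreal e"
    using \<open>e > 0\<close> by (simp add: distrib_left emeasure_param_eq_arc_measure[OF E(1)] ennreal_mult[symmetric])
  finally show "affine_outer_measure E \<le> ?C * emeasure (param_affine_arclength L z) E + ennreal e" .
qed

end

section \<open>Affine arclength inside a rectangle\<close>

text \<open>Subadditivity over a countable set of rectangles, with the sum in the shape to which an
  infinite sum of costs is converted.\<close>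

lemma emeasure_UN_le_nn_integral:
  assumes "countable I" and X: "\<And>i. i \<in> I \<Longrightarrow> X i \<in> sets M"
  shows "emeasure M (\<Union>i\<in>I. X i) \<le> (\<integral>\<^sup>+i. emeasure M (X i) \<partial>count_space I)"
proof -
  have "(\<Union>i\<in>I. X i) \<in> sets M" by (rule sets.countable_UN') (use assms in auto)
  then have "emeasure M (\<Union>i\<in>I. X i) = (\<integral>\<^sup>+x. indicator (\<Union>i\<in>I. X i) x \<partial>M)" by simp
  also have "\<dots> \<le> (\<integral>\<^sup>+x. \<integral>\<^sup>+i. indicator (X i) x \<partial>count_space I \<partial>M)"
  proof (rule nn_integral_mono)
    fix x
    show "indicator (\<Union>i\<in>I. X i) x \<le> (\<integral>\<^sup>+i. indicator (X i) x \<partial>count_space I :: ennreal)"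
    proof (cases "\<exists>i\<in>I. x \<in> X i")
      case True
      then obtain i where i: "i \<in> I" "x \<in> X i" by blast
      have "indicator (X i) x \<le> (\<integral>\<^sup>+i. indicator (X i) x \<partial>count_space I :: ennreal)"
        by (rule nn_integral_ge_point) fact
      then show ?thesis using i by (auto simp: indicator_def)
    qed (auto simp: indicator_def)
  qed
  also have "\<dots> = (\<integral>\<^sup>+i. \<integral>\<^sup>+x. indicator (X i) x \<partial>M \<partial>count_space I)"
    by (rule nn_integral_count_space_nn_integral) (use assms in auto)
  also have "\<dots> = (\<integral>\<^sup>+i. emeasure M (X i) \<partial>count_space I)"
    by (rule nn_integral_cong) (use X in auto)
  finally show ?thesis .
qed

section \<open>Arcs whose tangent stays in an octant\<close>

context tangent_curve
begin

text \<open>On each cell the weight is at most \<open>W i + h\<close> and the integral of the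
  density at most the increment of \<alpha>. The result is a Stieltjes sum, to which Abel summation
  applies.\<close>

lemma nn_integral_weighted_density:
  fixes s h :: real and a :: "nat \<Rightarrow> real"
  defines "a \<equiv> \<lambda>i. \<alpha> (s + real i * h)"
  assumes "h > 0" and [measurable]: "\<omega> \<in> borel_measurable borel" and W0: "\<And>i. 0 \<le> W i"
    and W: "\<And>i r. i < n \<Longrightarrow> r \<in> {s + real i * h..s + real (Suc i) * h} \<Longrightarrow> \<omega> r \<le> W i"
  shows "(\<integral>\<^sup>+r\<in>{s..s + real n * h}. ennreal ((\<omega> r + h) * \<alpha>.density_part r) \<partial>lborel)
    \<le> ennreal (\<Sum>i<n. (W i + h) * (a (Suc i) - a i))"
proof -
  have a_mono: "a i \<le> a (Suc i)" for i
    unfolding a_def using \<open>h > 0\<close> by (intro \<alpha>_mono) (simp add: algebra_simps)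
  have "(\<integral>\<^sup>+r\<in>{s..s + real n * h}. ennreal ((\<omega> r + h) * \<alpha>.density_part r) \<partial>lborel)
      \<le> (\<Sum>i<n. \<integral>\<^sup>+r\<in>{s + real i * h..s + real (Suc i) * h}. ennreal ((\<omega> r + h) * \<alpha>.density_part r) \<partial>lborel)"
    by (rule nn_integral_cells_le[OF _ \<open>h > 0\<close>]) measurable
  also have "\<dots> \<le> (\<Sum>i<n. ennreal ((W i + h) * (a (Suc i) - a i)))"
  proof (rule sum_mono)
    fix i assume i: "i \<in> {..<n}"
    let ?I = "{s + real i * h..s + real (Suc i) * h}"
    have "(\<integral>\<^sup>+r\<in>?I. ennreal ((\<omega> r + h) * \<alpha>.density_part r) \<partial>lborel)
        \<le> (\<integral>\<^sup>+r. ennreal (W i + h) * (ennreal (\<alpha>.density_part r) * indicator ?I r) \<partial>lborel)"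
    proof (rule nn_integral_mono)
      fix r
      have "(\<omega> r + h) * \<alpha>.density_part r \<le> (W i + h) * \<alpha>.density_part r" if "r \<in> ?I"
        using W[OF _ that] i by (intro mult_right_mono) auto
      then show "ennreal ((\<omega> r + h) * \<alpha>.density_part r) * indicator ?I r
          \<le> ennreal (W i + h) * (ennreal (\<alpha>.density_part r) * indicator ?I r)"
        using \<open>h > 0\<close> W0[of i]
        by (auto simp: indicator_def ennreal_mult[symmetric] intro!: ennreal_leI simp del: of_nat_Suc ennreal_plus)
    qed
    also have "\<dots> = ennreal (W i + h) * (\<integral>\<^sup>+r\<in>?I. ennreal (\<alpha>.density_part r) \<partial>lborel)"
      by (rule nn_integral_cmult) measurable
    also have "\<dots> \<le> ennreal (W i + h) * ennreal (a (Suc i) - a i)"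
      unfolding a_def using \<open>h > 0\<close>
      by (intro mult_left_mono \<alpha>.nn_integral_density_part_le) (auto simp: algebra_simps)
    also have "\<dots> = ennreal ((W i + h) * (a (Suc i) - a i))"
      using \<open>h > 0\<close> W0[of i] a_mono[of i] by (intro ennreal_mult[symmetric]) auto
    finally show "(\<integral>\<^sup>+r\<in>?I. ennreal ((\<omega> r + h) * \<alpha>.density_part r) \<partial>lborel)
        \<le> ennreal ((W i + h) * (a (Suc i) - a i))" .
  qed
  also have "\<dots> = ennreal (\<Sum>i<n. (W i + h) * (a (Suc i) - a i))"
    using \<open>h > 0\<close> W0 a_mono by (intro sum_ennreal mult_nonneg_nonneg add_nonneg_nonneg) auto
  finally show ?thesis .
qed

text \<open>Integration by parts turns the weight \<open>t - r\<close> into the sum of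
  \<open>\<alpha> r - \<alpha> s\<close>, which the hypothesis bounds by \<open>2 * Y\<close>. The
  boundary term and the extra \<open>h\<close> each contribute
  \<open>h * (\<alpha> t - \<alpha> s)\<close>, together at most \<open>h * pi / 2\<close>.\<close>

lemma nn_integral_weighted_density_decreasing:
  assumes "s < t" and h: "h = (t - s) / Suc n" and range: "\<alpha> t - \<alpha> s \<le> pi / 4"
    and Y: "(\<Sum>i<Suc n. \<alpha> (s + real i * h) - \<alpha> s) * h \<le> 2 * Y"
  shows "(\<integral>\<^sup>+r\<in>{s..t}. ennreal ((t - r + h) * \<alpha>.density_part r) \<partial>lborel) \<le> ennreal (2 * Y + h * pi / 2)"
proof -
  let ?m = "Suc n"
  have hpos: "h > 0" and hn: "s + real ?m * h = t" using assms by auto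
  define a where "a i = \<alpha> (s + real i * h)" for i
  have a0: "a 0 = \<alpha> s" and am: "a ?m = \<alpha> t" using hn by (simp_all add: a_def del: of_nat_Suc)
  have "(\<integral>\<^sup>+r\<in>{s..s + real ?m * h}. ennreal ((t - r + h) * \<alpha>.density_part r) \<partial>lborel)
      \<le> ennreal (\<Sum>i<?m. (real (Suc n - i) * h + h) * (a (Suc i) - a i))"
    unfolding a_def
  proof (rule nn_integral_weighted_density[OF hpos])
    fix i r assume "i < ?m" "r \<in> {s + real i * h..s + real (Suc i) * h}"
    then show "t - r \<le> real (Suc n - i) * h" using hn by (auto simp: of_nat_diff algebra_simps)
  qed (use hpos in auto)
  also have "(\<Sum>i<?m. (real (Suc n - i) * h + h) * (a (Suc i) - a i))
      = h * (\<Sum>i<?m. real (Suc n - i) * (a (Suc i) - a i)) + h * (\<Sum>i<?m. a (Suc i) - a i)"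
    unfolding sum_distrib_left sum.distrib[symmetric] by (intro sum.cong) (auto simp: algebra_simps simp del: of_nat_Suc)
  also have "\<dots> = h * (\<Sum>i<?m. a i - a 0) + 2 * h * (a ?m - a 0)"
    unfolding sum_weighted_differences(1) sum_lessThan_telescope by (simp add: algebra_simps)
  also have "\<dots> \<le> 2 * Y + h * pi / 2"
  proof -
    have "2 * h * (a ?m - a 0) \<le> 2 * h * (pi / 4)" unfolding a0 am using range hpos by (intro mult_left_mono) auto
    also have "\<dots> = h * pi / 2" by simp
    finally have "2 * h * (a ?m - a 0) \<le> h * pi / 2" .
    moreover have "h * (\<Sum>i<?m. a i - a 0) \<le> 2 * Y" unfolding a0 using Y by (simp add: a_def mult.commute del: of_nat_Suc)
    ultimately show ?thesis by (rule add_mono[rotated])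
  qed
  finally show ?thesis unfolding hn by (simp add: ennreal_leI)
qed

lemma nn_integral_weighted_density_increasing:
  assumes "s < t" and h: "h = (t - s) / Suc n" and range: "\<alpha> t - \<alpha> s \<le> pi / 4"
    and Y: "(\<Sum>i<Suc n. \<alpha> t - \<alpha> (s + real (Suc i) * h)) * h \<le> 2 * Y"
  shows "(\<integral>\<^sup>+r\<in>{s..t}. ennreal ((r - s + h) * \<alpha>.density_part r) \<partial>lborel) \<le> ennreal (2 * Y + h * pi / 2)"
proof -
  let ?m = "Suc n"
  have hpos: "h > 0" and hn: "s + real ?m * h = t" using assms by auto
  define a where "a i = \<alpha> (s + real i * h)" for i
  have a0: "a 0 = \<alpha> s" and am: "a ?m = \<alpha> t" using hn by (simp_all add: a_def del: of_nat_Suc)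
  have "(\<integral>\<^sup>+r\<in>{s..s + real ?m * h}. ennreal ((r - s + h) * \<alpha>.density_part r) \<partial>lborel)
      \<le> ennreal (\<Sum>i<?m. (real (Suc i) * h + h) * (a (Suc i) - a i))"
    unfolding a_def
  proof (rule nn_integral_weighted_density[OF hpos])
    fix i r assume "i < ?m" "r \<in> {s + real i * h..s + real (Suc i) * h}"
    then show "r - s \<le> real (Suc i) * h" using hn by (auto simp del: of_nat_Suc)
  qed (use hpos in auto)
  also have "(\<Sum>i<?m. (real (Suc i) * h + h) * (a (Suc i) - a i))
      = h * (\<Sum>i<?m. real (Suc i) * (a (Suc i) - a i)) + h * (\<Sum>i<?m. a (Suc i) - a i)"
    unfolding sum_distrib_left sum.distrib[symmetric] by (intro sum.cong) (auto simp: algebra_simps simp del: of_nat_Suc)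
  also have "\<dots> = h * (\<Sum>i<?m. a ?m - a (Suc i)) + 2 * h * (a ?m - a 0)"
    unfolding sum_weighted_differences(2) sum_lessThan_telescope by (simp add: algebra_simps)
  also have "\<dots> \<le> 2 * Y + h * pi / 2"
  proof -
    have "2 * h * (a ?m - a 0) \<le> 2 * h * (pi / 4)" unfolding a0 am using range hpos by (intro mult_left_mono) auto
    also have "\<dots> = h * pi / 2" by simp
    finally have "2 * h * (a ?m - a 0) \<le> h * pi / 2" .
    moreover have "h * (\<Sum>i<?m. a ?m - a (Suc i)) \<le> 2 * Y" unfolding am using Y by (simp add: a_def mult.commute del: of_nat_Suc)
    ultimately show ?thesis by (rule add_mono[rotated])
  qed
  finally show ?thesis unfolding hn by (simp add: ennreal_leI)
qed

text \<open>With \<open>w = \<omega> r + h\<close>, the numbers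
  \<open>x = w * \<alpha>' / \<tau>\<^sup>2\<close> and \<open>y = \<tau> / sqrt w\<close> satisfy
  \<open>x * y\<^sup>2 = \<alpha>'\<close>, so the inequality of the means splits \<kappa> into two
  integrable parts. The free parameter \<tau> balances them, and \<open>h\<close> tends to 0 at the
  end.\<close>

lemma nn_integral_\<kappa>_le_weighted:
  assumes "s < t" and [measurable]: "\<omega> \<in> borel_measurable borel"
    and \<omega>0: "\<And>r. r \<in> {s..t} \<Longrightarrow> 0 \<le> \<omega> r" and "\<tau> > 0" "Y \<ge> 0"
    and root: "\<And>h. h > 0 \<Longrightarrow> (\<integral>\<^sup>+r\<in>{s..t}. ennreal (1 / sqrt (\<omega> r + h)) \<partial>lborel) \<le> ennreal (2 * sqrt (t - s + h))"
    and weighted: "\<And>n h. h = (t - s) / Suc n \<Longrightarrow>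
      (\<integral>\<^sup>+r\<in>{s..t}. ennreal ((\<omega> r + h) * \<alpha>.density_part r) \<partial>lborel) \<le> ennreal (2 * Y + h * pi / 2)"
  shows "(\<integral>\<^sup>+r\<in>{s..t}. \<kappa> r \<partial>lborel) \<le> ennreal (2 / 3 * Y / \<tau>\<^sup>2 + 4 / 3 * \<tau> * sqrt (t - s))"
proof -
  define h where "h n = (t - s) / Suc n" for n
  have hpos: "h n > 0" for n using assms(1) by (simp add: h_def)
  have hlim: "h \<longlonglongrightarrow> 0"
    unfolding h_def using tendsto_mult[OF tendsto_const[of "t - s"] LIMSEQ_inverse_real_of_nat]
    by (simp add: divide_inverse)
  define B where "B n = 1 / (3 * \<tau>\<^sup>2) * (2 * Y + h n * pi / 2) + 2 * \<tau> / 3 * (2 * sqrt (t - s + h n))" for n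
  have step: "(\<integral>\<^sup>+r\<in>{s..t}. \<kappa> r \<partial>lborel) \<le> ennreal (B n)" for n
  proof -
    let ?a = "\<alpha>.density_part" and ?h = "h n"
    have "(\<integral>\<^sup>+r\<in>{s..t}. \<kappa> r \<partial>lborel)
        \<le> (\<integral>\<^sup>+r. ennreal (1 / (3 * \<tau>\<^sup>2)) * (ennreal ((\<omega> r + ?h) * ?a r) * indicator {s..t} r)
            + ennreal (2 * \<tau> / 3) * (ennreal (1 / sqrt (\<omega> r + ?h)) * indicator {s..t} r) \<partial>lborel)"
    proof (rule nn_integral_mono)
      fix r
      show "\<kappa> r * indicator {s..t} r \<le> ennreal (1 / (3 * \<tau>\<^sup>2)) * (ennreal ((\<omega> r + ?h) * ?a r) * indicator {s..t} r)
            + ennreal (2 * \<tau> / 3) * (ennreal (1 / sqrt (\<omega> r + ?h)) * indicator {s..t} r)"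
      proof (cases "r \<in> {s..t}")
        case True
        let ?w = "\<omega> r + ?h"
        have w: "?w > 0" using \<omega>0[OF True] hpos[of n] by linarith
        let ?x = "?w * ?a r / \<tau>\<^sup>2" and ?y = "\<tau> / sqrt ?w"
        have xy: "?x * ?y\<^sup>2 = ?a r" using w \<open>\<tau> > 0\<close> by (simp add: power_divide)
        have "root 3 (?x * ?y\<^sup>2) \<le> (?x + 2 * ?y) / 3"
          using w \<open>\<tau> > 0\<close> by (intro am_gm_cube) auto
        then have "root 3 (?a r) \<le> 1 / (3 * \<tau>\<^sup>2) * (?w * ?a r) + 2 * \<tau> / 3 * (1 / sqrt ?w)"
          unfolding xy by (simp add: add_divide_distrib)
        then have "\<kappa> r \<le> ennreal (1 / (3 * \<tau>\<^sup>2) * (?w * ?a r) + 2 * \<tau> / 3 * (1 / sqrt ?w))"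
          by (rule ennreal_leI)
        also have "\<dots> = ennreal (1 / (3 * \<tau>\<^sup>2) * (?w * ?a r)) + ennreal (2 * \<tau> / 3 * (1 / sqrt ?w))"
          using w \<open>\<tau> > 0\<close> by (intro ennreal_plus) auto
        also have "\<dots> = ennreal (1 / (3 * \<tau>\<^sup>2)) * ennreal (?w * ?a r) + ennreal (2 * \<tau> / 3) * ennreal (1 / sqrt ?w)"
          using w \<open>\<tau> > 0\<close> by (intro arg_cong2[where f="(+)"] ennreal_mult) auto
        finally show ?thesis using True by simp
      qed simp
    qed
    also have "\<dots> = ennreal (1 / (3 * \<tau>\<^sup>2)) * (\<integral>\<^sup>+r\<in>{s..t}. ennreal ((\<omega> r + ?h) * ?a r) \<partial>lborel)
        + ennreal (2 * \<tau> / 3) * (\<integral>\<^sup>+r\<in>{s..t}. ennreal (1 / sqrt (\<omega> r + ?h)) \<partial>lborel)"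
      by (simp add: nn_integral_add nn_integral_cmult)
    also have "\<dots> \<le> ennreal (1 / (3 * \<tau>\<^sup>2)) * ennreal (2 * Y + ?h * pi / 2) + ennreal (2 * \<tau> / 3) * ennreal (2 * sqrt (t - s + ?h))"
      by (intro add_mono mult_left_mono root weighted[of _ n] hpos) (auto simp: h_def)
    also have "\<dots> = ennreal (1 / (3 * \<tau>\<^sup>2) * (2 * Y + ?h * pi / 2)) + ennreal (2 * \<tau> / 3 * (2 * sqrt (t - s + ?h)))"
      using hpos[of n] assms(1) \<open>\<tau> > 0\<close> \<open>Y \<ge> 0\<close> by (intro arg_cong2[where f="(+)"] ennreal_mult[symmetric]) auto
    also have "\<dots> = ennreal (B n)"
      unfolding B_def using hpos[of n] assms(1) \<open>\<tau> > 0\<close> \<open>Y \<ge> 0\<close> by (intro ennreal_plus[symmetric]) auto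
    finally show ?thesis .
  qed
  have "B \<longlonglongrightarrow> 1 / (3 * \<tau>\<^sup>2) * (2 * Y + 0 * pi / 2) + 2 * \<tau> / 3 * (2 * sqrt (t - s + 0))"
    unfolding B_def by (intro tendsto_intros hlim) auto
  then have "(\<lambda>n. ennreal (B n)) \<longlonglongrightarrow> ennreal (2 / 3 * Y / \<tau>\<^sup>2 + 4 / 3 * \<tau> * sqrt (t - s))"
    by (intro tendsto_ennrealI) (simp add: algebra_simps)
  then show ?thesis
    by (rule LIMSEQ_le_const) (use step in blast)
qed

text \<open>Here \<open>ax\<close> is the direction of the frame axis that bounds the octant \<open>[low, low + \<pi>/4]\<close>, and
  \<open>m\<close> is the area of the box spanned by the chord in that frame.\<close>

lemma nn_integral_\<kappa>_octant:
  assumes st: "0 \<le> s" "s < t" "t \<le> L" and range: "low \<le> \<alpha> s" "\<alpha> t \<le> low + pi / 4"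
    and ax: "ax = low \<or> ax = low + pi / 4" and "m > 0"
    and m: "\<bar>dir ax \<bullet> (z t - z s)\<bar> * \<bar>cross2 (dir ax) (z t - z s)\<bar> \<le> m"
  shows "(\<integral>\<^sup>+r\<in>{s..t}. \<kappa> r \<partial>lborel) \<le> ennreal (3 * root 3 m)"
proof -
  let ?v = "z t - z s"
  define Y where "Y = \<bar>cross2 (dir ax) ?v\<bar>"
  \<comment> \<open>All tangents make an angle of at most \<open>pi / 4\<close>, hence less than
    \<open>pi / 3\<close>, with the axis; this is where the component along the axis controls the
    length.\<close>
  have "1 / 2 * (t - s) \<le> dir ax \<bullet> ?v"
  proof (rule dir_inner_chord_ge)
    fix \<phi> assume "\<alpha> s \<le> \<phi>" "\<phi> \<le> \<alpha> t"
    then have "\<bar>\<phi> - ax\<bar> \<le> pi / 3" using range ax by auto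
    then have "cos (pi / 3) \<le> cos \<bar>\<phi> - ax\<bar>" by (intro cos_monotone_0_pi_le) auto
    then show "1 / 2 \<le> cos (\<phi> - ax)" by (simp add: cos_60)
  qed (use st in auto)
  then have X: "t - s \<le> 2 * \<bar>dir ax \<bullet> ?v\<bar>"
    using abs_ge_self[of "dir ax \<bullet> ?v"] by simp
  have Yl: "Y * (t - s) \<le> 2 * m"
  proof -
    have "Y * (t - s) \<le> Y * (2 * \<bar>dir ax \<bullet> ?v\<bar>)" using X by (intro mult_left_mono) (auto simp: Y_def)
    then show ?thesis using m by (simp add: Y_def mult_ac)
  qed
  \<comment> \<open>This choice makes \<open>\<tau> * sqrt (t - s)\<close> equal to
    \<open>root 3 m\<close>, while \<open>Y * (t - s) \<le> 2 * m\<close> bounds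
    \<open>Y / \<tau>\<^sup>2\<close> by \<open>2 * root 3 m\<close>.\<close>
  define \<tau> where "\<tau> = root 3 m / sqrt (t - s)"
  have \<tau>: "\<tau> > 0" using st \<open>m > 0\<close> by (simp add: \<tau>_def)
  have rng: "\<alpha> t - \<alpha> s \<le> pi / 4" using range by linarith
  define c where "c n i = s + real i * ((t - s) / Suc n)" for n i
  have c: "c n 0 = s" "c n (Suc n) = t" "c n (Suc i) - c n i = (t - s) / Suc n" "c n i \<le> c n (Suc i)" for n i
  proof -
    define g where "g = (t - s) / real (Suc n)"
    have g: "real (Suc n) * g = t - s" "0 \<le> g" using st by (simp_all add: g_def del: of_nat_Suc)
    then show "c n 0 = s" "c n (Suc n) = t" "c n (Suc i) - c n i = (t - s) / Suc n" "c n i \<le> c n (Suc i)"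
      unfolding c_def g_def[symmetric] by (simp_all add: algebra_simps)
  qed
  have c_st: "s \<le> c n i" "c n i \<le> t" if "i \<le> Suc n" for n i
  proof -
    have "real i / real (Suc n) \<le> 1" using that by simp
    then have "real i / real (Suc n) * (t - s) \<le> 1 * (t - s)" using st by (intro mult_right_mono) auto
    then show "s \<le> c n i" "c n i \<le> t" using st by (simp_all add: c_def del: of_nat_Suc)
  qed
  have main: "(\<integral>\<^sup>+r\<in>{s..t}. \<kappa> r \<partial>lborel) \<le> ennreal (2 / 3 * Y / \<tau>\<^sup>2 + 4 / 3 * \<tau> * sqrt (t - s))"
    using ax
  proof
    \<comment> \<open>All tangents lie counterclockwise of the axis, so the curve rises over it at
      rate \<open>sin (\<phi> - low)\<close>, which is at least half of the turning since
      \<open>s\<close>. The total rise is the height \<open>Y\<close>.\<close>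
    assume ax: "ax = low"
    show ?thesis
    proof (rule nn_integral_\<kappa>_le_weighted[where \<omega>="\<lambda>r. t - r"])
      fix n :: nat and h :: real assume h: "h = (t - s) / Suc n"
      have "(\<Sum>i<Suc n. \<alpha> (c n i) - \<alpha> s) * h = (\<Sum>i<Suc n. 2 * ((\<alpha> (c n i) - \<alpha> s) / 2 * h))"
        unfolding sum_distrib_right by (intro sum.cong) auto
      also have "\<dots> \<le> (\<Sum>i<Suc n. 2 * (dir (low + pi / 2) \<bullet> z (c n (Suc i)) - dir (low + pi / 2) \<bullet> z (c n i)))"
      proof (intro sum_mono mult_left_mono)
        fix i assume i: "i \<in> {..<Suc n}"
        have "(\<alpha> (c n i) - \<alpha> s) / 2 * (c n (Suc i) - c n i) \<le> dir (low + pi / 2) \<bullet> (z (c n (Suc i)) - z (c n i))"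
        proof (rule dir_inner_chord_ge)
          fix \<phi> assume \<phi>: "\<alpha> (c n i) \<le> \<phi>" "\<phi> \<le> \<alpha> (c n (Suc i))"
          have "\<alpha> s \<le> \<alpha> (c n i)" "\<alpha> (c n (Suc i)) \<le> \<alpha> t" using c_st i by (auto intro!: \<alpha>_mono)
          then have "(\<phi> - low) / 2 \<le> sin (\<phi> - low)" using \<phi> range by (intro half_le_sin) auto
          also have "sin (\<phi> - low) = cos (\<phi> - (low + pi / 2))"
            by (simp add: sin_cos_eq cos_minus[of "\<phi> - (low + pi / 2)", symmetric] algebra_simps)
          finally show "(\<alpha> (c n i) - \<alpha> s) / 2 \<le> cos (\<phi> - (low + pi / 2))" using \<phi> range by simp
        qed (use st c_st[of i n] c_st[of "Suc i" n] c(4) i in auto)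
        then show "(\<alpha> (c n i) - \<alpha> s) / 2 * h \<le> dir (low + pi / 2) \<bullet> z (c n (Suc i)) - dir (low + pi / 2) \<bullet> z (c n i)"
          by (simp add: c h inner_diff_right)
      qed simp
      also have "\<dots> = 2 * (dir (low + pi / 2) \<bullet> z (c n (Suc n)) - dir (low + pi / 2) \<bullet> z (c n 0))"
        using sum_lessThan_telescope[of "\<lambda>i. dir (low + pi / 2) \<bullet> z (c n i)" "Suc n"]
        by (simp only: sum_distrib_left[symmetric])
      also have "\<dots> = 2 * cross2 (dir ax) ?v"
        by (simp add: c ax dir_quarter cross2_simps)
      also have "\<dots> \<le> 2 * Y" by (simp add: Y_def)
      finally show "(\<integral>\<^sup>+r\<in>{s..t}. ennreal ((t - r + h) * \<alpha>.density_part r) \<partial>lborel) \<le> ennreal (2 * Y + h * pi / 2)"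
        using rng by (intro nn_integral_weighted_density_decreasing[OF st(2) h]) (auto simp: c_def h simp del: of_nat_Suc sum.lessThan_Suc)
    qed (use st \<tau> nn_integral_inverse_sqrt(1)[of s t] in \<open>auto simp: Y_def\<close>)
  next
    \<comment> \<open>The mirror case: all tangents lie clockwise of the axis, the curve descends at
      a rate of at least half of the turning still to come, and the weight grows from
      \<open>s\<close>. The direction \<open>?b\<close> is the downward normal.\<close>
    assume ax: "ax = low + pi / 4"
    show ?thesis
    proof (rule nn_integral_\<kappa>_le_weighted[where \<omega>="\<lambda>r. r - s"])
      fix n :: nat and h :: real assume h: "h = (t - s) / Suc n"
      let ?b = "ax + pi / 2 + pi"
      have "(\<Sum>i<Suc n. \<alpha> t - \<alpha> (c n (Suc i))) * h = (\<Sum>i<Suc n. 2 * ((\<alpha> t - \<alpha> (c n (Suc i))) / 2 * h))"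
        unfolding sum_distrib_right by (intro sum.cong) auto
      also have "\<dots> \<le> (\<Sum>i<Suc n. 2 * (dir ?b \<bullet> z (c n (Suc i)) - dir ?b \<bullet> z (c n i)))"
      proof (intro sum_mono mult_left_mono)
        fix i assume i: "i \<in> {..<Suc n}"
        have "(\<alpha> t - \<alpha> (c n (Suc i))) / 2 * (c n (Suc i) - c n i) \<le> dir ?b \<bullet> (z (c n (Suc i)) - z (c n i))"
        proof (rule dir_inner_chord_ge)
          fix \<phi> assume \<phi>: "\<alpha> (c n i) \<le> \<phi>" "\<phi> \<le> \<alpha> (c n (Suc i))"
          have "\<alpha> s \<le> \<alpha> (c n i)" "\<alpha> (c n (Suc i)) \<le> \<alpha> t" using c_st i by (auto intro!: \<alpha>_mono)
          then have "(ax - \<phi>) / 2 \<le> sin (ax - \<phi>)" using \<phi> range ax by (intro half_le_sin) auto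
          also have "sin (ax - \<phi>) = cos (\<phi> - ?b)"
          proof -
            have "\<phi> - ?b = - (ax - \<phi> + pi / 2 + pi)" by simp
            then have "cos (\<phi> - ?b) = cos (ax - \<phi> + pi / 2 + pi)" by (metis cos_minus)
            also have "\<dots> = sin (ax - \<phi>)" by (simp only: cos_periodic_pi cos_add cos_pi_half sin_pi_half) simp
            finally show ?thesis ..
          qed
          finally show "(\<alpha> t - \<alpha> (c n (Suc i))) / 2 \<le> cos (\<phi> - ?b)" using \<phi> range ax by simp
        qed (use st c_st[of i n] c_st[of "Suc i" n] c(4) i in auto)
        then show "(\<alpha> t - \<alpha> (c n (Suc i))) / 2 * h \<le> dir ?b \<bullet> z (c n (Suc i)) - dir ?b \<bullet> z (c n i)"
          by (simp add: c h inner_diff_right)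
      qed simp
      also have "\<dots> = 2 * (dir ?b \<bullet> z (c n (Suc n)) - dir ?b \<bullet> z (c n 0))"
        using sum_lessThan_telescope[of "\<lambda>i. dir ?b \<bullet> z (c n i)" "Suc n"]
        by (simp only: sum_distrib_left[symmetric])
      also have "\<dots> = 2 * (- cross2 (dir ax) ?v)"
        unfolding c dir_pi inner_minus_left dir_quarter cross2_simps by simp
      also have "\<dots> \<le> 2 * Y" by (simp add: Y_def)
      finally show "(\<integral>\<^sup>+r\<in>{s..t}. ennreal ((r - s + h) * \<alpha>.density_part r) \<partial>lborel) \<le> ennreal (2 * Y + h * pi / 2)"
        using rng by (intro nn_integral_weighted_density_increasing[OF st(2) h]) (auto simp: c_def h simp del: of_nat_Suc sum.lessThan_Suc)
    qed (use st \<tau> nn_integral_inverse_sqrt(2)[of s t] in \<open>auto simp: Y_def\<close>)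
  qed
  \<comment> \<open>Each of the two terms is at most \<open>4 / 3 * root 3 m\<close>; their sum,
    \<open>8 / 3 * root 3 m\<close>, is rounded up.\<close>
  have "2 / 3 * Y / \<tau>\<^sup>2 + 4 / 3 * \<tau> * sqrt (t - s) \<le> 3 * root 3 m"
  proof -
    let ?q = "root 3 m"
    have q: "?q > 0" "?q ^ 3 = m" using \<open>m > 0\<close> by simp_all
    have "Y / \<tau>\<^sup>2 = Y * (t - s) / ?q\<^sup>2" using st by (simp add: \<tau>_def power_divide)
    also have "\<dots> \<le> 2 * m / ?q\<^sup>2" using Yl by (intro divide_right_mono) auto
    also have "\<dots> = 2 * ?q" using q by (simp add: power3_eq_cube power2_eq_square field_simps)
    finally have "Y / \<tau>\<^sup>2 \<le> 2 * ?q" .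
    moreover have "\<tau> * sqrt (t - s) = ?q" using st by (simp add: \<tau>_def)
    moreover have "2 / 3 * Y / \<tau>\<^sup>2 + 4 / 3 * \<tau> * sqrt (t - s) = 2 / 3 * (Y / \<tau>\<^sup>2) + 4 / 3 * (\<tau> * sqrt (t - s))"
      by simp
    ultimately show ?thesis using q(1) by linarith
  qed
  with main show ?thesis by (meson ennreal_leI order_trans)
qed

text \<open>Sorting the parameters by the octant of their tangent, counted from the direction of the
  rectangle, reduces the claim to one octant. Two points of \<open>R\<close> span a chord with
  components at most the side lengths, so the box of the chord has at most the area of
  \<open>R\<close>.\<close>

lemma emeasure_arc_measure_rectangle:
  assumes "R \<in> rectangles \<delta>"
  shows "emeasure arc_measure (z -` R) \<le> ennreal 39 * ennreal (root 3 (measure lebesgue R))"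
proof -
  obtain a q w k where wk: "0 < w" "0 < k" and R: "R = frame_rectangle a q w k"
    and m: "measure lebesgue R = 4 * (w * k)"
    using rectangle_eq_frame_rectangle[OF assms] by blast
  let ?m = "measure lebesgue R"
  have "R \<in> sets borel" using rectangles_compact[OF assms] by (simp add: compact_imp_closed)
  then have zR [measurable]: "z -` R \<in> sets borel" using measurable_sets[OF z_measurable] by simp
  define J where "J j = {t \<in> {0..L} \<inter> z -` R. a + real_of_int j * (pi / 4) \<le> \<alpha> t \<and> \<alpha> t < a + (real_of_int j + 1) * (pi / 4)}" for j :: int
  have J_sets [measurable]: "J j \<in> sets borel" for j
  proof -
    let ?S = "{a + real_of_int j * (pi / 4)..<a + (real_of_int j + 1) * (pi / 4)}"
    have "\<alpha> -` ?S \<inter> space borel \<in> sets borel"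
      by (rule measurable_sets[OF \<alpha>.borel_measurable_f]) (rule atLeastLessThan_borel)
    then have "({0..L} \<inter> z -` R) \<inter> (\<alpha> -` ?S \<inter> space borel) \<in> sets borel"
      by (intro sets.Int zR) auto
    also have "({0..L} \<inter> z -` R) \<inter> (\<alpha> -` ?S \<inter> space borel) = J j"
      unfolding J_def by auto
    finally show ?thesis .
  qed
  have J: "emeasure arc_measure (J j) \<le> ennreal (3 * root 3 ?m)" for j
  proof -
    have "emeasure arc_measure (J j) = (\<integral>\<^sup>+t\<in>J j. \<kappa> t \<partial>lborel)"
      unfolding emeasure_arc_measure[OF J_sets]
      by (intro nn_integral_cong) (auto simp: J_def indicator_def)
    also have "\<dots> \<le> ennreal (3 * root 3 ?m)"
    proof (rule nn_integral_le_of_subintervals)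
      show "J j \<subseteq> {0..L}" by (auto simp: J_def)
      fix s t assume st: "s \<in> J j" "t \<in> J j" "s < t"
      let ?v = "z t - z s" and ?low = "a + real_of_int j * (pi / 4)"
      have prod: "\<bar>dir a \<bullet> ?v\<bar> * \<bar>cross2 (dir a) ?v\<bar> \<le> ?m"
      proof -
        have "dir a \<bullet> ?v = dir a \<bullet> (z t - q) - dir a \<bullet> (z s - q)"
          "cross2 (dir a) ?v = cross2 (dir a) (z t - q) - cross2 (dir a) (z s - q)"
          by (simp_all add: inner_diff_right cross2_simps)
        moreover have "\<bar>dir a \<bullet> (z t - q)\<bar> \<le> w" "\<bar>dir a \<bullet> (z s - q)\<bar> \<le> w"
          "\<bar>cross2 (dir a) (z t - q)\<bar> \<le> k" "\<bar>cross2 (dir a) (z s - q)\<bar> \<le> k"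
          using st by (auto simp: J_def R frame_rectangle_def)
        ultimately have "\<bar>dir a \<bullet> ?v\<bar> \<le> 2 * w" "\<bar>cross2 (dir a) ?v\<bar> \<le> 2 * k" by linarith+
        then have "\<bar>dir a \<bullet> ?v\<bar> * \<bar>cross2 (dir a) ?v\<bar> \<le> (2 * w) * (2 * k)"
          using wk by (intro mult_mono) auto
        then show ?thesis by (simp add: m)
      qed
      \<comment> \<open>Octants are numbered in steps of \<open>pi / 4\<close> and axes occur every
        \<open>pi / 2\<close>, so an even octant has its axis at the lower end and an odd one at the
        upper end.\<close>
      define ax where "ax = (if even j then ?low else ?low + pi / 4)"
      have "\<exists>i. ax = a + real_of_int i * (pi / 2)"
      proof (cases "even j")
        case True
        then obtain i where "j = 2 * i" by blast
        then show ?thesis using True by (intro exI[of _ i]) (simp add: ax_def)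
      next
        case False
        then obtain i where "j = 2 * i + 1" by (elim oddE)
        then show ?thesis using False by (intro exI[of _ "i + 1"]) (simp add: ax_def algebra_simps)
      qed
      then have "\<bar>dir ax \<bullet> ?v\<bar> * \<bar>cross2 (dir ax) ?v\<bar> \<le> ?m"
        using prod axis_product_invariant by auto
      moreover have "\<alpha> t \<le> ?low + pi / 4"
      proof -
        have "(real_of_int j + 1) * (pi / 4) = real_of_int j * (pi / 4) + pi / 4" by (simp only: distrib_right mult_1)
        moreover have "\<alpha> t < a + (real_of_int j + 1) * (pi / 4)" using st by (simp only: J_def mem_Collect_eq)
        ultimately show ?thesis by linarith
      qed
      ultimately show "(\<integral>\<^sup>+r\<in>{s..t}. \<kappa> r \<partial>lborel) \<le> ennreal (3 * root 3 ?m)"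
        using st wk by (intro nn_integral_\<kappa>_octant[where low="?low" and ax=ax]) (auto simp: J_def ax_def m)
    qed measurable
    finally show ?thesis .
  qed
  \<comment> \<open>The values of \<alpha> lie in a window of length \<open>3 * pi\<close>, which is
    12 octants long and therefore meets at most 13 of them.\<close>
  define j0 where "j0 = \<lfloor>(\<theta> 0 - a) / (pi / 4)\<rfloor>"
  let ?U = "\<Union>i<13. J (j0 + int i)"
  have "z -` R \<inter> {0..L} \<subseteq> ?U"
  proof
    fix t assume t: "t \<in> z -` R \<inter> {0..L}"
    define j where "j = \<lfloor>(\<alpha> t - a) / (pi / 4)\<rfloor>"
    have j: "real_of_int j \<le> (\<alpha> t - a) / (pi / 4)" "(\<alpha> t - a) / (pi / 4) < real_of_int j + 1"
      unfolding j_def by linarith+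
    have "t \<in> J j"
    proof -
      have pi4: "0 < pi / 4" by simp
      have "real_of_int j * (pi / 4) \<le> \<alpha> t - a" using j(1) unfolding pos_le_divide_eq[OF pi4] .
      moreover have "\<alpha> t - a < (real_of_int j + 1) * (pi / 4)" using j(2) unfolding pos_divide_less_eq[OF pi4] .
      ultimately show ?thesis using t unfolding J_def mem_Collect_eq by (intro conjI) (blast, linarith, linarith)
    qed
    have "j0 \<le> j" unfolding j0_def j_def using \<alpha>_range(1)[of t] by (intro floor_mono divide_right_mono) auto
    have "(\<alpha> t - a) / (pi / 4) < (\<theta> 0 - a + 3 * pi) / (pi / 4)"
      using \<alpha>_range(2)[of t] by (intro divide_strict_right_mono) auto
    also have "\<dots> = (\<theta> 0 - a) / (pi / 4) + 12" by (simp add: add_divide_distrib)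
    finally have "j \<le> j0 + 12" unfolding j0_def j_def by linarith
    have "j = j0 + int (nat (j - j0))" "nat (j - j0) < 13" using \<open>j0 \<le> j\<close> \<open>j \<le> j0 + 12\<close> by auto
    then show "t \<in> ?U" using \<open>t \<in> J j\<close> by (metis UN_I lessThan_iff)
  qed
  have "emeasure arc_measure (z -` R) = emeasure arc_measure (z -` R \<inter> {0..L})"
    by (simp add: emeasure_arc_measure) (auto intro!: nn_integral_cong simp: indicator_def)
  also have "\<dots> \<le> emeasure arc_measure ?U"
    by (rule emeasure_mono[OF \<open>z -` R \<inter> {0..L} \<subseteq> ?U\<close>]) measurable
  also have "\<dots> \<le> (\<Sum>i<13. emeasure arc_measure (J (j0 + int i)))"
    by (rule emeasure_subadditive_finite) auto
  also have "\<dots> \<le> (\<Sum>i<(13::nat). ennreal (3 * root 3 ?m))"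
    by (rule sum_mono) (rule J)
  also have "\<dots> = ennreal 39 * ennreal (root 3 ?m)"
    by (simp add: ennreal_mult mult.assoc[symmetric])
  finally show ?thesis .
qed

text \<open>The estimate for a rectangle does not depend on its diameter, so summing it over a cover
  already bounds the premeasure with \<open>\<delta> = 1\<close>.\<close>

lemma affine_outer_measure_ge:
  assumes E: "E \<in> sets borel"
  shows "ennreal (1 / 39) * emeasure (param_affine_arclength L z) E \<le> affine_outer_measure E"
proof -
  let ?w = "\<lambda>R :: (real^2) set. ennreal (root 3 (measure lebesgue R))"
  have "ennreal (1 / 39) * emeasure arc_measure (z -` E) \<le> affine_premeasure 1 E"
    unfolding affine_premeasure_def
  proof (rule INF_greatest)
    fix C assume "C \<in> {C. C \<subseteq> rectangles 1 \<and> countable C \<and> E \<subseteq> \<Union> C}"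
    then have C: "C \<subseteq> rectangles 1" "countable C" "E \<subseteq> \<Union> C" by auto
    have zR: "z -` R \<in> sets arc_measure" if "R \<in> C" for R
    proof -
      have "R \<in> sets borel" using rectangles_compact[of R 1] that C by (auto simp: compact_imp_closed)
      then show ?thesis using measurable_sets[OF z_measurable] by simp
    qed
    have "emeasure arc_measure (z -` E) \<le> emeasure arc_measure (\<Union>R\<in>C. z -` R)"
    proof (rule emeasure_mono)
      show "z -` E \<subseteq> (\<Union>R\<in>C. z -` R)" using C(3) by blast
      show "(\<Union>R\<in>C. z -` R) \<in> sets arc_measure"
        by (rule sets.countable_UN') (use C zR in auto)
    qed
    also have "\<dots> \<le> (\<integral>\<^sup>+R. emeasure arc_measure (z -` R) \<partial>count_space C)"
      by (rule emeasure_UN_le_nn_integral[OF C(2) zR])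
    also have "\<dots> \<le> (\<integral>\<^sup>+R. ennreal 39 * ?w R \<partial>count_space C)"
      by (rule nn_integral_mono) (use C emeasure_arc_measure_rectangle in auto)
    also have "\<dots> = ennreal 39 * (\<Sum>\<^sub>\<infinity>R\<in>C. ?w R)"
      by (simp add: nn_integral_cmult infsum_ennreal_eq_nn_integral[OF C(2)])
    finally have "ennreal (1 / 39) * emeasure arc_measure (z -` E) \<le> ennreal (1 / 39) * (ennreal 39 * (\<Sum>\<^sub>\<infinity>R\<in>C. ?w R))"
      by (rule mult_left_mono) simp
    also have "\<dots> = (\<Sum>\<^sub>\<infinity>R\<in>C. ?w R)"
      by (simp only: mult.assoc[symmetric] ennreal_mult[symmetric]) simp
    finally show "ennreal (1 / 39) * emeasure arc_measure (z -` E) \<le> (\<Sum>\<^sub>\<infinity>R\<in>C. ?w R)" .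
  qed
  also have "\<dots> \<le> affine_outer_measure E" by (rule affine_premeasure_le_outer) simp
  finally show ?thesis by (simp add: emeasure_param_eq_arc_measure[OF E])
qed

end

section \<open>Existence of arclength parametrizations\<close>

lemma arc_length_le:
  assumes "\<And>n p. mono p \<Longrightarrow> p 0 = s \<Longrightarrow> p n = t \<Longrightarrow> ennreal (\<Sum>i<n. dist (z (p i)) (z (p (Suc i)))) \<le> c"
  shows "arc_length z s t \<le> c"
  unfolding arc_length_def by (rule SUP_least) (use assms in auto)

lemma arc_length_ge:
  "mono p \<Longrightarrow> p 0 = s \<Longrightarrow> p n = t \<Longrightarrow> ennreal (\<Sum>i<n. dist (z (p i)) (z (p (Suc i)))) \<le> arc_length z s t"
  unfolding arc_length_def by (rule SUP_upper2[of "(n, p)"]) auto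

lemma arc_length_reparametrize_le:
  assumes "mono_on {s..t} \<phi>" "s \<le> t"
  shows "arc_length (\<lambda>x. g (\<phi> x)) s t \<le> arc_length g (\<phi> s) (\<phi> t)"
proof (rule arc_length_le)
  fix n :: nat and p :: "nat \<Rightarrow> real" assume p: "mono p" "p 0 = s" "p n = t"
  \<comment> \<open>Beyond index \<open>n\<close> the points \<open>p i\<close> may leave
    \<open>[s, t]\<close>, where \<phi> need not be monotone; \<open>min i n\<close> freezes them at
    \<open>t\<close>.\<close>
  define q where "q i = \<phi> (p (min i n))" for i
  have in_st: "p (min i n) \<in> {s..t}" for i
    using monoD[OF p(1), of 0 "min i n"] monoD[OF p(1), of "min i n" n] p by auto
  have "mono q"
  proof (rule monoI)
    fix i j :: nat assume "i \<le> j"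
    then have "p (min i n) \<le> p (min j n)" by (intro monoD[OF p(1)]) auto
    then show "q i \<le> q j" unfolding q_def using assms(1) in_st by (auto simp: mono_on_def)
  qed
  then have "ennreal (\<Sum>i<n. dist (g (q i)) (g (q (Suc i)))) \<le> arc_length g (\<phi> s) (\<phi> t)"
    by (rule arc_length_ge) (auto simp: q_def p)
  also have "(\<Sum>i<n. dist (g (q i)) (g (q (Suc i)))) = (\<Sum>i<n. dist (g (\<phi> (p i))) (g (\<phi> (p (Suc i)))))"
    by (intro sum.cong) (auto simp: q_def min_def)
  finally show "ennreal (\<Sum>i<n. dist (g (\<phi> (p i))) (g (\<phi> (p (Suc i))))) \<le> arc_length g (\<phi> s) (\<phi> t)" .
qed

text \<open>Concatenating polygons gives one inequality. For the other, a polygon is cut at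
  \<open>b\<close> by taking minima and maxima with \<open>b\<close>: in a cell on one side of
  \<open>b\<close> one of the two new distances vanishes, and only a cell containing
  \<open>b\<close> uses the triangle inequality.\<close>

lemma arc_length_add:
  assumes "a \<le> b" "b \<le> c"
  shows "arc_length g a c = arc_length g a b + arc_length g b c"
proof (rule antisym)
  show "arc_length g a c \<le> arc_length g a b + arc_length g b c"
  proof (rule arc_length_le)
    fix n :: nat and p :: "nat \<Rightarrow> real" assume p: "mono p" "p 0 = a" "p n = c"
    define u where "u i = min (p i) b" for i
    define v where "v i = max (p i) b" for i
    have uv: "mono u" "mono v" using p(1) unfolding u_def v_def mono_def
      by (meson min.mono max.mono order_refl)+
    have "(\<Sum>i<n. dist (g (p i)) (g (p (Suc i))))
        \<le> (\<Sum>i<n. dist (g (u i)) (g (u (Suc i))) + dist (g (v i)) (g (v (Suc i))))"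
    proof (rule sum_mono)
      fix i
      have "p i \<le> p (Suc i)" using p(1) by (simp add: mono_def)
      then consider "p (Suc i) \<le> b" | "b \<le> p i" | "p i \<le> b" "b \<le> p (Suc i)" by linarith
      then show "dist (g (p i)) (g (p (Suc i))) \<le> dist (g (u i)) (g (u (Suc i))) + dist (g (v i)) (g (v (Suc i)))"
        using \<open>p i \<le> p (Suc i)\<close> by cases (auto simp: u_def v_def min_def max_def dist_triangle)
    qed
    also have "\<dots> = (\<Sum>i<n. dist (g (u i)) (g (u (Suc i)))) + (\<Sum>i<n. dist (g (v i)) (g (v (Suc i))))"
      by (rule sum.distrib)
    finally have "ennreal (\<Sum>i<n. dist (g (p i)) (g (p (Suc i))))
        \<le> ennreal (\<Sum>i<n. dist (g (u i)) (g (u (Suc i)))) + ennreal (\<Sum>i<n. dist (g (v i)) (g (v (Suc i))))"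
      by (subst ennreal_plus[symmetric]) (auto intro: ennreal_leI sum_nonneg)
    also have "\<dots> \<le> arc_length g a b + arc_length g b c"
      by (intro add_mono arc_length_ge uv) (use p assms in \<open>auto simp: u_def v_def\<close>)
    finally show "ennreal (\<Sum>i<n. dist (g (p i)) (g (p (Suc i)))) \<le> arc_length g a b + arc_length g b c" .
  qed
  have concat: "ennreal (\<Sum>i<n. dist (g (p i)) (g (p (Suc i)))) + ennreal (\<Sum>i<m. dist (g (q i)) (g (q (Suc i)))) \<le> arc_length g a c"
    if p: "mono p" "p 0 = a" "p n = b" and q: "mono q" "q 0 = b" "q m = c" for n m p q
  proof -
    define r where "r i = (if i \<le> n then p i else q (i - n))" for i
    have "mono r"
    proof (rule monoI)
      fix i j :: nat assume "i \<le> j"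
      show "r i \<le> r j"
      proof (cases "i \<le> n \<and> \<not> j \<le> n")
        case True
        then have "p i \<le> p n" "q 0 \<le> q (j - n)" using p(1) q(1) by (auto simp: mono_def)
        then show ?thesis using True p q by (simp add: r_def)
      qed (use \<open>i \<le> j\<close> p(1) q(1) in \<open>auto simp: r_def mono_def\<close>)
    qed
    have rn: "r (n + i) = q i" for i using p q by (auto simp: r_def)
    have "(\<Sum>i<n + m. dist (g (r i)) (g (r (Suc i)))) = (\<Sum>i<n. dist (g (r i)) (g (r (Suc i)))) + (\<Sum>i<m. dist (g (r (n + i))) (g (r (Suc (n + i)))))"
      by (induction m) auto
    also have "(\<Sum>i<n. dist (g (r i)) (g (r (Suc i)))) = (\<Sum>i<n. dist (g (p i)) (g (p (Suc i))))"
      by (intro sum.cong) (auto simp: r_def)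
    also have "(\<Sum>i<m. dist (g (r (n + i))) (g (r (Suc (n + i))))) = (\<Sum>i<m. dist (g (q i)) (g (q (Suc i))))"
      using rn[of "Suc _"] by (intro sum.cong) (auto simp: rn)
    finally have eq: "(\<Sum>i<n + m. dist (g (r i)) (g (r (Suc i))))
      = (\<Sum>i<n. dist (g (p i)) (g (p (Suc i)))) + (\<Sum>i<m. dist (g (q i)) (g (q (Suc i))))" .
    have "ennreal (\<Sum>i<n + m. dist (g (r i)) (g (r (Suc i)))) \<le> arc_length g a c"
      by (rule arc_length_ge[OF \<open>mono r\<close>]) (use p q rn in \<open>auto simp: r_def\<close>)
    then show ?thesis unfolding eq by (simp add: sum_nonneg)
  qed
  have ne: "{(n :: nat, p :: nat \<Rightarrow> real). mono p \<and> p 0 = s \<and> p n = t} \<noteq> {}" if "s \<le> t" for s t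
  proof -
    have "mono (\<lambda>i::nat. if i = 0 then s else t)" using that by (auto simp: mono_def)
    then have "(1, \<lambda>i. if i = 0 then s else t) \<in> {(n :: nat, p :: nat \<Rightarrow> real). mono p \<and> p 0 = s \<and> p n = t}" by simp
    then show ?thesis by blast
  qed
  show "arc_length g a b + arc_length g b c \<le> arc_length g a c"
    unfolding arc_length_def[of g a b] arc_length_def[of g b c]
    unfolding ennreal_SUP_add_left[OF ne[OF assms(1)], symmetric] ennreal_SUP_add_right[OF ne[OF assms(2)]]
    by (intro SUP_least) (use concat in auto)
qed

lemma arc_length_lipschitz:
  assumes "\<And>x y. dist (g x) (g y) \<le> C * \<bar>x - y\<bar>" "a \<le> b" "0 \<le> C"
  shows "arc_length g a b \<le> ennreal (C * (b - a))"
proof (rule arc_length_le)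
  fix n :: nat and p :: "nat \<Rightarrow> real" assume p: "mono p" "p 0 = a" "p n = b"
  have "(\<Sum>i<n. dist (g (p i)) (g (p (Suc i)))) \<le> (\<Sum>i<n. C * (p (Suc i) - p i))"
  proof (rule sum_mono)
    fix i
    have "p i \<le> p (Suc i)" using p(1) by (simp add: mono_def)
    then show "dist (g (p i)) (g (p (Suc i))) \<le> C * (p (Suc i) - p i)" using assms(1)[of "p i" "p (Suc i)"] by simp
  qed
  also have "\<dots> = C * (b - a)"
    by (simp only: sum_distrib_left[symmetric] sum_lessThan_telescope p)
  finally show "ennreal (\<Sum>i<n. dist (g (p i)) (g (p (Suc i)))) \<le> ennreal (C * (b - a))" by (rule ennreal_leI)
qed

text \<open>\<sigma> is the inverse of the signed arc length \<open>S\<close> from \<open>0\<close>.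
  \<open>S\<close> is continuous because \<open>g\<close> is Lipschitz, strictly increasing because
  \<open>g\<close> is injective on a period, and unbounded in both directions because it gains
  \<open>S T\<close> with each period.\<close>

lemma arclength_reparametrization:
  fixes g :: "real \<Rightarrow> real^2"
  assumes lip: "\<And>x y. dist (g x) (g y) \<le> C * \<bar>x - y\<bar>" and "T > 0"
    and per: "\<And>t. g (t + T) = g t" and inj: "inj_on g {0..<T}"
  obtains L \<sigma> where "L > 0" "strict_mono \<sigma>" "surj \<sigma>" "\<sigma> 0 = 0" "\<And>t. \<sigma> (t + L) = \<sigma> t + T"
    "\<And>s t. s \<le> t \<Longrightarrow> arc_length (\<lambda>x. g (\<sigma> x)) s t = ennreal (t - s)"
proof -
  have C0: "C \<ge> 0" using order_trans[OF zero_le_dist lip[of 0 1]] by simp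
  define S where "S t = (if t \<ge> 0 then enn2real (arc_length g 0 t) else - enn2real (arc_length g t 0))" for t
  have fin: "arc_length g a b < top" if "a \<le> b" for a b
    using arc_length_lipschitz[OF lip that C0] by (simp add: order_le_less_trans)
  have add: "enn2real (arc_length g a c) = enn2real (arc_length g a b) + enn2real (arc_length g b c)"
    if "a \<le> b" "b \<le> c" for a b c
    unfolding arc_length_add[OF that] using fin that by (intro enn2real_plus) auto
  have S_diff: "S b - S a = enn2real (arc_length g a b)" if "a \<le> b" for a b
    using add[of 0 a b] add[of a b 0] add[of a 0 b] that by (auto simp: S_def)
  have AL: "arc_length g a b = ennreal (S b - S a)" if "a \<le> b" for a b
    unfolding S_diff[OF that] using fin[OF that] by simp
  have per_int: "g (t + real_of_int k * T) = g t" for t k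
  proof (induction k rule: int_induct[where k=0])
    case (step1 i)
    have "g (t + real_of_int (i + 1) * T) = g ((t + real_of_int i * T) + T)" by (simp add: algebra_simps)
    then show ?case using per step1 by metis
  next
    case (step2 i)
    have "g (t + real_of_int i * T) = g ((t + real_of_int (i - 1) * T) + T)" by (simp add: algebra_simps)
    then show ?case using per step2 by metis
  qed simp
  have neq: "g a \<noteq> g b" if "a < b" "b < a + T" for a b
  proof
    assume eq: "g a = g b"
    define k where "k = \<lfloor>a / T\<rfloor>"
    define k' where "k' = \<lfloor>b / T\<rfloor>"
    have a': "a + real_of_int (- k) * T \<in> {0..<T}"
      using floor_divide_lower[OF \<open>T > 0\<close>, of a] floor_divide_upper[OF \<open>T > 0\<close>, of a] by (simp add: k_def algebra_simps)
    have b': "b + real_of_int (- k') * T \<in> {0..<T}"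
      using floor_divide_lower[OF \<open>T > 0\<close>, of b] floor_divide_upper[OF \<open>T > 0\<close>, of b] by (simp add: k'_def algebra_simps)
    have "a + real_of_int (- k) * T = b + real_of_int (- k') * T"
      by (rule inj_onD[OF inj _ a' b']) (simp only: per_int eq)
    then have d: "b - a = real_of_int (k' - k) * T" by (simp add: algebra_simps)
    then have "0 * T < real_of_int (k' - k) * T" "real_of_int (k' - k) * T < 1 * T" using that by linarith+
    then have "0 < real_of_int (k' - k)" "real_of_int (k' - k) < 1"
      using mult_less_cancel_right_pos[OF \<open>T > 0\<close>] by blast+
    then show False unfolding of_int_0_less_iff of_int_less_1_iff by linarith
  qed
  have S_mono: "S a < S b" if "a < b" for a b
  proof -
    \<comment> \<open>Shortening to less than a period guarantees \<open>g a \<noteq> g c\<close>,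
      so that the arc has positive length.\<close>
    define c where "c = min b (a + T / 2)"
    have c: "a < c" "c \<le> b" "c < a + T" using that \<open>T > 0\<close> by (auto simp: c_def)
    have "ennreal (dist (g a) (g c)) \<le> ennreal (S c - S a)"
      using arc_length_ge_dist[of a c g] c AL[of a c] by simp
    moreover have "dist (g a) (g c) > 0" using neq[OF c(1,3)] by simp
    ultimately have "S a < S c" by (smt (verit) ennreal_le_iff2)
    moreover have "S c \<le> S b" using S_diff[OF c(2)] enn2real_nonneg[of "arc_length g c b"] by linarith
    ultimately show ?thesis by simp
  qed
  then have S_strict: "strict_mono S" by (rule strict_monoI)
  have S_per: "S (t + T) = S t + S T" for t
  proof -
    have shift_le: "arc_length (\<lambda>x. g (x + c)) a b \<le> arc_length g (a + c) (b + c)" if "a \<le> b" for a b c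
      by (rule arc_length_reparametrize_le[OF _ that]) (auto simp: mono_on_def)
    have "arc_length g (a + T) (b + T) = arc_length g a b" if "a \<le> b" for a b
    proof (rule antisym)
      show "arc_length g a b \<le> arc_length g (a + T) (b + T)" using shift_le[OF that, of T] per by simp
      have "g (x + - T) = g x" for x using per[of "x - T"] by simp
      then show "arc_length g (a + T) (b + T) \<le> arc_length g a b" using shift_le[of "a + T" "b + T" "- T"] that by simp
    qed
    then have eq: "S (b + T) - S (a + T) = S b - S a" if "a \<le> b" for a b
      using S_diff[of a b] S_diff[of "a + T" "b + T"] that by simp
    have "S 0 = 0" using arc_length_lipschitz[OF lip _ C0, of 0 0] by (simp add: S_def)
    then show ?thesis using eq[of 0 t] eq[of t 0] by (cases "0 \<le> t") auto
  qed
  have S0: "S 0 = 0" using S_per[of 0] by simp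
  have S_lip: "\<bar>S a - S b\<bar> \<le> C * \<bar>a - b\<bar>" for a b
  proof -
    have "\<bar>S b - S a\<bar> \<le> C * (b - a)" if "a \<le> b" for a b
    proof -
      have "ennreal (S b - S a) \<le> ennreal (C * (b - a))" using arc_length_lipschitz[OF lip that C0] AL[OF that] by simp
      moreover have "0 \<le> C * (b - a)" using C0 that by simp
      moreover have "0 \<le> S b - S a" using S_diff[OF that] by simp
      ultimately show ?thesis by simp
    qed
    from this[of a b] this[of b a] show ?thesis by (cases "a \<le> b") (auto simp: abs_minus_commute)
  qed
  have S_cont: "continuous_on UNIV S"
  proof -
    have "C-lipschitz_on UNIV S" by (rule lipschitz_onI) (use S_lip C0 in \<open>auto simp: dist_real_def\<close>)
    then show ?thesis by (rule lipschitz_on_continuous_on)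
  qed
  have L: "S T > 0" using S_mono[OF \<open>T > 0\<close>] S0 by simp
  have S_nat: "S (real n * T) = real n * S T" for n
  proof (induction n)
    case (Suc n)
    have "real (Suc n) * T = real n * T + T" by (simp add: algebra_simps)
    then have "S (real (Suc n) * T) = S (real n * T) + S T" using S_per by simp
    then show ?case using Suc by (simp add: algebra_simps)
  qed (simp add: S0)
  have S_neg: "S (- (real n * T)) = - (real n * S T)" for n
  proof (induction n)
    case (Suc n)
    have "S (- (real (Suc n) * T) + T) = S (- (real (Suc n) * T)) + S T" by (rule S_per)
    moreover have "- (real (Suc n) * T) + T = - (real n * T)" by (simp add: algebra_simps)
    ultimately show ?case using Suc by (simp add: algebra_simps)
  qed (simp add: S0)
  have "surj S"
    unfolding surj_def
  proof (rule allI)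
    fix y
    obtain n :: nat where n: "\<bar>y\<bar> / S T < real n" using reals_Archimedean2 by blast
    then have y: "- (real n * S T) \<le> y" "y \<le> real n * S T" using L by (auto simp: pos_divide_less_eq abs_less_iff)
    have "\<exists>x\<ge>- (real n * T). x \<le> real n * T \<and> S x = y"
      by (rule IVT') (use y S_nat S_neg \<open>T > 0\<close> continuous_on_subset[OF S_cont] in auto)
    then show "\<exists>x. y = S x" by blast
  qed
  define \<sigma> where "\<sigma> = inv S"
  have S\<sigma>: "S (\<sigma> y) = y" for y using \<open>surj S\<close> by (simp add: \<sigma>_def surj_f_inv_f)
  have \<sigma>S: "\<sigma> (S x) = x" for x using S_strict strict_mono_imp_inj_on by (simp add: \<sigma>_def strict_mono_on_imp_inj_on)
  have \<sigma>_mono: "strict_mono \<sigma>"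
  proof (rule strict_monoI)
    fix x y :: real assume "x < y"
    then have "S (\<sigma> x) < S (\<sigma> y)" by (simp add: S\<sigma>)
    then show "\<sigma> x < \<sigma> y" using S_strict strict_mono_less by blast
  qed
  show ?thesis
  proof (rule that[of "S T" \<sigma>])
    show "surj \<sigma>" using \<sigma>S by (metis surjI)
    show "\<sigma> 0 = 0" using \<sigma>S[of 0] S0 by simp
    show "\<sigma> (t + S T) = \<sigma> t + T" for t using \<sigma>S[of "\<sigma> t + T"] S_per[of "\<sigma> t"] S\<sigma> by simp
    show "arc_length (\<lambda>x. g (\<sigma> x)) s t = ennreal (t - s)" if "s \<le> t" for s t
    proof (rule antisym)
      have le: "\<sigma> s \<le> \<sigma> t" using \<sigma>_mono that by (simp add: strict_mono_less_eq)
      have "arc_length (\<lambda>x. g (\<sigma> x)) s t \<le> arc_length g (\<sigma> s) (\<sigma> t)"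
        by (rule arc_length_reparametrize_le[OF _ that]) (auto simp: mono_on_def strict_mono_less_eq[OF \<sigma>_mono])
      then show "arc_length (\<lambda>x. g (\<sigma> x)) s t \<le> ennreal (t - s)" using AL[OF le] S\<sigma> by simp
      have "arc_length (\<lambda>x. g (\<sigma> (S x))) (\<sigma> s) (\<sigma> t) \<le> arc_length (\<lambda>x. g (\<sigma> x)) (S (\<sigma> s)) (S (\<sigma> t))"
        by (rule arc_length_reparametrize_le[OF _ le]) (auto simp: mono_on_def strict_mono_less_eq[OF S_strict])
      then show "ennreal (t - s) \<le> arc_length (\<lambda>x. g (\<sigma> x)) s t" using AL[OF le] S\<sigma> \<sigma>S by simp
    qed
  qed (use L \<sigma>_mono in auto)
qed

lemma dist_dir_le: "dist (dir a) (dir b) \<le> \<bar>a - b\<bar>"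
proof -
  have "(dist (dir a) (dir b))\<^sup>2 = 2 - 2 * cos (b - a)"
    by (simp add: dist_norm power2_norm_eq_inner inner_diff_left inner_diff_right dir_inner_dir
        inner_commute[of "dir b" "dir a"] cos_minus[of "a - b", symmetric])
  also have "\<dots> = (2 * sin ((b - a) / 2))\<^sup>2"
  proof -
    have "2 * ((b - a) / 2) = b - a" by simp
    then have "cos (b - a) = 1 - 2 * (sin ((b - a) / 2))\<^sup>2"
      using cos_double_sin[of "(b - a) / 2"] by (simp only:)
    then show ?thesis by (simp add: power_mult_distrib)
  qed
  finally have "dist (dir a) (dir b) = \<bar>2 * sin ((b - a) / 2)\<bar>"
    by (metis abs_of_nonneg power2_eq_iff_nonneg zero_le_dist power2_abs abs_ge_zero)
  also have "\<dots> \<le> \<bar>a - b\<bar>"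
    using abs_sin_x_le_abs_x[of "(b - a) / 2"] by simp
  finally show ?thesis .
qed

lemma linear_complex_of_plane: "linear complex_of_plane"
  by (rule linearI) (simp_all add: complex_of_plane_def complex_eq_iff)

lemma inj_complex_of_plane: "complex_of_plane x = complex_of_plane y \<longleftrightarrow> x = y"
  by (simp add: complex_of_plane_def vec_eq_iff forall_2)

lemma complex_of_plane_polar: "complex_of_plane (r *\<^sub>R dir t) = r * cis t"
  by (simp add: complex_of_plane_def complex_eq_iff)

section \<open>The frontier as a polar graph\<close>

context convex_region
begin

text \<open>Let \<open>e\<close> be the radius of a disc around \<open>p\<close> inside
  \<open>K\<close> and \<open>R\<close> a bound for the distances from \<open>p\<close>. The outer
  normal \<open>n\<close> at the frontier point in direction \<open>b\<close> satisfies
  \<open>n \<bullet> dir b \<ge> e / R\<close>, because the disc lies below the supporting line. The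
  frontier point in direction \<open>a\<close> lies below it as well, and comparing the two gives
  the Lipschitz constant \<open>R * R / e\<close>.\<close>

lemma radial_function:
  obtains \<rho> C where "\<And>t. \<rho> t > 0" "\<And>t. p + \<rho> t *\<^sub>R dir t \<in> frontier K" "C \<ge> 0"
    "\<And>s t. \<bar>\<rho> s - \<rho> t\<bar> \<le> C * \<bar>s - t\<bar>" "\<And>t. \<rho> t \<le> C"
proof -
  have "\<exists>d>0. p + d *\<^sub>R dir t \<in> frontier K" for t
    using ray_to_frontier[of K p "dir t"] bounded_K p_in_K open_K by (metis dir_neq_0 interior_open)
  then obtain \<rho> where \<rho>: "\<And>t. \<rho> t > 0" "\<And>t. p + \<rho> t *\<^sub>R dir t \<in> frontier K" by metis
  have "bounded (closure K)" using bounded_K by (rule bounded_closure)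
  then obtain R where R: "R > 0" "\<And>x. x \<in> closure K \<Longrightarrow> dist p x \<le> R"
    by (metis bounded_any_center dual_order.strict_trans1 le_less_linear less_eq_real_def max.cobounded1 max.cobounded2 order_less_le_trans zero_less_one)
  obtain e where e: "e > 0" "cball p e \<subseteq> K" using open_K p_in_K open_contains_cball by blast
  have \<rho>R: "\<rho> t \<le> R" for t
    using R(2)[of "p + \<rho> t *\<^sub>R dir t"] \<rho>[of t] frontier_subset_closure by (auto simp: dist_norm)
  have one: "\<rho> a - \<rho> b \<le> R * R / e * \<bar>a - b\<bar>" for a b
  proof -
    obtain c where c: "\<And>y. y \<in> closure K \<Longrightarrow> 0 \<le> cross2 (dir c) (y - (p + \<rho> b *\<^sub>R dir b))"
      using support_direction[OF \<rho>(2) refl \<rho>(1)] by blast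
    define n where "n = - dir (c + pi / 2)"
    have n: "n \<bullet> (y - (p + \<rho> b *\<^sub>R dir b)) \<le> 0" if "y \<in> closure K" for y
      using c[OF that] by (simp add: n_def dir_quarter)
    have nn: "norm n = 1" "n \<bullet> n = 1" by (simp_all add: n_def dir_inner_dir)
    have "p + e *\<^sub>R n \<in> cball p e" using e nn by (simp add: dist_norm)
    then have "p + e *\<^sub>R n \<in> closure K" using e closure_subset by blast
    from n[OF this] have 1: "e \<le> \<rho> b * (n \<bullet> dir b)"
      using nn by (simp add: inner_diff_right)
    have "p + \<rho> a *\<^sub>R dir a \<in> closure K" using \<rho> frontier_subset_closure by blast
    from n[OF this] have 2: "\<rho> a * (n \<bullet> dir a) \<le> \<rho> b * (n \<bullet> dir b)"
      by (simp add: inner_diff_right)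
    have pos: "n \<bullet> dir b > 0" using 1 e(1) \<rho>(1)[of b] by (smt (verit) zero_less_mult_pos)
    have "\<rho> b * (n \<bullet> dir b) \<le> R * (n \<bullet> dir b)" using pos \<rho>R by (intro mult_right_mono) auto
    with 1 have 3: "e \<le> R * (n \<bullet> dir b)" by linarith
    have "(\<rho> a - \<rho> b) * (n \<bullet> dir b) \<le> \<rho> a * (n \<bullet> (dir b - dir a))"
      using 2 by (simp add: inner_diff_right algebra_simps)
    also have "\<dots> \<le> \<rho> a * (norm n * norm (dir b - dir a))"
      using \<rho>(1)[of a] by (intro mult_left_mono norm_cauchy_schwarz) auto
    also have "\<dots> \<le> R * \<bar>a - b\<bar>"
      using dist_dir_le[of b a] \<rho>R[of a] R(1) nn by (intro mult_mono) (auto simp: dist_norm abs_minus_commute)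
    finally have 4: "(\<rho> a - \<rho> b) * (n \<bullet> dir b) \<le> R * \<bar>a - b\<bar>" .
    show ?thesis
    proof (cases "\<rho> a \<le> \<rho> b")
      case True
      have "0 \<le> R * R / e * \<bar>a - b\<bar>" using R(1) e(1) by simp
      then show ?thesis using True by linarith
    next
      case False
      have "(\<rho> a - \<rho> b) * e \<le> (\<rho> a - \<rho> b) * (R * (n \<bullet> dir b))"
        using False 3 by (intro mult_left_mono) auto
      also have "\<dots> \<le> R * (R * \<bar>a - b\<bar>)"
        using mult_left_mono[OF 4, of R] R(1) by (simp add: mult_ac)
      finally show ?thesis using e(1) by (simp add: pos_le_divide_eq mult_ac)
    qed
  qed
  define C where "C = max R (R * R / e)"
  show ?thesis
  proof (rule that[of \<rho> C])
    show "C \<ge> 0" using R(1) by (simp add: C_def)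
    show "\<rho> t \<le> C" for t using \<rho>R[of t] by (simp add: C_def)
    show "\<bar>\<rho> s - \<rho> t\<bar> \<le> C * \<bar>s - t\<bar>" for s t
    proof -
      have "R * R / e * \<bar>s - t\<bar> \<le> C * \<bar>s - t\<bar>" by (intro mult_right_mono) (auto simp: C_def)
      then show ?thesis using one[of s t] one[of t s] by (simp add: abs_le_iff abs_minus_commute)
    qed
  qed (use \<rho> in auto)
qed

text \<open>\<open>compact_affine_arclength\<close> selects a parametrization by choice, so its
  meaning rests on this existence. The polar graph is Lipschitz and runs once around the frontier,
  hence can be parametrized by arc length; polar angles increase, which makes it
  counterclockwise.\<close>

lemma ccw_arclength_parametrization_exists: "\<exists>L z. ccw_arclength_parametrization (frontier K) L z"
proof -
  obtain \<rho> C where \<rho>: "\<And>t. \<rho> t > 0" "\<And>t. p + \<rho> t *\<^sub>R dir t \<in> frontier K" and "C \<ge> 0"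
    and \<rho>_lip: "\<And>s t. \<bar>\<rho> s - \<rho> t\<bar> \<le> C * \<bar>s - t\<bar>" and \<rho>C: "\<And>t. \<rho> t \<le> C"
    using radial_function by metis
  define g where "g t = p + \<rho> t *\<^sub>R dir t" for t
  have \<rho>_unique: "r = \<rho> t" if "p + r *\<^sub>R dir t \<in> frontier K" "r > 0" for r t
    by (rule frontier_ray_unique[OF that(1) \<rho>(2) that(2) \<rho>(1)])
  have dir_per: "dir (t + 2 * pi) = dir t" for t by (simp add: dir_def)
  have \<rho>_per: "\<rho> (t + 2 * pi) = \<rho> t" for t
    by (rule \<rho>_unique) (use \<rho>[of "t + 2 * pi"] in \<open>simp_all add: dir_per\<close>)
  have g_lip: "dist (g x) (g y) \<le> (C + C) * \<bar>x - y\<bar>" for x y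
  proof -
    have "g x - g y = (\<rho> x - \<rho> y) *\<^sub>R dir x + \<rho> y *\<^sub>R (dir x - dir y)"
      by (simp add: g_def algebra_simps)
    then have "dist (g x) (g y) \<le> norm ((\<rho> x - \<rho> y) *\<^sub>R dir x) + norm (\<rho> y *\<^sub>R (dir x - dir y))"
      unfolding dist_norm by (simp only: norm_triangle_ineq)
    also have "\<dots> = \<bar>\<rho> x - \<rho> y\<bar> + \<rho> y * dist (dir x) (dir y)"
      using \<rho>(1)[of y] by (simp add: dist_norm)
    also have "\<dots> \<le> C * \<bar>x - y\<bar> + C * \<bar>x - y\<bar>"
      using \<rho>_lip dist_dir_le \<rho>C \<open>C \<ge> 0\<close> by (intro add_mono mult_mono) auto
    finally show ?thesis by (simp add: distrib_right)
  qed
  have inj: "inj_on g {0..<2 * pi}"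
  proof (rule inj_onI)
    fix s t assume st: "s \<in> {0..<2 * pi}" "t \<in> {0..<2 * pi}" "g s = g t"
    then have eq: "\<rho> s *\<^sub>R dir s = \<rho> t *\<^sub>R dir t" by (simp add: g_def)
    then have "\<rho> s = \<rho> t" using \<rho>(1)[of s] \<rho>(1)[of t] by (metis abs_of_pos mult.right_neutral norm_dir norm_scaleR)
    then have "dir s = dir t" using eq \<rho>(1)[of t] by simp
    then obtain n :: int where n: "s = t + 2 * pi * n" using dir_eq_iff by blast
    then have "s - t = real_of_int n * (2 * pi)" by (simp add: mult_ac)
    moreover have "0 \<le> s" "s < 2 * pi" "0 \<le> t" "t < 2 * pi" using st by auto
    ultimately have "- 1 * (2 * pi) < real_of_int n * (2 * pi)" "real_of_int n * (2 * pi) < 1 * (2 * pi)"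
      by linarith+
    then have "- 1 < real_of_int n" "real_of_int n < 1"
      using mult_less_cancel_right_pos[of "2 * pi"] by (metis mult_pos_pos pi_gt_zero zero_less_numeral)+
    then have "n = 0" by linarith
    then show "s = t" using n by simp
  qed
  have per: "g (t + 2 * pi) = g t" for t by (simp add: g_def \<rho>_per dir_per)
  obtain L \<sigma> where L: "L > 0" and \<sigma>: "strict_mono \<sigma>" "surj \<sigma>" "\<sigma> 0 = 0" "\<And>t. \<sigma> (t + L) = \<sigma> t + 2 * pi"
    and al: "\<And>s t. s \<le> t \<Longrightarrow> arc_length (\<lambda>x. g (\<sigma> x)) s t = ennreal (t - s)"
    using arclength_reparametrization[OF g_lip _ per inj] pi_gt_zero by auto
  define z where "z x = g (\<sigma> x)" for x
  have "bij_betw \<sigma> {0..<L} {0..<2 * pi}"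
  proof (rule bij_betw_imageI)
    show "inj_on \<sigma> {0..<L}" using strict_mono_on_imp_inj_on[of UNIV \<sigma>] \<sigma>(1) inj_on_subset by blast
    show "\<sigma> ` {0..<L} = {0..<2 * pi}"
    proof (intro equalityI subsetI)
      fix y assume "y \<in> \<sigma> ` {0..<L}"
      then obtain x where x: "0 \<le> x" "x < L" "y = \<sigma> x" by auto
      have "\<sigma> 0 \<le> \<sigma> x" "\<sigma> x < \<sigma> L"
        using x strict_mono_less[OF \<sigma>(1)] strict_mono_less_eq[OF \<sigma>(1)] by auto
      then show "y \<in> {0..<2 * pi}" using \<sigma>(3) \<sigma>(4)[of 0] x(3) by simp
    next
      fix y assume y: "y \<in> {0..<2 * pi}"
      obtain x where x: "y = \<sigma> x" using \<sigma>(2) by (metis surjD)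
      have "\<sigma> 0 \<le> \<sigma> x" "\<sigma> x < \<sigma> L" using y x \<sigma>(3) \<sigma>(4)[of 0] by auto
      then have "x \<in> {0..<L}" using strict_mono_less[OF \<sigma>(1)] strict_mono_less_eq[OF \<sigma>(1)] by auto
      then show "y \<in> \<sigma> ` {0..<L}" using x by blast
    qed
  qed
  moreover have "bij_betw g {0..<2 * pi} (frontier K)"
  proof (rule bij_betw_imageI[OF inj])
    show "g ` {0..<2 * pi} = frontier K"
    proof (intro equalityI subsetI)
      fix x assume "x \<in> frontier K"
      then have "x - p \<noteq> 0" using frontier_disjoint p_in_K by auto
      obtain t where t: "0 \<le> t" "t < 2 * pi" "(1 / norm (x - p)) *\<^sub>R (x - p) = dir t"
      proof -
        let ?u = "(1 / norm (x - p)) *\<^sub>R (x - p)"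
        have "norm ?u = 1" using \<open>x - p \<noteq> 0\<close> by simp
        then have "(?u $ 1)\<^sup>2 + (?u $ 2)\<^sup>2 = 1"
          using power2_norm_eq_inner[of ?u] by (simp only: inner_2 power2_eq_square)
        then obtain t where "0 \<le> t" "t < 2 * pi" "?u $ 1 = cos t" "?u $ 2 = sin t"
          using sincos_total_2pi by metis
        then show ?thesis by (intro that[of t]) (auto simp: vec_eq_iff forall_2)
      qed
      then have "x = p + norm (x - p) *\<^sub>R dir t" using \<open>x - p \<noteq> 0\<close> by (simp flip: t(3))
      moreover have "norm (x - p) = \<rho> t"
        by (rule \<rho>_unique) (use \<open>x \<in> frontier K\<close> \<open>x - p \<noteq> 0\<close> calculation in auto)
      ultimately have "x = g t" by (simp add: g_def)
      then show "x \<in> g ` {0..<2 * pi}" using t by auto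
    qed (use \<rho> in \<open>auto simp: g_def\<close>)
  qed
  ultimately have bij: "bij_betw z {0..<L} (frontier K)"
    using bij_betw_trans unfolding z_def o_def by blast
  have "continuous_on UNIV \<sigma>"
    by (rule continuous_onI_mono) (use \<sigma> in \<open>auto simp: strict_mono_less_eq\<close>)
  then have \<sigma>_cont: "continuous_on S (\<lambda>s. \<sigma> (L * s))" for S
    by (rule continuous_on_compose2) (auto intro!: continuous_intros)
  have \<rho>_cont: "continuous_on UNIV \<rho>"
  proof -
    have "C-lipschitz_on UNIV \<rho>" by (rule lipschitz_onI) (use \<rho>_lip \<open>C \<ge> 0\<close> in \<open>auto simp: dist_real_def\<close>)
    then show ?thesis by (rule lipschitz_on_continuous_on)
  qed
  have \<rho>\<sigma>_cont: "continuous_on S (\<lambda>s. \<rho> (\<sigma> (L * s)))" for S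
    by (rule continuous_on_compose2[OF \<rho>_cont \<sigma>_cont]) auto
  define \<gamma> where "\<gamma> s = complex_of_plane (z (L * s))" for s
  have \<gamma>_eq: "\<gamma> s = complex_of_plane p + \<rho> (\<sigma> (L * s)) * cis (\<sigma> (L * s))" for s
    by (simp add: \<gamma>_def z_def g_def linear_add[OF linear_complex_of_plane] complex_of_plane_polar)
  \<comment> \<open>An explicit logarithm of the curve around \<open>p\<close>: its real part
    returns to its initial value and its imaginary part grows by \<open>2 * pi\<close>, so the
    winding number is 1.\<close>
  define q where "q s = of_real (ln (\<rho> (\<sigma> (L * s)))) + \<i> * of_real (\<sigma> (L * s))" for s
  have "path q" unfolding path_def q_def
    by (intro continuous_intros \<rho>\<sigma>_cont \<sigma>_cont) (use \<rho>(1) in \<open>auto simp: less_imp_neq[symmetric]\<close>)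
  have eq: "\<gamma> s - complex_of_plane p = exp (q s)" for s
    using \<rho>(1)[of "\<sigma> (L * s)"] by (simp add: \<gamma>_eq q_def exp_add cis_conv_exp exp_of_real)
  have wn: "winding_number \<gamma> (complex_of_plane p) = 1"
  proof -
    have "winding_number \<gamma> (complex_of_plane p) = winding_number (\<lambda>s. \<gamma> s - complex_of_plane p) 0"
      by (rule winding_number_offset)
    also have "(\<lambda>s. \<gamma> s - complex_of_plane p) = exp \<circ> q" by (simp add: fun_eq_iff eq)
    also have "winding_number (exp \<circ> q) 0 = (pathfinish q - pathstart q) / (2 * of_real pi * \<i>)"
      by (rule winding_number_compose_exp) fact
    also have "pathfinish q - pathstart q = 2 * of_real pi * \<i>"
      using \<sigma>(3) \<sigma>(4)[of 0] \<rho>_per[of 0] by (simp add: pathfinish_def pathstart_def q_def algebra_simps)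
    finally show ?thesis by simp
  qed
  have "path \<gamma>" unfolding path_def \<gamma>_eq[abs_def] cis_conv_exp
    by (intro continuous_intros \<rho>\<sigma>_cont \<sigma>_cont)
  have "pathfinish \<gamma> = pathstart \<gamma>"
    using \<sigma>(3) \<sigma>(4)[of 0] per[of 0] by (simp add: pathfinish_def pathstart_def \<gamma>_def z_def)
  have disj: "complex_of_plane ` K \<inter> path_image \<gamma> = {}"
    using \<rho>(2) frontier_disjoint by (auto simp: path_image_def \<gamma>_def z_def g_def inj_complex_of_plane)
  have conn: "connected (complex_of_plane ` K)"
    using convex_K by (intro convex_connected convex_linear_image linear_complex_of_plane)
  \<comment> \<open>The winding number is constant on the connected set \<open>K\<close>, which the
    curve does not meet.\<close>
  have "winding_number \<gamma> (complex_of_plane x) = 1" if "x \<in> inside (frontier K)" for x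
  proof -
    have "x \<in> K" using that inside_frontier_eq_interior[OF bounded_K convex_K] open_K by (simp add: interior_open)
    then have "winding_number \<gamma> (complex_of_plane x) = winding_number \<gamma> (complex_of_plane p)"
      using \<open>path \<gamma>\<close> \<open>pathfinish \<gamma> = pathstart \<gamma>\<close> p_in_K conn disj by (intro winding_number_eq[of \<gamma> _ "complex_of_plane ` K"]) auto
    then show ?thesis using wn by simp
  qed
  then have "ccw_arclength_parametrization (frontier K) L z"
    unfolding ccw_arclength_parametrization_def \<gamma>_def using bij al per \<sigma>(4) by (auto simp: z_def[abs_def])
  then show ?thesis by blast
qed

end

section \<open>Locality of the affine arclength measure\<close>

lemma arc_length_cong:
  assumes "\<And>x. x \<in> {s..t} \<Longrightarrow> f x = g x"
  shows "arc_length f s t = arc_length g s t"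
  unfolding arc_length_def
proof (intro SUP_cong refl, clarsimp)
  fix n and p :: "nat \<Rightarrow> real" assume p: "mono p" "s = p 0" "t = p n"
  have "f (p i) = g (p i)" if "i \<le> n" for i
    using assms[of "p i"] monoD[OF p(1), of 0 i] monoD[OF p(1), of i n] p that by auto
  then show "ennreal (\<Sum>i<n. dist (f (p i)) (f (p (Suc i)))) = ennreal (\<Sum>i<n. dist (g (p i)) (g (p (Suc i))))"
    by (intro arg_cong[where f=ennreal] sum.cong) auto
qed

lemma AE_lborel_shift:
  assumes "AE x in lborel. P (x :: real)"
  shows "AE x in lborel. P (x + c)"
proof -
  obtain N where N: "N \<in> null_sets lborel" "{x \<in> space lborel. \<not> P x} \<subseteq> N"
    using assms by (auto simp: eventually_ae_filter)
  have "{x. x - (- c) \<in> N} \<in> null_sets lborel" by (rule null_sets_translation[OF N(1)])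
  then show ?thesis by (rule AE_I') (use N(2) in auto)
qed

text \<open>Both curves are seen from the same base point \<open>p\<close>. In \<open>U\<close>,
  where the frontiers coincide, points can therefore be matched by their polar directions.\<close>

locale two_curves =
  c1: tangent_curve K1 p L1 z1 \<theta>1 A1 + c2: tangent_curve K2 p L2 z2 \<theta>2 A2
  for K1 K2 p L1 L2 z1 z2 \<theta>1 \<theta>2 A1 A2 +
  fixes U :: "(real^2) set"
  assumes open_U: "open U" and frontier_U: "frontier K1 \<inter> U = frontier K2 \<inter> U"
begin

lemma same_direction:
  assumes "t \<in> {0..L1}" "\<tau> \<in> {0..L2}" "z1 t = z2 \<tau>"
  shows "dir (\<theta>1 t) = dir (\<theta>2 \<tau>)"
proof -
  obtain r where r: "r > 0" "z1 t = p + r *\<^sub>R dir (\<theta>1 t)" using c1.\<theta>_polar assms by blast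
  obtain r' where r': "r' > 0" "z2 \<tau> = p + r' *\<^sub>R dir (\<theta>2 \<tau>)" using c2.\<theta>_polar assms by blast
  have eq: "r *\<^sub>R dir (\<theta>1 t) = r' *\<^sub>R dir (\<theta>2 \<tau>)" using r r' assms(3) by simp
  then have "r = r'" using r(1) r'(1) by (metis abs_of_pos mult.right_neutral norm_dir norm_scaleR)
  then show ?thesis using eq r(1) by simp
qed

lemma same_point:
  assumes "t \<in> {0..L1}" "\<tau> \<in> {0..L2}" "z1 t \<in> U" "dir (\<theta>1 t) = dir (\<theta>2 \<tau>)"
  shows "z1 t = z2 \<tau>"
proof -
  obtain r where r: "r > 0" "z1 t = p + r *\<^sub>R dir (\<theta>1 t)" using c1.\<theta>_polar assms by blast
  obtain r' where r': "r' > 0" "z2 \<tau> = p + r' *\<^sub>R dir (\<theta>2 \<tau>)" using c2.\<theta>_polar assms by blast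
  have "z1 t \<in> frontier K2" using c1.z_in_frontier[OF assms(1)] frontier_U assms(3) by auto
  then have "r = r'"
    using r r' assms(4) c2.z_in_frontier[OF assms(2)] by (intro c2.frontier_ray_unique[of r "dir (\<theta>1 t)" r']) auto
  then show ?thesis using r r' assms(4) by simp
qed

text \<open>Both polar angles increase, so near a common point the two parametrizations differ by an
  increasing change of parameter; it preserves arc length and is therefore a translation.\<close>

lemma locally_translation:
  assumes t0: "0 < t0" "t0 < L1" and \<tau>0: "0 < \<tau>0" "\<tau>0 < L2" and eq: "z1 t0 = z2 \<tau>0" and U: "z1 t0 \<in> U"
  obtains e where "e > 0" "\<And>u. \<bar>u\<bar> < e \<Longrightarrow> t0 + u \<in> {0<..<L1} \<and> \<tau>0 + u \<in> {0<..<L2} \<and> z1 (t0 + u) = z2 (\<tau>0 + u)"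
proof -
  \<comment> \<open>The two polar angles are determined only up to multiples of
    \<open>2 * pi\<close>; \<open>c\<close> is the multiple by which they differ here.\<close>
  define c where "c = \<theta>2 \<tau>0 - \<theta>1 t0"
  have "dir (\<theta>1 t0) = dir (\<theta>2 \<tau>0)" using t0 \<tau>0 eq by (intro same_direction) auto
  then obtain n :: int where n: "\<theta>1 t0 = \<theta>2 \<tau>0 + 2 * pi * n" using dir_eq_iff by blast
  have dir_c: "dir (x + c) = dir x" for x
    unfolding dir_eq_iff by (rule exI[of _ "- n"]) (simp add: c_def n)
  have mono1: "\<theta>1 s < \<theta>1 t \<longleftrightarrow> s < t" if "s \<in> {0..L1}" "t \<in> {0..L1}" for s t
    using c1.\<theta>_mono that by (simp add: strict_mono_on_less)
  have mono2: "\<theta>2 s < \<theta>2 t \<longleftrightarrow> s < t" if "s \<in> {0..L2}" "t \<in> {0..L2}" for s t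
    using c2.\<theta>_mono that by (simp add: strict_mono_on_less)
  have mono2': "\<theta>2 s \<le> \<theta>2 t \<longleftrightarrow> s \<le> t" if "s \<in> {0..L2}" "t \<in> {0..L2}" for s t
    using mono2[OF that(2,1)] by (simp add: not_less[symmetric])
  have mono1': "\<theta>1 s \<le> \<theta>1 t \<longleftrightarrow> s \<le> t" if "s \<in> {0..L1}" "t \<in> {0..L1}" for s t
    using mono1[OF that(2,1)] by (simp add: not_less[symmetric])
  have "isCont \<theta>1 t0"
    using c1.\<theta>_cont t0 by (intro continuous_on_interior[of "{0..L1}"]) auto
  then have "(\<theta>1 \<longlongrightarrow> \<theta>1 t0) (at t0)" by (simp add: isCont_def)
  moreover have "\<theta>1 t0 + c = \<theta>2 \<tau>0" by (simp add: c_def)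
  then have "\<theta>2 0 - c < \<theta>1 t0" "\<theta>1 t0 < \<theta>2 L2 - c" using mono2[of 0 \<tau>0] mono2[of \<tau>0 L2] \<tau>0 by auto
  ultimately have "\<forall>\<^sub>F t in at t0. \<theta>2 0 - c < \<theta>1 t \<and> \<theta>1 t < \<theta>2 L2 - c"
    by (intro eventually_conj order_tendstoD)
  moreover have "(z1 \<longlongrightarrow> z1 t0) (at t0)"
    using c1.continuous_on_z[of UNIV] by (simp add: continuous_on_eq_continuous_at isCont_def)
  then have "\<forall>\<^sub>F t in at t0. z1 t \<in> U" using open_U U by (rule topological_tendstoD)
  moreover have "\<forall>\<^sub>F t in at t0. t \<in> {0<..<L1}"
    using t0 by (intro eventually_at_in_open') auto
  ultimately have "\<forall>\<^sub>F t in at t0. (\<theta>2 0 - c < \<theta>1 t \<and> \<theta>1 t < \<theta>2 L2 - c) \<and> z1 t \<in> U \<and> t \<in> {0<..<L1}"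
    by eventually_elim blast
  then obtain d where "d > 0" and "\<forall>t\<in>UNIV. t \<noteq> t0 \<and> dist t t0 < d \<longrightarrow>
      (\<theta>2 0 - c < \<theta>1 t \<and> \<theta>1 t < \<theta>2 L2 - c) \<and> z1 t \<in> U \<and> t \<in> {0<..<L1}"
    unfolding eventually_at by (elim exE conjE)
  then have d: "d > 0" "\<And>t. t \<noteq> t0 \<Longrightarrow> dist t t0 < d \<Longrightarrow>
      (\<theta>2 0 - c < \<theta>1 t \<and> \<theta>1 t < \<theta>2 L2 - c) \<and> z1 t \<in> U \<and> t \<in> {0<..<L1}"
    by simp_all
  have I: "\<theta>2 0 < \<theta>1 t + c" "\<theta>1 t + c < \<theta>2 L2" "z1 t \<in> U" "t \<in> {0<..<L1}" if "\<bar>t - t0\<bar> < d" for t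
    using d(2)[of t] that U t0 \<open>\<theta>2 0 - c < \<theta>1 t0\<close> \<open>\<theta>1 t0 < \<theta>2 L2 - c\<close>
    by (cases "t = t0"; auto simp: dist_real_def)+
  have "\<exists>\<tau>\<in>{0<..<L2}. \<theta>2 \<tau> = \<theta>1 t + c" if "\<bar>t - t0\<bar> < d" for t
  proof -
    have "\<exists>\<tau>\<ge>0. \<tau> \<le> L2 \<and> \<theta>2 \<tau> = \<theta>1 t + c"
      using I(1,2)[OF that] c2.\<theta>_cont c2.L_pos by (intro IVT') auto
    then obtain \<tau> where \<tau>: "0 \<le> \<tau>" "\<tau> \<le> L2" "\<theta>2 \<tau> = \<theta>1 t + c" by blast
    moreover have "\<tau> \<noteq> 0" "\<tau> \<noteq> L2" using \<tau>(3) I(1,2)[OF that] by auto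
    ultimately show ?thesis by (intro bexI[of _ \<tau>]) auto
  qed
  then obtain \<phi> where \<phi>: "\<And>t. \<bar>t - t0\<bar> < d \<Longrightarrow> \<phi> t \<in> {0<..<L2} \<and> \<theta>2 (\<phi> t) = \<theta>1 t + c" by metis
  have z\<phi>: "z1 t = z2 (\<phi> t)" if "\<bar>t - t0\<bar> < d" for t
    using I[OF that] \<phi>[OF that] by (intro same_point) (auto simp: dir_c)
  have \<phi>_le: "\<phi> s \<le> \<phi> t" if "\<bar>s - t0\<bar> < d" "\<bar>t - t0\<bar> < d" "s \<le> t" for s t
  proof -
    have "\<theta>2 (\<phi> s) \<le> \<theta>2 (\<phi> t)"
      using mono1'[of s t] I(4)[OF that(1)] I(4)[OF that(2)] \<phi>[OF that(1)] \<phi>[OF that(2)] that(3) by auto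
    then show ?thesis using mono2'[of "\<phi> s" "\<phi> t"] \<phi>[OF that(1)] \<phi>[OF that(2)] by auto
  qed
  have transl: "\<phi> t - \<phi> s = t - s" if st: "\<bar>s - t0\<bar> < d" "\<bar>t - t0\<bar> < d" "s \<le> t" for s t
  proof (rule antisym)
    have btw: "\<bar>x - t0\<bar> < d" if "x \<in> {s..t}" for x using that st by auto
    have "arc_length z1 s t = arc_length (\<lambda>x. z2 (\<phi> x)) s t"
      by (rule arc_length_cong) (use z\<phi> btw in auto)
    also have "\<dots> \<le> arc_length z2 (\<phi> s) (\<phi> t)"
      by (rule arc_length_reparametrize_le[OF _ st(3)]) (use \<phi>_le btw in \<open>auto simp: mono_on_def\<close>)
    finally show "t - s \<le> \<phi> t - \<phi> s"
      using c1.z_arc_length[OF st(3)] c2.z_arc_length[OF \<phi>_le[OF st]] \<phi>_le[OF st] by simp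
    \<comment> \<open>Monotonicity of \<phi> alone gives one inequality of lengths. The other
      requires reading the second curve in terms of the first, so \<phi> is shown to be onto and its
      inverse \<psi> to be monotone.\<close>
    have "\<exists>x\<in>{s..t}. \<phi> x = y" if y: "y \<in> {\<phi> s..\<phi> t}" for y
    proof -
      have y2: "y \<in> {0..L2}" using y \<phi>[OF st(1)] \<phi>[OF st(2)] by auto
      have "\<theta>2 (\<phi> s) \<le> \<theta>2 y" "\<theta>2 y \<le> \<theta>2 (\<phi> t)"
        using mono2'[of "\<phi> s" y] mono2'[of y "\<phi> t"] y y2 \<phi>[OF st(1)] \<phi>[OF st(2)] by auto
      then have "\<theta>1 s \<le> \<theta>2 y - c" "\<theta>2 y - c \<le> \<theta>1 t" using \<phi>[OF st(1)] \<phi>[OF st(2)] by auto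
      moreover have "continuous_on {s..t} \<theta>1"
        using c1.\<theta>_cont I(4)[OF st(1)] I(4)[OF st(2)] by (elim continuous_on_subset) auto
      ultimately have "\<exists>x\<ge>s. x \<le> t \<and> \<theta>1 x = \<theta>2 y - c" using st(3) by (intro IVT') auto
      then obtain x where x: "x \<in> {s..t}" "\<theta>1 x = \<theta>2 y - c" by auto
      then have "\<theta>2 (\<phi> x) = \<theta>2 y" using \<phi>[OF btw[OF x(1)]] by simp
      then have "\<phi> x = y" using mono2'[of "\<phi> x" y] mono2'[of y "\<phi> x"] y2 \<phi>[OF btw[OF x(1)]] by auto
      then show ?thesis using x by blast
    qed
    then obtain \<psi> where \<psi>: "\<And>y. y \<in> {\<phi> s..\<phi> t} \<Longrightarrow> \<psi> y \<in> {s..t} \<and> \<phi> (\<psi> y) = y" by metis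
    have inj\<phi>: "x = x'" if "\<phi> x = \<phi> x'" "x \<in> {s..t}" "x' \<in> {s..t}" for x x'
    proof -
      have "\<theta>1 x = \<theta>1 x'" using \<phi>[OF btw[OF that(2)]] \<phi>[OF btw[OF that(3)]] that(1) by simp
      then show ?thesis using mono1'[of x x'] mono1'[of x' x] I(4)[OF btw[OF that(2)]] I(4)[OF btw[OF that(3)]] by auto
    qed
    have "mono_on {\<phi> s..\<phi> t} \<psi>"
    proof (rule mono_onI, rule ccontr)
      fix y y' assume y: "y \<in> {\<phi> s..\<phi> t}" "y' \<in> {\<phi> s..\<phi> t}" "y \<le> y'" "\<not> \<psi> y \<le> \<psi> y'"
      then have "\<phi> (\<psi> y') \<le> \<phi> (\<psi> y)" using \<psi>[OF y(1)] \<psi>[OF y(2)] btw by (intro \<phi>_le) auto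
      then have "y = y'" using \<psi>[OF y(1)] \<psi>[OF y(2)] y(3) by simp
      then show False using y(4) by simp
    qed
    have "arc_length z2 (\<phi> s) (\<phi> t) = arc_length (\<lambda>y. z1 (\<psi> y)) (\<phi> s) (\<phi> t)"
      by (rule arc_length_cong) (use z\<phi>[OF btw] \<psi> in auto)
    also have "\<dots> \<le> arc_length z1 (\<psi> (\<phi> s)) (\<psi> (\<phi> t))"
      by (rule arc_length_reparametrize_le[OF \<open>mono_on _ \<psi>\<close> \<phi>_le[OF st]])
    also have "\<dots> = arc_length z1 s t"
    proof -
      have \<psi>s: "\<psi> (\<phi> s) \<in> {s..t} \<and> \<phi> (\<psi> (\<phi> s)) = \<phi> s" using \<phi>_le[OF st] by (intro \<psi>) simp
      have \<psi>t: "\<psi> (\<phi> t) \<in> {s..t} \<and> \<phi> (\<psi> (\<phi> t)) = \<phi> t" using \<phi>_le[OF st] by (intro \<psi>) simp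
      have "\<psi> (\<phi> s) = s" by (rule inj\<phi>[OF conjunct2[OF \<psi>s] conjunct1[OF \<psi>s]]) (use st(3) in simp)
      moreover have "\<psi> (\<phi> t) = t" by (rule inj\<phi>[OF conjunct2[OF \<psi>t] conjunct1[OF \<psi>t]]) (use st(3) in simp)
      ultimately show ?thesis by simp
    qed
    finally show "\<phi> t - \<phi> s \<le> t - s"
      using c1.z_arc_length[OF st(3)] c2.z_arc_length[OF \<phi>_le[OF st]] st(3) by simp
  qed
  have "\<phi> t0 = \<tau>0"
  proof -
    have "\<theta>2 (\<phi> t0) = \<theta>2 \<tau>0" "\<phi> t0 \<in> {0<..<L2}" using \<phi>[of t0] d(1) by (auto simp: c_def)
    then show ?thesis using mono2'[of "\<phi> t0" \<tau>0] mono2'[of \<tau>0 "\<phi> t0"] \<tau>0 by auto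
  qed
  have shift: "\<phi> (t0 + u) = \<tau>0 + u" if "\<bar>u\<bar> < d" for u
    using transl[of t0 "t0 + u"] transl[of "t0 + u" t0] that d(1) \<open>\<phi> t0 = \<tau>0\<close> by (cases "u \<ge> 0") auto
  show ?thesis
  proof (rule that[OF d(1)])
    fix u assume u: "\<bar>u\<bar> < d"
    then have "\<bar>(t0 + u) - t0\<bar> < d" by simp
    from I(4)[OF this] \<phi>[OF this] z\<phi>[OF this] show "t0 + u \<in> {0<..<L1} \<and> \<tau>0 + u \<in> {0<..<L2} \<and> z1 (t0 + u) = z2 (\<tau>0 + u)"
      unfolding shift[OF u] by blast
  qed
qed

lemma dir_\<alpha>_shift:
  assumes x: "0 < x" "x < L1" "0 < x + c" "x + c < L2" and "e > 0"
    and eq: "\<And>y. \<bar>y - x\<bar> < e \<Longrightarrow> z1 y = z2 (y + c)"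
  shows "dir (c1.\<alpha> x) = dir (c2.\<alpha> (x + c))"
proof -
  have "(z2 has_vector_derivative dir (c2.\<alpha> (x + c))) (at_right (x + c))"
    using x by (intro c2.z_right_derivative) auto
  moreover have "(\<lambda>y. y + c) ` {x<..} = {x + c<..}"
    by (auto simp: image_iff intro!: bexI[of _ "_ - c"])
  ultimately have "(z2 \<circ> (\<lambda>y. y + c) has_vector_derivative 1 *\<^sub>R dir (c2.\<alpha> (x + c))) (at_right x)"
    by (intro vector_diff_chain_within) (auto intro!: derivative_eq_intros)
  moreover have "\<forall>\<^sub>F y in nhds x. y \<in> {x<..} \<longrightarrow> z1 y = (z2 \<circ> (\<lambda>y. y + c)) y"
    unfolding eventually_nhds_metric using eq \<open>e > 0\<close> by (intro exI[of _ e]) (auto simp: dist_real_def)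
  moreover have "z1 x = (z2 \<circ> (\<lambda>y. y + c)) x" using eq[of x] \<open>e > 0\<close> by simp
  ultimately have "(z1 has_vector_derivative dir (c2.\<alpha> (x + c))) (at_right x)"
    using has_vector_derivative_cong_ev[of "{x<..}" z1 "z2 \<circ> (\<lambda>y. y + c)" x] by simp
  then have "right_derivative z1 x = dir (c2.\<alpha> (x + c))"
    unfolding right_derivative_def by (intro vector_derivative_within) auto
  then show ?thesis using c1.right_derivative_z[of x] x by simp
qed

text \<open>Equal right derivatives determine the tangent angles only up to multiples of
  \<open>2 * pi\<close>, so the derivatives of \<open>dir \<circ> \<alpha>\<close> are compared; the
  cross product with the tangent recovers \<open>D1\<close> and \<open>D2\<close>.\<close>

lemma density_shift:
  assumes x: "0 < x" "x < L1" "0 < x + c" "x + c < L2" and "e > 0"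
    and eq: "\<And>y. \<bar>y - x\<bar> < e \<Longrightarrow> 0 < y \<and> y < L1 \<and> 0 < y + c \<and> y + c < L2 \<and> z1 y = z2 (y + c)"
    and D1: "(c1.\<alpha> has_real_derivative D1) (at x)" and D2: "(c2.\<alpha> has_real_derivative D2) (at (x + c))"
  shows "D1 = D2"
proof -
  have dir_eq: "dir (c1.\<alpha> y) = dir (c2.\<alpha> (y + c))" if "\<bar>y - x\<bar> < e" for y
  proof (rule dir_\<alpha>_shift[where e="e - \<bar>y - x\<bar>"])
    fix y' assume "\<bar>y' - y\<bar> < e - \<bar>y - x\<bar>"
    then have "\<bar>y' - x\<bar> < e" by linarith
    then show "z1 y' = z2 (y' + c)" using eq by blast
  qed (use eq[OF that] that in auto)
  have 1: "(dir \<circ> c1.\<alpha> has_vector_derivative D1 *\<^sub>R dir (c1.\<alpha> x + pi / 2)) (at x)"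
    using D1 by (intro vector_diff_chain_at[OF _ dir_has_vector_derivative]) (simp add: has_real_derivative_iff_has_vector_derivative)
  have "(dir \<circ> c2.\<alpha> has_vector_derivative D2 *\<^sub>R dir (c2.\<alpha> (x + c) + pi / 2)) (at (x + c))"
    using D2 by (intro vector_diff_chain_at[OF _ dir_has_vector_derivative]) (simp add: has_real_derivative_iff_has_vector_derivative)
  then have "((dir \<circ> c2.\<alpha>) \<circ> (\<lambda>y. y + c) has_vector_derivative 1 *\<^sub>R (D2 *\<^sub>R dir (c2.\<alpha> (x + c) + pi / 2))) (at x)"
    by (rule vector_diff_chain_at[rotated]) (auto intro!: derivative_eq_intros)
  then have "(dir \<circ> c1.\<alpha> has_vector_derivative D2 *\<^sub>R dir (c2.\<alpha> (x + c) + pi / 2)) (at x)"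
    unfolding has_vector_derivative_def scaleR_one
    by (rule has_derivative_transform_within[OF _ \<open>e > 0\<close>]) (use dir_eq in \<open>auto simp: dist_real_def\<close>)
  with 1 have "D1 *\<^sub>R dir (c1.\<alpha> x + pi / 2) = D2 *\<^sub>R dir (c2.\<alpha> (x + c) + pi / 2)"
    by (rule vector_derivative_unique_at)
  then have "cross2 (dir (c1.\<alpha> x)) (D1 *\<^sub>R dir (c1.\<alpha> x + pi / 2))
      = cross2 (dir (c2.\<alpha> (x + c))) (D2 *\<^sub>R dir (c2.\<alpha> (x + c) + pi / 2))"
    using dir_eq[of x] \<open>e > 0\<close> by simp
  then show ?thesis by (simp add: cross2_simps cross2_dir_dir)
qed

abbreviation "\<nu>1 \<equiv> param_affine_arclength L1 z1"
abbreviation "\<nu>2 \<equiv> param_affine_arclength L2 z2"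

end

lemma sets_param_affine_arclength [simp, measurable_cong]: "sets (param_affine_arclength L z) = sets borel"
  by (simp add: param_affine_arclength_def)

context tangent_curve
begin

text \<open>The parameters at distance at least \<open>e\<close> from \<open>t0\<close> form a
  compact set, whose image is closed and, by injectivity, misses \<open>z t0\<close>.\<close>

lemma z_neighbourhood:
  assumes "0 < t0" "t0 < L" "e > 0"
  obtains B where "open B" "z t0 \<in> B" "\<And>t. t \<in> {0..L} \<Longrightarrow> z t \<in> B \<Longrightarrow> \<bar>t - t0\<bar> < e"
proof
  let ?C = "z ` ({0..L} - {t0 - e<..<t0 + e})"
  have "compact ({0..L} - {t0 - e<..<t0 + e})" by (intro compact_diff) auto
  then have "compact ?C" by (rule compact_continuous_image[OF continuous_on_z])
  then show "open (- ?C)" by (intro open_Compl compact_imp_closed)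
  show "z t0 \<in> - ?C"
  proof
    assume "z t0 \<in> ?C"
    then obtain t where t: "t \<in> {0..L}" "t \<notin> {t0 - e<..<t0 + e}" "z t0 = z t" by auto
    \<comment> \<open>The parameter \<open>L\<close> names the same point as \<open>0\<close> and is
      moved there, since injectivity holds on \<open>{0..<L}\<close>.\<close>
    define t' where "t' = (if t = L then 0 else t)"
    have "z t0 = z t'" "t' \<in> {0..<L}" using t z_L L_pos by (auto simp: t'_def)
    then have "t0 = t'" using z_bij assms by (auto simp: bij_betw_def inj_on_def)
    then show False using t assms by (auto simp: t'_def split: if_splits)
  qed
  show "\<bar>t - t0\<bar> < e" if "t \<in> {0..L}" "z t \<in> - ?C" for t
    using that by (auto simp: abs_less_iff)
qed

lemma emeasure_param_disjoint_frontier: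
  assumes "E \<in> sets borel" "E \<inter> frontier K = {}"
  shows "emeasure (param_affine_arclength L z) E = 0"
proof -
  have "(\<integral>\<^sup>+t\<in>{0..L}. \<kappa> t * indicator E (z t) \<partial>lborel) = (\<integral>\<^sup>+t. 0 \<partial>(lborel :: real measure))"
    using z_in_frontier assms(2) by (intro nn_integral_cong) (auto simp: indicator_def)
  then show ?thesis using emeasure_param_affine_arclength[OF assms(1)] by simp
qed

lemma emeasure_param_singleton: "emeasure (param_affine_arclength L z) {x} = 0"
proof (cases "x \<in> frontier K")
  case True
  then have "x \<in> z ` {0..<L}" using z_bij by (simp add: bij_betw_def)
  then obtain t0 where t0: "t0 \<in> {0..<L}" "x = z t0" by blast
  have "(\<integral>\<^sup>+t\<in>{0..L}. \<kappa> t * indicator {x} (z t) \<partial>lborel) = (\<integral>\<^sup>+t. 0 \<partial>(lborel :: real measure))"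
    using AE_lborel_singleton[of t0] AE_lborel_singleton[of L]
  proof (intro nn_integral_cong_AE, eventually_elim)
    case (elim t)
    then have "z t \<noteq> x" if "t \<in> {0..L}"
      using that t0 z_bij by (auto simp: bij_betw_def inj_on_def)
    then show ?case by (auto simp: indicator_def)
  qed
  then show ?thesis using emeasure_param_affine_arclength[of "{x}"] by simp
qed (auto intro: emeasure_param_disjoint_frontier)

end

context two_curves
begin

text \<open>The starting points are excluded because the comparison by a translation is made at
  interior parameters of both curves.\<close>

lemma locally_equal:
  assumes "x \<in> U" "x \<noteq> z1 0" "x \<noteq> z2 0"
  shows "\<exists>B. open B \<and> x \<in> B \<and> (\<forall>E\<in>sets borel. E \<subseteq> B \<longrightarrow> emeasure \<nu>1 E = emeasure \<nu>2 E)"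
proof (cases "x \<in> frontier K1")
  case False
  have "emeasure \<nu>1 E = emeasure \<nu>2 E" if "E \<in> sets borel" "E \<subseteq> U - frontier K1" for E
  proof -
    have "E \<inter> frontier K1 = {}" "E \<inter> frontier K2 = {}" using that frontier_U by auto
    then show ?thesis
      using c1.emeasure_param_disjoint_frontier c2.emeasure_param_disjoint_frontier that(1) by simp
  qed
  then show ?thesis
    using assms False open_U by (intro exI[of _ "U - frontier K1"]) (auto intro: open_Diff)
next
  case True
  have "x \<in> z1 ` {0..<L1}" using True c1.z_bij by (simp add: bij_betw_def)
  then obtain t0 where t0: "t0 \<in> {0..<L1}" "x = z1 t0" by blast
  have "x \<in> frontier K2" using True assms(1) frontier_U by auto
  then have "x \<in> z2 ` {0..<L2}" using c2.z_bij by (simp add: bij_betw_def)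
  then obtain \<tau>0 where \<tau>0: "\<tau>0 \<in> {0..<L2}" "x = z2 \<tau>0" by blast
  have pos: "0 < t0" "t0 < L1" "0 < \<tau>0" "\<tau>0 < L2"
    using t0 \<tau>0 assms(2,3) by (auto simp: less_le)
  have eq0: "z1 t0 = z2 \<tau>0" "z1 t0 \<in> U" using t0 \<tau>0 assms by auto
  obtain e where e: "e > 0" "\<And>u. \<bar>u\<bar> < e \<Longrightarrow> t0 + u \<in> {0<..<L1} \<and> \<tau>0 + u \<in> {0<..<L2} \<and> z1 (t0 + u) = z2 (\<tau>0 + u)"
    using locally_translation[OF pos eq0] by metis
  define c where "c = \<tau>0 - t0"
  have near: "0 < y \<and> y < L1 \<and> 0 < y + c \<and> y + c < L2 \<and> z1 y = z2 (y + c)" if "\<bar>y - t0\<bar> < e" for y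
    using e(2)[OF that] by (simp add: c_def algebra_simps)
  have \<kappa>: "AE t in lborel. \<bar>t - t0\<bar> < e \<longrightarrow> c1.\<kappa> t = c2.\<kappa> (t + c)"
    using c1.\<alpha>.AE_density_part AE_lborel_shift[OF c2.\<alpha>.AE_density_part, of c]
  proof eventually_elim
    case (elim t)
    show ?case
    proof
      assume t: "\<bar>t - t0\<bar> < e"
      have "c1.\<alpha>.density_part t = c2.\<alpha>.density_part (t + c)"
      proof (rule density_shift[where e="e - \<bar>t - t0\<bar>"])
        fix y assume "\<bar>y - t\<bar> < e - \<bar>t - t0\<bar>"
        then have "\<bar>y - t0\<bar> < e" by linarith
        then show "0 < y \<and> y < L1 \<and> 0 < y + c \<and> y + c < L2 \<and> z1 y = z2 (y + c)" by (rule near)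
      qed (use near[OF t] t elim in auto)
      then show "c1.\<kappa> t = c2.\<kappa> (t + c)" by simp
    qed
  qed
  \<comment> \<open>Inside \<open>B1 \<inter> B2\<close> both integrals receive contributions only
    from parameters at which the translation identity holds.\<close>
  obtain B1 where B1: "open B1" "z1 t0 \<in> B1" "\<And>t. t \<in> {0..L1} \<Longrightarrow> z1 t \<in> B1 \<Longrightarrow> \<bar>t - t0\<bar> < e"
    using c1.z_neighbourhood[OF pos(1,2) e(1)] by metis
  obtain B2 where B2: "open B2" "z2 \<tau>0 \<in> B2" "\<And>t. t \<in> {0..L2} \<Longrightarrow> z2 t \<in> B2 \<Longrightarrow> \<bar>t - \<tau>0\<bar> < e"
    using c2.z_neighbourhood[OF pos(3,4) e(1)] by metis
  have "emeasure \<nu>1 E = emeasure \<nu>2 E" if E [measurable]: "E \<in> sets borel" and "E \<subseteq> B1 \<inter> B2" for E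
  proof -
    have "emeasure \<nu>1 E = (\<integral>\<^sup>+t\<in>{0..L1}. c1.\<kappa> t * indicator E (z1 t) \<partial>lborel)"
      by (rule c1.emeasure_param_affine_arclength[OF E])
    also have "\<dots> = (\<integral>\<^sup>+t. c2.\<kappa> (c + 1 * t) * indicator E (z2 (c + 1 * t)) * indicator {0..L2} (c + 1 * t) \<partial>lborel)"
      using \<kappa>
    proof (intro nn_integral_cong_AE, eventually_elim)
      case (elim t)
      show ?case
      proof (cases "\<bar>t - t0\<bar> < e")
        case True
        then show ?thesis using near[OF True] elim by (simp add: add.commute indicator_def)
      next
        case False
        then have "\<not> (t \<in> {0..L1} \<and> z1 t \<in> E)" using B1(3) \<open>E \<subseteq> _\<close> by blast
        moreover have "\<not> (c + t \<in> {0..L2} \<and> z2 (c + t) \<in> E)"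
        proof
          assume "c + t \<in> {0..L2} \<and> z2 (c + t) \<in> E"
          then have "\<bar>c + t - \<tau>0\<bar> < e" using B2(3) \<open>E \<subseteq> _\<close> by blast
          then show False using False by (simp add: c_def)
        qed
        ultimately show ?thesis by (auto simp: indicator_def)
      qed
    qed
    also have "\<dots> = (\<integral>\<^sup>+t\<in>{0..L2}. c2.\<kappa> t * indicator E (z2 t) \<partial>lborel)"
      by (subst nn_integral_real_affine[where c=1 and t=c and f="\<lambda>t. c2.\<kappa> t * indicator E (z2 t) * indicator {0..L2} t"]) auto
    also have "\<dots> = emeasure \<nu>2 E"
      by (rule c2.emeasure_param_affine_arclength[OF E, symmetric])
    finally show ?thesis .
  qed
  then show ?thesis
    using B1 B2 t0 \<tau>0 by (intro exI[of _ "B1 \<inter> B2"]) auto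
qed

text \<open>By Lindelof, countably many of the sets on which the measures agree cover
  \<open>E\<close> except for the two starting points, which are null for both measures; disjoint
  pieces then add up.\<close>

lemma emeasure_eq:
  assumes E: "E \<in> sets borel" "E \<subseteq> U"
  shows "emeasure \<nu>1 E = emeasure \<nu>2 E"
proof -
  define good where "good = {B :: (real^2) set. open B \<and> (\<forall>E\<in>sets borel. E \<subseteq> B \<longrightarrow> emeasure \<nu>1 E = emeasure \<nu>2 E)}"
  have "\<And>S. S \<in> good \<Longrightarrow> open S" by (simp add: good_def)
  then obtain \<F> where \<F>: "\<F> \<subseteq> good" "countable \<F>" "\<Union>\<F> = \<Union>good" using Lindelof by metis
  \<comment> \<open>Inserting the empty set makes the family nonempty, as enumerating it by the
    natural numbers requires.\<close>
  define B where "B = from_nat_into (insert {} \<F>)"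
  have rB: "range B = insert {} \<F>" unfolding B_def using \<F>(2) by (intro range_from_nat_into) auto
  have "{} \<in> good" by (simp add: good_def)
  then have good_B: "B n \<in> good" for n using rangeI[of B n] \<F>(1) unfolding rB by auto
  have B_sets: "B n \<in> sets borel" for n using good_B[of n] by (simp add: good_def)
  have sub: "E - {z1 0, z2 0} \<subseteq> (\<Union>n. B n)"
  proof
    fix x assume x: "x \<in> E - {z1 0, z2 0}"
    then obtain G where "open G" "x \<in> G" "\<forall>E\<in>sets borel. E \<subseteq> G \<longrightarrow> emeasure \<nu>1 E = emeasure \<nu>2 E"
      using locally_equal[of x] E(2) by auto
    then have "x \<in> \<Union>good" unfolding good_def by blast
    then have "x \<in> \<Union>(insert {} \<F>)" using \<F>(3) by simp
    then show "x \<in> (\<Union>n. B n)" unfolding rB[symmetric] .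
  qed
  define D where "D n = (E - {z1 0, z2 0}) \<inter> disjointed B n" for n
  have D_sets: "D n \<in> sets borel" for n
    unfolding D_def using sets.range_disjointed_sets[of B borel] B_sets E(1) by (intro sets.Int sets.Diff) auto
  have D_disj: "disjoint_family D"
    unfolding D_def using disjoint_family_disjointed[of B] by (auto simp: disjoint_family_on_def)
  have D_UN: "(\<Union>n. D n) = E - {z1 0, z2 0}"
    unfolding D_def using sub UN_disjointed_eq[of B] by auto
  have D_eq: "emeasure \<nu>1 (D n) = emeasure \<nu>2 (D n)" for n
  proof -
    have "D n \<subseteq> B n" unfolding D_def using disjointed_subset[of B n] by auto
    then show ?thesis using good_B[of n] D_sets[of n] by (simp add: good_def)
  qed
  have null: "{z1 0, z2 0} \<in> null_sets \<nu>1" "{z1 0, z2 0} \<in> null_sets \<nu>2"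
  proof -
    have "{z1 0} \<union> {z2 0} \<in> null_sets \<nu>1"
      by (intro null_sets.Un) (auto simp: null_sets_def c1.emeasure_param_singleton)
    then show "{z1 0, z2 0} \<in> null_sets \<nu>1" by (simp add: insert_commute)
    have "{z1 0} \<union> {z2 0} \<in> null_sets \<nu>2"
      by (intro null_sets.Un) (auto simp: null_sets_def c2.emeasure_param_singleton)
    then show "{z1 0, z2 0} \<in> null_sets \<nu>2" by (simp add: insert_commute)
  qed
  have "emeasure \<nu>1 E = emeasure \<nu>1 (\<Union>n. D n)"
    unfolding D_UN by (rule emeasure_Diff_null_set[OF null(1), symmetric]) (use E in simp)
  also have "\<dots> = (\<Sum>n. emeasure \<nu>1 (D n))"
    by (rule suminf_emeasure[symmetric]) (use D_sets D_disj in auto)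
  also have "\<dots> = (\<Sum>n. emeasure \<nu>2 (D n))" by (simp add: D_eq)
  also have "\<dots> = emeasure \<nu>2 (\<Union>n. D n)"
    by (rule suminf_emeasure) (use D_sets D_disj in auto)
  also have "\<dots> = emeasure \<nu>2 E"
    unfolding D_UN by (rule emeasure_Diff_null_set[OF null(2)]) (use E in simp)
  finally show ?thesis .
qed

end

section \<open>Comparison of the two measures\<close>

text \<open>Links the parametrization selected by choice to the locale, whose results hold for every
  counterclockwise arclength parametrization.\<close>

lemma (in convex_region) compact_affine_arclength_eq:
  "\<exists>L z \<theta> A. tangent_curve K p L z \<theta> A \<and> compact_affine_arclength (frontier K) = param_affine_arclength L z"
proof -
  define Lz where "Lz = (SOME (L, z). ccw_arclength_parametrization (frontier K) L z)"
  obtain L z where Lz: "Lz = (L, z)" by (cases Lz)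
  have "\<exists>Lz. case Lz of (L, z) \<Rightarrow> ccw_arclength_parametrization (frontier K) L z"
    using ccw_arclength_parametrization_exists by auto
  then have "case Lz of (L, z) \<Rightarrow> ccw_arclength_parametrization (frontier K) L z"
    unfolding Lz_def by (rule someI_ex)
  then have "ccw_arclength_parametrization (frontier K) L z" by (simp add: Lz)
  then interpret convex_param K p L z by unfold_locales
  have "compact_affine_arclength (frontier K) = param_affine_arclength L z"
    unfolding compact_affine_arclength_def Lz_def[symmetric] by (simp add: Lz)
  then show ?thesis using tangent_curve_exists by blast
qed

lemma compact_affine_arclength_bounds:
  assumes "convex_region K p" and E: "E \<in> sets borel" "E \<subseteq> frontier K"
  shows "ennreal (1 / 39) * emeasure (compact_affine_arclength (frontier K)) E \<le> affine_outer_measure E"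
    and "affine_outer_measure E \<le> ennreal (root 3 4) * emeasure (compact_affine_arclength (frontier K)) E"
proof -
  obtain L z \<theta> A where "tangent_curve K p L z \<theta> A"
    and eq: "compact_affine_arclength (frontier K) = param_affine_arclength L z"
    using convex_region.compact_affine_arclength_eq[OF assms(1)] by blast
  interpret tangent_curve K p L z \<theta> A by fact
  show "ennreal (1 / 39) * emeasure (compact_affine_arclength (frontier K)) E \<le> affine_outer_measure E"
    unfolding eq by (rule affine_outer_measure_ge[OF E(1)])
  show "affine_outer_measure E \<le> ennreal (root 3 4) * emeasure (compact_affine_arclength (frontier K)) E"
    unfolding eq by (rule affine_outer_measure_le[OF E])
qed

lemma sets_compact_affine_arclength [simp]: "sets (compact_affine_arclength \<Gamma>) = sets borel"
  by (simp add: compact_affine_arclength_def split: prod.split)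

lemma compact_affine_arclength_local:
  assumes "convex_region K1 p" "convex_region K2 p" "open U" "frontier K1 \<inter> U = frontier K2 \<inter> U"
    and E: "E \<in> sets borel" "E \<subseteq> U"
  shows "emeasure (compact_affine_arclength (frontier K1)) E = emeasure (compact_affine_arclength (frontier K2)) E"
proof -
  obtain L1 z1 \<theta>1 A1 where 1: "tangent_curve K1 p L1 z1 \<theta>1 A1"
    and eq1: "compact_affine_arclength (frontier K1) = param_affine_arclength L1 z1"
    using convex_region.compact_affine_arclength_eq[OF assms(1)] by blast
  obtain L2 z2 \<theta>2 A2 where 2: "tangent_curve K2 p L2 z2 \<theta>2 A2"
    and eq2: "compact_affine_arclength (frontier K2) = param_affine_arclength L2 z2"
    using convex_region.compact_affine_arclength_eq[OF assms(2)] by blast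
  interpret two_curves K1 K2 p L1 L2 z1 z2 \<theta>1 \<theta>2 A1 A2 U
    using 1 2 assms(3,4) unfolding two_curves_def two_curves_axioms_def by blast
  show ?thesis unfolding eq1 eq2 by (rule emeasure_eq[OF E])
qed

lemma frontier_Int_open_eq:
  assumes "open B"
  shows "frontier (K \<inter> B) \<inter> B = frontier K \<inter> B"
proof -
  have "closure (K \<inter> B) \<inter> B = closure K \<inter> B"
    using open_Int_closure_subset[OF assms, of K] closure_mono[of "K \<inter> B" K] by (auto simp: Int_commute)
  moreover have "interior (K \<inter> B) \<inter> B = interior K \<inter> B"
    using assms by (simp add: interior_Int interior_open)
  ultimately show ?thesis unfolding frontier_def by blast
qed

lemma open_square_mono: "N \<le> M \<Longrightarrow> open_square N \<subseteq> open_square M"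
  by (auto simp: mem_box_cart) (meson le_less_trans less_le_trans neg_le_iff_le of_nat_mono)+

lemma in_open_square: "\<exists>N. x \<in> open_square N"
proof -
  obtain N :: nat where "norm x < real N" using reals_Archimedean2 by blast
  then have "- real N < x $ i \<and> x $ i < real N" for i
    using component_le_norm_cart[of x i] by (auto simp: abs_le_iff)
  then have "x \<in> open_square N" by (simp add: mem_box_cart)
  then show ?thesis by blast
qed

section \<open>Unbounded sets and their truncations\<close>

locale unbounded_convex_region =
  \<comment> \<open>From \<open>N0\<close> on every open square contains \<open>p\<close>, so all
    truncations share one base point and can be compared as \<open>two_curves\<close>.\<close>
  fixes K :: "(real^2) set" and p :: "real^2" and N0 :: nat
  assumes open_K: "open K" and convex_K: "convex K" and p_in_K: "p \<in> K" and p_in_square: "p \<in> open_square N0"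
begin

definition C :: "nat \<Rightarrow> (real^2) set" where "C n = K \<inter> open_square (N0 + n)"

lemma region_C: "convex_region (C n) p"
  unfolding C_def
proof
  show "open (K \<inter> open_square (N0 + n))" by (intro open_Int open_K open_box)
  show "convex (K \<inter> open_square (N0 + n))" by (intro convex_Int convex_K convex_box)
  show "bounded (K \<inter> open_square (N0 + n))" by (intro bounded_Int) simp
  show "p \<in> K \<inter> open_square (N0 + n)" using p_in_K p_in_square open_square_mono[of N0 "N0 + n"] by auto
qed

text \<open>\<nu> is defined by cutting with closed squares, whereas \<open>convex_region\<close>
  asks for open sets. A convex set with nonempty interior has the same closure as its interior, so
  the frontiers agree.\<close>

lemma frontier_closed_square: "frontier (K \<inter> closed_square (N0 + n)) = frontier (C n)"
proof -
  have int: "interior (K \<inter> closed_square (N0 + n)) = C n"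
    using open_K by (simp add: C_def interior_Int interior_open interior_cbox)
  have "convex (K \<inter> closed_square (N0 + n))" by (intro convex_Int convex_K convex_box)
  moreover have "interior (K \<inter> closed_square (N0 + n)) \<noteq> {}"
    unfolding int using convex_region.p_in_K[OF region_C] by blast
  ultimately have "closure (C n) = closure (K \<inter> closed_square (N0 + n))"
    unfolding int[symmetric] by (rule convex_closure_interior)
  then show ?thesis
    unfolding frontier_def int using convex_region.open_K[OF region_C] by (simp add: interior_open)
qed

definition \<nu> :: "nat \<Rightarrow> (real^2) measure" where
  "\<nu> n = compact_affine_arclength (frontier (C n))"

definition m :: "nat \<Rightarrow> (real^2) set \<Rightarrow> ennreal" where
  "m n E = emeasure (\<nu> n) (E \<inter> open_square (N0 + n))"

lemma square_sets [simp]: "E \<in> sets borel \<Longrightarrow> E \<inter> open_square N \<in> sets borel"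
  by (intro sets.Int) auto

text \<open>Within the smaller open square both truncations have the frontier of \<open>K\<close>,
  so their measures agree there by locality; the larger square can only add mass.\<close>

lemma m_incseq:
  assumes "E \<in> sets borel"
  shows "incseq (\<lambda>n. m n E)"
proof (rule incseq_SucI)
  fix n
  let ?U = "open_square (N0 + n)"
  have sub: "?U \<subseteq> open_square (N0 + Suc n)" by (rule open_square_mono) simp
  have "frontier (C n) \<inter> ?U = frontier K \<inter> ?U"
    unfolding C_def by (rule frontier_Int_open_eq[OF open_box])
  moreover have "frontier (C (Suc n)) \<inter> open_square (N0 + Suc n) = frontier K \<inter> open_square (N0 + Suc n)"
    unfolding C_def by (rule frontier_Int_open_eq[OF open_box])
  ultimately have "frontier (C n) \<inter> ?U = frontier (C (Suc n)) \<inter> ?U" using sub by blast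
  then have "m n E = emeasure (\<nu> (Suc n)) (E \<inter> ?U)"
    unfolding m_def \<nu>_def using assms
    by (intro compact_affine_arclength_local[OF region_C region_C open_box _ square_sets]) auto
  also have "\<dots> \<le> m (Suc n) E"
    unfolding m_def
  proof (rule emeasure_mono)
    show "E \<inter> ?U \<subseteq> E \<inter> open_square (N0 + Suc n)" using sub by blast
    show "E \<inter> open_square (N0 + Suc n) \<in> sets (\<nu> (Suc n))" unfolding \<nu>_def sets_compact_affine_arclength by (rule square_sets[OF assms])
  qed
  finally show "m n E \<le> m (Suc n) E" .
qed

text \<open>\<open>measure_of\<close> returns the prescribed set function only if it is countably
  additive. Monotonicity in \<open>n\<close> turns the limit into a supremum, which commutes with
  countable sums.\<close>

lemma emeasure_limit:
  assumes E: "E \<in> sets borel"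
  shows "emeasure (measure_of UNIV (sets borel)
        (\<lambda>E. lim (\<lambda>N. emeasure (compact_affine_arclength (frontier (K \<inter> closed_square N))) (E \<inter> open_square N)))) E
      = (SUP n. m n E)"
proof -
  let ?f = "\<lambda>E. lim (\<lambda>N. emeasure (compact_affine_arclength (frontier (K \<inter> closed_square N))) (E \<inter> open_square N))"
  have f: "?f E = (SUP n. m n E)" if "E \<in> sets borel" for E
  proof (rule limI)
    have "(\<lambda>n. m n E) \<longlonglongrightarrow> (SUP n. m n E)" by (rule LIMSEQ_SUP[OF m_incseq[OF that]])
    then have "(\<lambda>n. emeasure (compact_affine_arclength (frontier (K \<inter> closed_square (n + N0)))) (E \<inter> open_square (n + N0)))
        \<longlonglongrightarrow> (SUP n. m n E)"
      by (simp add: m_def \<nu>_def frontier_closed_square add.commute[of _ N0] del: of_nat_add)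
    then show "(\<lambda>N. emeasure (compact_affine_arclength (frontier (K \<inter> closed_square N))) (E \<inter> open_square N)) \<longlonglongrightarrow> (SUP n. m n E)"
      by (rule LIMSEQ_offset)
  qed
  have "emeasure (measure_of UNIV (sets borel) ?f) E = ?f E"
  proof (rule emeasure_measure_of_sigma)
    show "sigma_algebra UNIV (sets (borel :: (real^2) measure))"
      using sets.sigma_algebra_axioms[of "borel :: (real^2) measure"] by simp
    show "positive (sets borel) ?f" by (simp add: positive_def f m_def)
    show "countably_additive (sets borel) ?f"
    proof (rule countably_additiveI)
      fix F :: "nat \<Rightarrow> (real^2) set" assume F: "range F \<subseteq> sets borel" "disjoint_family F" "(\<Union>i. F i) \<in> sets borel"
      have Fi: "F i \<in> sets borel" for i using F(1) by auto
      have "(\<Sum>i. ?f (F i)) = (\<Sum>i. SUP n. m n (F i))" using Fi by (simp add: f)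
      also have "\<dots> = (SUP n. \<Sum>i. m n (F i))"
        by (rule ennreal_suminf_SUP_eq) (rule m_incseq[OF Fi])
      also have "\<dots> = (SUP n. m n (\<Union>i. F i))"
      proof (rule SUP_cong[OF refl])
        fix n
        have "(\<Sum>i. m n (F i)) = emeasure (\<nu> n) (\<Union>i. F i \<inter> open_square (N0 + n))"
          unfolding m_def
        proof (rule suminf_emeasure)
          show "range (\<lambda>i. F i \<inter> open_square (N0 + n)) \<subseteq> sets (\<nu> n)" using Fi by (auto simp: \<nu>_def)
          show "disjoint_family (\<lambda>i. F i \<inter> open_square (N0 + n))"
            using F(2) by (auto simp: disjoint_family_on_def)
        qed
        then show "(\<Sum>i. m n (F i)) = m n (\<Union>i. F i)" by (simp add: m_def)
      qed
      also have "\<dots> = ?f (\<Union>i. F i)" using F(3) by (simp only: f)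
      finally show "(\<Sum>i. ?f (F i)) = ?f (\<Union>i. F i)" .
    qed
  qed (rule E)
  then show ?thesis by (simp only: f[OF E])
qed

text \<open>Exhaustion by squares is continuity from below, which holds because Borel sets are
  Caratheodory measurable and the outer measure is a measure on them.\<close>

lemma affine_outer_measure_eq_SUP_squares:
  assumes E: "E \<in> sets borel"
  shows "affine_outer_measure E = (SUP n. affine_outer_measure (E \<inter> open_square (N0 + n)))"
proof -
  have UN: "(\<Union>n. E \<inter> open_square (N0 + n)) = E"
  proof -
    have "\<exists>n. x \<in> open_square (N0 + n)" for x
    proof -
      obtain N where "x \<in> open_square N" using in_open_square by blast
      then have "x \<in> open_square (N0 + N)" using open_square_mono[of N "N0 + N"] by (simp only: le_add2) blast
      then show ?thesis by blast
    qed
    then show ?thesis by blast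
  qed
  have "(SUP n. emeasure affine_measure (E \<inter> open_square (N0 + n))) = emeasure affine_measure (\<Union>n. E \<inter> open_square (N0 + n))"
  proof (rule SUP_emeasure_incseq)
    show "range (\<lambda>n. E \<inter> open_square (N0 + n)) \<subseteq> sets affine_measure"
      using square_sets[OF E] sets_borel_subset_affine_measure by blast
    show "incseq (\<lambda>n. E \<inter> open_square (N0 + n))"
    proof (rule incseq_SucI)
      fix n
      show "E \<inter> open_square (N0 + n) \<subseteq> E \<inter> open_square (N0 + Suc n)"
        by (intro Int_mono order_refl open_square_mono) simp
    qed
  qed
  then show ?thesis
    unfolding UN by (simp only: emeasure_affine_measure[OF E] emeasure_affine_measure[OF square_sets[OF E]])
qed

lemma bounds:
  assumes E: "E \<in> sets borel" "E \<subseteq> frontier K"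
  shows "ennreal (1 / 39) * (SUP n. m n E) \<le> affine_outer_measure E"
    and "affine_outer_measure E \<le> ennreal (root 3 4) * (SUP n. m n E)"
proof -
  have n: "ennreal (1 / 39) * m n E \<le> affine_outer_measure (E \<inter> open_square (N0 + n))"
    "affine_outer_measure (E \<inter> open_square (N0 + n)) \<le> ennreal (root 3 4) * m n E" for n
  proof -
    have "E \<inter> open_square (N0 + n) \<subseteq> frontier (C n)"
      using E(2) frontier_Int_open_eq[of "open_square (N0 + n)" K] unfolding C_def by auto
    then show "ennreal (1 / 39) * m n E \<le> affine_outer_measure (E \<inter> open_square (N0 + n))"
      "affine_outer_measure (E \<inter> open_square (N0 + n)) \<le> ennreal (root 3 4) * m n E"
      unfolding m_def \<nu>_def using E(1) compact_affine_arclength_bounds[OF region_C] by auto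
  qed
  show "ennreal (1 / 39) * (SUP n. m n E) \<le> affine_outer_measure E"
    unfolding SUP_mult_left_ennreal affine_outer_measure_eq_SUP_squares[OF E(1)]
    by (rule SUP_mono) (use n(1) in blast)
  show "affine_outer_measure E \<le> ennreal (root 3 4) * (SUP n. m n E)"
    unfolding SUP_mult_left_ennreal affine_outer_measure_eq_SUP_squares[OF E(1)]
    by (rule SUP_mono) (use n(2) in blast)
qed

end

lemma affine_arclength_bounds:
  assumes K: "open K" "convex K" "K \<noteq> {}" and E: "E \<in> sets borel" "E \<subseteq> frontier K"
  shows "ennreal (1 / 39) * emeasure (affine_arclength K) E \<le> emeasure affine_measure E"
    and "emeasure affine_measure E \<le> ennreal (root 3 4) * emeasure (affine_arclength K) E"
proof -
  obtain p where p: "p \<in> K" using K(3) by blast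
  have "ennreal (1 / 39) * emeasure (affine_arclength K) E \<le> affine_outer_measure E \<and>
    affine_outer_measure E \<le> ennreal (root 3 4) * emeasure (affine_arclength K) E"
  proof (cases "bounded K")
    case True
    then have "convex_region K p" using K p by unfold_locales
    from compact_affine_arclength_bounds[OF this E] True show ?thesis
      by (simp add: affine_arclength_def)
  next
    case False
    obtain N0 where "p \<in> open_square N0" using in_open_square by blast
    then interpret unbounded_convex_region K p N0 using K p by unfold_locales
    show ?thesis
      using bounds[OF E] False unfolding affine_arclength_def
      by (simp add: emeasure_limit[OF E(1)])
  qed
  then show "ennreal (1 / 39) * emeasure (affine_arclength K) E \<le> emeasure affine_measure E"
    "emeasure affine_measure E \<le> ennreal (root 3 4) * emeasure (affine_arclength K) E"
    by (simp_all only: emeasure_affine_measure[OF E(1)])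
qed

theorem theorem1p2:
  shows "\<exists>A B :: real. 0 < A \<and> A \<le> B \<and>
    (\<forall>K :: (real^2) set. open K \<and> convex K \<and> K \<noteq> {} \<longrightarrow>
      (\<forall>E \<in> sets borel. E \<subseteq> frontier K \<longrightarrow>
         ennreal A * emeasure (affine_arclength K) E \<le> emeasure affine_measure E \<and>
         emeasure affine_measure E \<le> ennreal B * emeasure (affine_arclength K) E))"
proof (intro exI conjI allI ballI impI)
  show "(0 :: real) < 1 / 39" by simp
  have "root 3 1 \<le> root 3 4" by (rule real_root_le_mono) auto
  then show "1 / 39 \<le> root 3 4" by (simp only: real_root_one)
qed (use affine_arclength_bounds in auto)

end
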